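(* Let $H$ be a Hopf algebra over a field $K$. (a) Let $C$ be a coalgebra in $\mathfrak{M}_H$. If the coradical $C_0$ of $C$ is $H$, then there is a coalgebra map $\pi_C:C\to H$ which is a morphism in $\mathfrak{M}_H$ such that $\pi_C|_H=\mathrm{Id}_H$. (b) Let $C$ be a coalgebra in ${}_H\mathfrak{M}_H$. If $C_0=H$, $H$ has an $ad$-invariant integral, and every $C_n$ is a direct summand of $C_{n+1}$ as an object in ${}_H\mathfrak{M}_H$, then there is a coalgebra map $\pi_C:C\to H$ which is a morphism in ${}_H\mathfrak{M}_H$ such that $\pi_C|_H=\mathrm{Id}_H$. (c) Let $C$ be a coalgebra in ${}_H\mathfrak{M}_H$. If $C_0=H$ is semisimple (as an algebra), then there is a coalgebra map $\pi_C:C\to H$ which is a morphism in ${}_H\mathfrak{M}_H$ such that $\pi_C|_H=\mathrm{Id}_H$.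
   Context: $\mathfrak{M}_H$ (resp. ${}_H\mathfrak{M}_H$) is the monoidal category of right $H$-modules (resp. $(H,H)$-bimodules) with tensor product over $K$ and diagonal actions, with unit $K$ (action via $\varepsilon_H$). A coalgebra in it is a right $H$-module coalgebra (resp. $H$-bimodule coalgebra), e.g. $H$ itself with multiplication and $\Delta_H$. $(C_n)_{n\ge0}$ is the coradical filtration of $C$. "$C_0=H$" means that $C_0$ is identified with $H$ as a coalgebra in the relevant category. An $ad$-invariant integral on $H$ is a left and right integral $\lambda\in H^*$ with $\lambda(1)=1$ and $\lambda(\sum h_{(1)}xS(h_{(2)}))=\lambda(\sum S(h_{(1)})xh_{(2)})=\varepsilon(h)\lambda(x)$ for all $h,x\in H$. *)

theory Defs
  imports Complex_Main "HOL-Library.Poly_Mapping"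
begin

section \<open>Tensor powers of a vector space\<close>

text \<open>
  Tensor products are the textbook quotients of free vector spaces by the (multi)linearity
  relations. Since the vector space structure of the factors is a parameter and not part of the
  type, the quotient is not formed as a type: a tensor is written as a formal sum, i.e. as an
  element of the free vector space \<open>'v \<times> 'v \<Rightarrow>\<^sub>0 'k\<close> or \<open>'v \<times> 'v \<times> 'v \<Rightarrow>\<^sub>0 'k\<close>, and equality in the
  tensor product is congruence modulo the relations. In particular a comultiplication
  assigns to an element a formal sum that represents its value in the tensor square; all
  notions below depend only on the class of that sum.
\<close>

definition free_scale :: "'k::field \<Rightarrow> ('i \<Rightarrow>\<^sub>0 'k) \<Rightarrow> ('i \<Rightarrow>\<^sub>0 'k)" where
  "free_scale a t = Poly_Mapping.map ((*) a) t"

abbreviation free_gen :: "'i \<Rightarrow> ('i \<Rightarrow>\<^sub>0 'k::field)" where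
  "free_gen i \<equiv> Poly_Mapping.single i 1"

text \<open>The linear extension of \<open>f\<close>, from the basis to the free vector space.\<close>

definition free_lift ::
  "('k::field \<Rightarrow> 'v \<Rightarrow> 'v::ab_group_add) \<Rightarrow> ('i \<Rightarrow> 'v) \<Rightarrow> ('i \<Rightarrow>\<^sub>0 'k) \<Rightarrow> 'v" where
  "free_lift s f t = (\<Sum>i\<in>Poly_Mapping.keys t. s (Poly_Mapping.lookup t i) (f i))"

lemma lookup_free_scale [simp]:
  "Poly_Mapping.lookup (free_scale a t) i = a * Poly_Mapping.lookup t i"
  by (simp add: free_scale_def Poly_Mapping.map.rep_eq when_def)

lemma vector_space_free_scale: "vector_space free_scale"
  by unfold_locales (auto intro!: poly_mapping_eqI simp: lookup_add algebra_simps)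

inductive_set tensor2_rels ::
  "('k::field \<Rightarrow> 'v \<Rightarrow> 'v::ab_group_add) \<Rightarrow> ('v \<times> 'v \<Rightarrow>\<^sub>0 'k) set"
  for s :: "'k::field \<Rightarrow> 'v \<Rightarrow> 'v::ab_group_add" where
  "free_gen (x + x', y) - free_gen (x, y) - free_gen (x', y) \<in> tensor2_rels s"
| "free_gen (x, y + y') - free_gen (x, y) - free_gen (x, y') \<in> tensor2_rels s"
| "free_gen (s a x, y) - free_scale a (free_gen (x, y)) \<in> tensor2_rels s"
| "free_gen (x, s a y) - free_scale a (free_gen (x, y)) \<in> tensor2_rels s"

inductive_set tensor3_rels ::
  "('k::field \<Rightarrow> 'v \<Rightarrow> 'v::ab_group_add) \<Rightarrow> ('v \<times> 'v \<times> 'v \<Rightarrow>\<^sub>0 'k) set"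
  for s :: "'k::field \<Rightarrow> 'v \<Rightarrow> 'v::ab_group_add" where
  "free_gen (x + x', y, z) - free_gen (x, y, z) - free_gen (x', y, z) \<in> tensor3_rels s"
| "free_gen (x, y + y', z) - free_gen (x, y, z) - free_gen (x, y', z) \<in> tensor3_rels s"
| "free_gen (x, y, z + z') - free_gen (x, y, z) - free_gen (x, y, z') \<in> tensor3_rels s"
| "free_gen (s a x, y, z) - free_scale a (free_gen (x, y, z)) \<in> tensor3_rels s"
| "free_gen (x, s a y, z) - free_scale a (free_gen (x, y, z)) \<in> tensor3_rels s"
| "free_gen (x, y, s a z) - free_scale a (free_gen (x, y, z)) \<in> tensor3_rels s"

definition tensor2_eq ::
  "('k::field \<Rightarrow> 'v \<Rightarrow> 'v::ab_group_add) \<Rightarrow> ('v \<times> 'v \<Rightarrow>\<^sub>0 'k) \<Rightarrow> ('v \<times> 'v \<Rightarrow>\<^sub>0 'k) \<Rightarrow> bool" where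
  "tensor2_eq s t u \<longleftrightarrow> t - u \<in> module.span free_scale (tensor2_rels s)"

definition tensor3_eq ::
  "('k::field \<Rightarrow> 'v \<Rightarrow> 'v::ab_group_add) \<Rightarrow> ('v \<times> 'v \<times> 'v \<Rightarrow>\<^sub>0 'k) \<Rightarrow> ('v \<times> 'v \<times> 'v \<Rightarrow>\<^sub>0 'k) \<Rightarrow> bool"
  where
  "tensor3_eq s t u \<longleftrightarrow> t - u \<in> module.span free_scale (tensor3_rels s)"

text \<open>The image of \<open>A \<otimes> B\<close> in the tensor square, for subspaces \<open>A\<close> and \<open>B\<close>.\<close>

definition tensor2_sub ::
  "('k::field \<Rightarrow> 'v \<Rightarrow> 'v::ab_group_add) \<Rightarrow> 'v set \<Rightarrow> 'v set \<Rightarrow> ('v \<times> 'v \<Rightarrow>\<^sub>0 'k) set" where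
  "tensor2_sub s A B = {t. \<exists>u. Poly_Mapping.keys u \<subseteq> A \<times> B \<and> tensor2_eq s t u}"

text \<open>The map \<open>f \<otimes> g\<close>.\<close>

definition tensor2_map ::
  "('v \<Rightarrow> 'w) \<Rightarrow> ('v \<Rightarrow> 'w) \<Rightarrow> ('v \<times> 'v \<Rightarrow>\<^sub>0 'k::field) \<Rightarrow> ('w \<times> 'w \<Rightarrow>\<^sub>0 'k)" where
  "tensor2_map f g = free_lift free_scale (\<lambda>(x, y). free_gen (f x, g y))"

text \<open>\<open>(\<Sum> x \<otimes> y, \<Sum> x' \<otimes> y') \<mapsto> \<Sum> \<Sum> act x x' \<otimes> act y y'\<close>: the product of \<open>H \<otimes> H\<close> if \<open>act\<close> is the
  product of \<open>H\<close>, and the source of the diagonal actions if \<open>act\<close> is an action.\<close>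

definition tensor2_act ::
  "('u \<Rightarrow> 'v \<Rightarrow> 'w) \<Rightarrow> ('u \<times> 'u \<Rightarrow>\<^sub>0 'k::field) \<Rightarrow> ('v \<times> 'v \<Rightarrow>\<^sub>0 'k) \<Rightarrow> ('w \<times> 'w \<Rightarrow>\<^sub>0 'k)" where
  "tensor2_act act t t' =
    free_lift free_scale (\<lambda>(x, y).
      free_lift free_scale (\<lambda>(x', y'). free_gen (act x x', act y y')) t') t"

section \<open>Coalgebras and Hopf algebras\<close>

locale coalgebra = vector_space scale
  for scale :: "'k::field \<Rightarrow> 'c::ab_group_add \<Rightarrow> 'c" +
  fixes comult :: "'c \<Rightarrow> ('c \<times> 'c \<Rightarrow>\<^sub>0 'k)"
    and counit :: "'c \<Rightarrow> 'k"
  assumes comult_add: "tensor2_eq scale (comult (x + y)) (comult x + comult y)"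
    and comult_scale: "tensor2_eq scale (comult (scale a x)) (free_scale a (comult x))"
    and counit_linear: "Vector_Spaces.linear scale (*) counit"
    and coassoc: "tensor3_eq scale
      (free_lift free_scale
        (\<lambda>(x, y). free_lift free_scale (\<lambda>(x1, x2). free_gen (x1, x2, y)) (comult x)) (comult c))
      (free_lift free_scale
        (\<lambda>(x, y). free_lift free_scale (\<lambda>(y1, y2). free_gen (x, y1, y2)) (comult y)) (comult c))"
    and counit_left: "free_lift scale (\<lambda>(x, y). scale (counit x) y) (comult c) = c"
    and counit_right: "free_lift scale (\<lambda>(x, y). scale (counit y) x) (comult c) = c"

definition coalgebra_map ::
  "('k::field \<Rightarrow> 'c::ab_group_add \<Rightarrow> 'c) \<Rightarrow> ('c \<Rightarrow> ('c \<times> 'c \<Rightarrow>\<^sub>0 'k)) \<Rightarrow> ('c \<Rightarrow> 'k) \<Rightarrow>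
   ('k \<Rightarrow> 'd::ab_group_add \<Rightarrow> 'd) \<Rightarrow> ('d \<Rightarrow> ('d \<times> 'd \<Rightarrow>\<^sub>0 'k)) \<Rightarrow> ('d \<Rightarrow> 'k) \<Rightarrow>
   ('c \<Rightarrow> 'd) \<Rightarrow> bool" where
  "coalgebra_map sC \<Delta>C \<epsilon>C sD \<Delta>D \<epsilon>D f \<longleftrightarrow>
    Vector_Spaces.linear sC sD f \<and>
    (\<forall>c. tensor2_eq sD (\<Delta>D (f c)) (tensor2_map f f (\<Delta>C c))) \<and>
    (\<forall>c. \<epsilon>D (f c) = \<epsilon>C c)"

text \<open>The class \<open>ring_1\<close> demands \<open>0 \<noteq> 1\<close>, which for a bialgebra is no restriction since
  \<open>\<epsilon>\<close> maps \<open>1\<close> to \<open>1\<close>.\<close>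

locale bialgebra = coalgebra scale comult counit
  for scale :: "'k::field \<Rightarrow> 'h::ring_1 \<Rightarrow> 'h" and comult counit +
  assumes scale_mult_left: "scale a (x * y) = scale a x * y"
    and scale_mult_right: "scale a (x * y) = x * scale a y"
    and comult_one: "tensor2_eq scale (comult 1) (free_gen (1, 1))"
    and comult_mult: "tensor2_eq scale (comult (x * y)) (tensor2_act (*) (comult x) (comult y))"
    and counit_one: "counit 1 = 1"
    and counit_mult: "counit (x * y) = counit x * counit y"

locale hopf_algebra = bialgebra scale comult counit
  for scale :: "'k::field \<Rightarrow> 'h::ring_1 \<Rightarrow> 'h" and comult counit +
  fixes antipode :: "'h \<Rightarrow> 'h"
  assumes antipode_linear: "Vector_Spaces.linear scale scale antipode"
    and antipode_left: "free_lift scale (\<lambda>(x, y). antipode x * y) (comult h) = scale (counit h) 1"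
    and antipode_right: "free_lift scale (\<lambda>(x, y). x * antipode y) (comult h) = scale (counit h) 1"

section \<open>Coalgebras in the categories of modules and of bimodules\<close>

locale right_module_coalgebra =
  H: bialgebra scaleH comultH counitH + C: coalgebra scale comult counit
  for scaleH :: "'k::field \<Rightarrow> 'h::ring_1 \<Rightarrow> 'h" and comultH counitH
    and scale :: "'k \<Rightarrow> 'c::ab_group_add \<Rightarrow> 'c" and comult counit +
  fixes ract :: "'c \<Rightarrow> 'h \<Rightarrow> 'c"
  assumes ract_add_left: "ract (x + y) h = ract x h + ract y h"
    and ract_add_right: "ract x (h + g) = ract x h + ract x g"
    and ract_scale_left: "ract (scale a x) h = scale a (ract x h)"
    and ract_scale_right: "ract x (scaleH a h) = scale a (ract x h)"
    and ract_one: "ract x 1 = x"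
    and ract_mult: "ract x (h * g) = ract (ract x h) g"
    and comult_ract: "tensor2_eq scale (comult (ract x h)) (tensor2_act ract (comult x) (comultH h))"
    and counit_ract: "counit (ract x h) = counit x * counitH h"

locale left_module_coalgebra =
  H: bialgebra scaleH comultH counitH + C: coalgebra scale comult counit
  for scaleH :: "'k::field \<Rightarrow> 'h::ring_1 \<Rightarrow> 'h" and comultH counitH
    and scale :: "'k \<Rightarrow> 'c::ab_group_add \<Rightarrow> 'c" and comult counit +
  fixes lact :: "'h \<Rightarrow> 'c \<Rightarrow> 'c"
  assumes lact_add_left: "lact (h + g) x = lact h x + lact g x"
    and lact_add_right: "lact h (x + y) = lact h x + lact h y"
    and lact_scale_left: "lact (scaleH a h) x = scale a (lact h x)"
    and lact_scale_right: "lact h (scale a x) = scale a (lact h x)"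
    and lact_one: "lact 1 x = x"
    and lact_mult: "lact (h * g) x = lact h (lact g x)"
    and comult_lact: "tensor2_eq scale (comult (lact h x)) (tensor2_act lact (comultH h) (comult x))"
    and counit_lact: "counit (lact h x) = counitH h * counit x"

locale bimodule_coalgebra =
  left_module_coalgebra scaleH comultH counitH scale comult counit lact +
  right_module_coalgebra scaleH comultH counitH scale comult counit ract
  for scaleH :: "'k::field \<Rightarrow> 'h::ring_1 \<Rightarrow> 'h" and comultH counitH
    and scale :: "'k \<Rightarrow> 'c::ab_group_add \<Rightarrow> 'c" and comult counit
    and lact :: "'h \<Rightarrow> 'c \<Rightarrow> 'c" and ract :: "'c \<Rightarrow> 'h \<Rightarrow> 'c" +
  assumes lact_ract: "ract (lact h x) g = lact h (ract x g)"

definition sub_bimodule ::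
  "('k::field \<Rightarrow> 'c::ab_group_add \<Rightarrow> 'c) \<Rightarrow> ('h \<Rightarrow> 'c \<Rightarrow> 'c) \<Rightarrow> ('c \<Rightarrow> 'h \<Rightarrow> 'c) \<Rightarrow> 'c set \<Rightarrow> bool" where
  "sub_bimodule s lact ract D \<longleftrightarrow>
    module.subspace s D \<and> (\<forall>h. \<forall>x\<in>D. lact h x \<in> D \<and> ract x h \<in> D)"

definition bimodule_direct_summand ::
  "('k::field \<Rightarrow> 'c::ab_group_add \<Rightarrow> 'c) \<Rightarrow> ('h \<Rightarrow> 'c \<Rightarrow> 'c) \<Rightarrow> ('c \<Rightarrow> 'h \<Rightarrow> 'c) \<Rightarrow>
   'c set \<Rightarrow> 'c set \<Rightarrow> bool" where
  "bimodule_direct_summand s lact ract A B \<longleftrightarrow>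
    sub_bimodule s lact ract A \<and> sub_bimodule s lact ract B \<and>
    (\<exists>D. sub_bimodule s lact ract D \<and> A \<inter> D = {0} \<and> {x + y | x y. x \<in> A \<and> y \<in> D} = B)"

section \<open>The coradical filtration\<close>

definition subcoalgebra ::
  "('k::field \<Rightarrow> 'c::ab_group_add \<Rightarrow> 'c) \<Rightarrow> ('c \<Rightarrow> ('c \<times> 'c \<Rightarrow>\<^sub>0 'k)) \<Rightarrow> 'c set \<Rightarrow> bool" where
  "subcoalgebra s \<Delta> D \<longleftrightarrow> module.subspace s D \<and> (\<forall>d\<in>D. \<Delta> d \<in> tensor2_sub s D D)"

definition simple_subcoalgebra ::
  "('k::field \<Rightarrow> 'c::ab_group_add \<Rightarrow> 'c) \<Rightarrow> ('c \<Rightarrow> ('c \<times> 'c \<Rightarrow>\<^sub>0 'k)) \<Rightarrow> 'c set \<Rightarrow> bool" where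
  "simple_subcoalgebra s \<Delta> D \<longleftrightarrow>
    subcoalgebra s \<Delta> D \<and> D \<noteq> {0} \<and>
    (\<forall>E. subcoalgebra s \<Delta> E \<and> E \<subseteq> D \<longrightarrow> E = {0} \<or> E = D)"

definition coradical ::
  "('k::field \<Rightarrow> 'c::ab_group_add \<Rightarrow> 'c) \<Rightarrow> ('c \<Rightarrow> ('c \<times> 'c \<Rightarrow>\<^sub>0 'k)) \<Rightarrow> 'c set" where
  "coradical s \<Delta> = module.span s (\<Union> {D. simple_subcoalgebra s \<Delta> D})"

text \<open>\<open>C\<^sub>n\<^sub>+\<^sub>1\<close> is the preimage of \<open>C \<otimes> C\<^sub>n + C\<^sub>0 \<otimes> C\<close> under \<open>\<Delta>\<close>.\<close>

primrec coradical_filtration ::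
  "('k::field \<Rightarrow> 'c::ab_group_add \<Rightarrow> 'c) \<Rightarrow> ('c \<Rightarrow> ('c \<times> 'c \<Rightarrow>\<^sub>0 'k)) \<Rightarrow> nat \<Rightarrow> 'c set" where
  "coradical_filtration s \<Delta> 0 = coradical s \<Delta>"
| "coradical_filtration s \<Delta> (Suc n) =
    {c. \<exists>t \<in> tensor2_sub s UNIV (coradical_filtration s \<Delta> n).
        \<exists>u \<in> tensor2_sub s (coradical s \<Delta>) UNIV. tensor2_eq s (\<Delta> c) (t + u)}"

text \<open>An identification of the coalgebra \<open>H\<close> with the coradical of \<open>C\<close>, given by the embedding
  of \<open>H\<close> into \<open>C\<close>; its compatibility with the actions of \<open>H\<close> is stated separately.\<close>

definition coradical_identification ::
  "('k::field \<Rightarrow> 'h::ab_group_add \<Rightarrow> 'h) \<Rightarrow> ('h \<Rightarrow> ('h \<times> 'h \<Rightarrow>\<^sub>0 'k)) \<Rightarrow> ('h \<Rightarrow> 'k) \<Rightarrow>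
   ('k \<Rightarrow> 'c::ab_group_add \<Rightarrow> 'c) \<Rightarrow> ('c \<Rightarrow> ('c \<times> 'c \<Rightarrow>\<^sub>0 'k)) \<Rightarrow> ('c \<Rightarrow> 'k) \<Rightarrow>
   ('h \<Rightarrow> 'c) \<Rightarrow> bool" where
  "coradical_identification sH \<Delta>H \<epsilon>H sC \<Delta>C \<epsilon>C \<iota> \<longleftrightarrow>
    coalgebra_map sH \<Delta>H \<epsilon>H sC \<Delta>C \<epsilon>C \<iota> \<and> inj \<iota> \<and> range \<iota> = coradical sC \<Delta>C"

section \<open>Integrals and semisimplicity\<close>

text \<open>Left and right integrals in the dual algebra \<open>H\<^sup>*\<close>: its product is convolution, and its
  augmentation is evaluation at \<open>1\<close>.\<close>

definition convolution ::
  "('h \<Rightarrow> ('h \<times> 'h \<Rightarrow>\<^sub>0 'k::field)) \<Rightarrow> ('h \<Rightarrow> 'k) \<Rightarrow> ('h \<Rightarrow> 'k) \<Rightarrow> 'h \<Rightarrow> 'k" where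
  "convolution \<Delta> f g h = free_lift (*) (\<lambda>(x, y). f x * g y) (\<Delta> h)"

definition left_integral ::
  "('k::field \<Rightarrow> 'h::ring_1 \<Rightarrow> 'h) \<Rightarrow> ('h \<Rightarrow> ('h \<times> 'h \<Rightarrow>\<^sub>0 'k)) \<Rightarrow> ('h \<Rightarrow> 'k) \<Rightarrow> bool" where
  "left_integral s \<Delta> lam \<longleftrightarrow> Vector_Spaces.linear s (*) lam \<and>
    (\<forall>f. Vector_Spaces.linear s (*) f \<longrightarrow> (\<forall>h. convolution \<Delta> f lam h = f 1 * lam h))"

definition right_integral ::
  "('k::field \<Rightarrow> 'h::ring_1 \<Rightarrow> 'h) \<Rightarrow> ('h \<Rightarrow> ('h \<times> 'h \<Rightarrow>\<^sub>0 'k)) \<Rightarrow> ('h \<Rightarrow> 'k) \<Rightarrow> bool" where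
  "right_integral s \<Delta> lam \<longleftrightarrow> Vector_Spaces.linear s (*) lam \<and>
    (\<forall>f. Vector_Spaces.linear s (*) f \<longrightarrow> (\<forall>h. convolution \<Delta> lam f h = lam h * f 1))"

definition ad_invariant_integral ::
  "('k::field \<Rightarrow> 'h::ring_1 \<Rightarrow> 'h) \<Rightarrow> ('h \<Rightarrow> ('h \<times> 'h \<Rightarrow>\<^sub>0 'k)) \<Rightarrow> ('h \<Rightarrow> 'k) \<Rightarrow> ('h \<Rightarrow> 'h) \<Rightarrow>
   ('h \<Rightarrow> 'k) \<Rightarrow> bool" where
  "ad_invariant_integral s \<Delta> \<epsilon> S lam \<longleftrightarrow>
    left_integral s \<Delta> lam \<and> right_integral s \<Delta> lam \<and> lam 1 = 1 \<and>
    (\<forall>h x. lam (free_lift s (\<lambda>(h1, h2). h1 * x * S h2) (\<Delta> h)) = \<epsilon> h * lam x) \<and>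
    (\<forall>h x. lam (free_lift s (\<lambda>(h1, h2). S h1 * x * h2) (\<Delta> h)) = \<epsilon> h * lam x)"

definition left_ideal :: "('k::field \<Rightarrow> 'h::ring_1 \<Rightarrow> 'h) \<Rightarrow> 'h set \<Rightarrow> bool" where
  "left_ideal s I \<longleftrightarrow> module.subspace s I \<and> (\<forall>h. \<forall>x\<in>I. h * x \<in> I)"

definition minimal_left_ideal :: "('k::field \<Rightarrow> 'h::ring_1 \<Rightarrow> 'h) \<Rightarrow> 'h set \<Rightarrow> bool" where
  "minimal_left_ideal s I \<longleftrightarrow>
    left_ideal s I \<and> I \<noteq> {0} \<and> (\<forall>J. left_ideal s J \<and> J \<subseteq> I \<longrightarrow> J = {0} \<or> J = I)"

text \<open>An algebra is semisimple if its left regular module is a sum of simple submodules.\<close>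

definition semisimple_algebra :: "('k::field \<Rightarrow> 'h::ring_1 \<Rightarrow> 'h) \<Rightarrow> bool" where
  "semisimple_algebra s \<longleftrightarrow> module.span s (\<Union> {I. minimal_left_ideal s I}) = UNIV"

end

theory Submission
  imports Defs
begin

text \<open>
  Since \<open>C\<^sub>0 = H\<close> is cosemisimple, \<open>H\<close> has a normalised integral \<open>\<lambda>\<close>, and \<open>\<theta>(x, y) = \<lambda>(x S(y))\<close> makes \<open>H\<close>
  coseparable by right \<open>H\<close>-linear maps, and by \<open>H\<close>-bilinear maps if \<open>\<lambda>\<close> is ad-invariant. Start with
  an \<open>H\<close>-linear retraction \<open>f\<close> of \<open>\<iota>\<close>. If \<open>f\<close> is comultiplicative on \<open>C\<^sub>n\<close>, then
  \<open>\<omega> = \<Delta> f - (f \<otimes> f) \<Delta>\<close> is a 2-cocycle on the \<open>H\<close>-bicomodule \<open>C\<^sub>n\<^sub>+\<^sub>1/C\<^sub>n\<close>, and adding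
  \<open>c \<mapsto> (\<theta> \<otimes> id)(f(c\<^sub>1) \<otimes> \<omega>(c\<^sub>2))\<close> to \<open>f\<close> makes it comultiplicative on \<open>C\<^sub>n\<^sub>+\<^sub>1\<close> without changing it on \<open>C\<^sub>n\<close>.
  The iterates stabilise on every \<open>C\<^sub>n\<close>, and the \<open>C\<^sub>n\<close> exhaust \<open>C\<close>, so they converge to a coalgebra
  map, which is automatically counital because \<open>\<epsilon> - \<epsilon> \<pi>\<close> is an idempotent vanishing on \<open>C\<^sub>0\<close>.

  The initial \<open>f\<close> comes from the splitting of the Hopf modules \<open>C\<^sub>n\<^sub>+\<^sub>1/C\<^sub>n\<close> in case (a), from the given
  complements in case (b), and from averaging over an integral element \<open>\<Lambda>\<close> of \<open>H\<close> in case (c), where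
  \<open>\<Lambda>\<close> also forces \<open>\<lambda>\<close> to be ad-invariant.
\<close>

section \<open>Linear maps and Sweedler sums\<close>

text \<open>Linearity over \<open>H\<close> and comultiplicativity are never arranged together:
  \<theta> is itself compatible with the actions, so correcting an \<open>H\<close>-linear map gives
  an \<open>H\<close>-linear map again. The correction is a Newton step. Its error is quadratic in
  quantities that vanish on C_n, and such products vanish on C_{n+1} because \<Delta> sends C_{n+1}
  into C \<otimes> C_n + C_0 \<otimes> C. For the same reason an identity that is known only on C_0
  may be used on C_{n+1} next to a factor that vanishes on C_n; this replaces all computations in
  C_{n+1}/C_n, and no quotient is formed. Equality of tensors is a congruence of formal sums.
  Tensors are therefore not rewritten but contracted with multilinear maps, and products of two
  functionals suffice to return from contractions to congruences. Two facts are far from the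
  one-sided definition of the filtration by simple subcoalgebras: its left-right symmetry and its
  exhaustion of C. Both are read off from the actions of the dual algebra on C.\<close>

abbreviation lin where "lin \<equiv> Vector_Spaces.linear"

definition bilin where
  "bilin s1 s2 s3 B \<longleftrightarrow> (\<forall>y. lin s1 s3 (\<lambda>x. B x y)) \<and> (\<forall>x. lin s2 s3 (\<lambda>y. B x y))"

definition trilin where
  "trilin s1 s2 s3 s4 T \<longleftrightarrow> (\<forall>y z. lin s1 s4 (\<lambda>x. T x y z)) \<and> (\<forall>x z. lin s2 s4 (\<lambda>y. T x y z))
     \<and> (\<forall>x y. lin s3 s4 (\<lambda>z. T x y z))"

lemma lin_vs: "lin s1 s2 f \<Longrightarrow> vector_space s1" "lin s1 s2 f \<Longrightarrow> vector_space s2"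
  by (simp_all add: Vector_Spaces.linear_def)

lemma lin_add: "lin s1 s2 f \<Longrightarrow> f (x + y) = f x + f y"
  and lin_scale: "lin s1 s2 f \<Longrightarrow> f (s1 a x) = s2 a (f x)"
  by (simp_all add: Vector_Spaces.linear_iff)

lemma lin_zero: "lin s1 s2 f \<Longrightarrow> f 0 = 0"
  and lin_diff: "lin s1 s2 f \<Longrightarrow> f (x - y) = f x - f y"
  and lin_sum: "lin s1 s2 f \<Longrightarrow> f (sum g A) = (\<Sum>i\<in>A. f (g i))"
proof -
  assume "lin s1 s2 f"
  then interpret Vector_Spaces.linear s1 s2 f .
  show "f 0 = 0" "f (x - y) = f x - f y" "f (sum g A) = (\<Sum>i\<in>A. f (g i))"
    by (rule zero diff sum)+
qed

lemma linI: "\<lbrakk>vector_space s1; vector_space s2; \<And>x y. f (x + y) = f x + f y;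
    \<And>a x. f (s1 a x) = s2 a (f x)\<rbrakk> \<Longrightarrow> lin s1 s2 f"
  by (simp add: Vector_Spaces.linear_iff)

lemma vs_add: "vector_space s \<Longrightarrow> s a (x + y) = s a x + s a y"
  and vs_addl: "vector_space s \<Longrightarrow> s (a + b) x = s a x + s b x"
  and vs_scale: "vector_space s \<Longrightarrow> s a (s b x) = s (a * b) x"
  and vs_one: "vector_space s \<Longrightarrow> s 1 x = x"
  and vs_zero: "vector_space s \<Longrightarrow> s 0 x = 0"
  and vs_zeror: "vector_space s \<Longrightarrow> s a 0 = 0"
  and vs_diff: "vector_space s \<Longrightarrow> s a (x - y) = s a x - s a y"
  and vs_sum: "vector_space s \<Longrightarrow> s a (sum g A) = (\<Sum>i\<in>A. s a (g i))"
proof -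
  assume "vector_space s"
  then interpret vector_space s .
  show "s a (x + y) = s a x + s a y" "s (a + b) x = s a x + s b x" "s a (s b x) = s (a * b) x"
    "s 1 x = x" "s 0 x = 0" "s a 0 = 0" "s a (x - y) = s a x - s a y"
    "s a (sum g A) = (\<Sum>i\<in>A. s a (g i))"
    by (simp_all add: scale_right_distrib scale_left_distrib scale_right_diff_distrib scale_sum_right)
qed

lemma vs_K: "vector_space ((*) :: 'k::field \<Rightarrow> 'k \<Rightarrow> 'k)"
  by unfold_locales (auto simp: algebra_simps)

lemma lin_id: "vector_space s \<Longrightarrow> lin s s (\<lambda>x. x)"
  by (rule linI) auto

lemma lin_comp:
  assumes "lin s2 s3 f" "lin s1 s2 g"
  shows "lin s1 s3 (\<lambda>x. f (g x))"
  by (rule linI) (simp_all add: lin_vs[OF assms(1)] lin_vs[OF assms(2)] lin_add[OF assms(1)] lin_add[OF assms(2)]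
      lin_scale[OF assms(1)] lin_scale[OF assms(2)])

lemma lin_plus:
  assumes "lin s1 s2 f" "lin s1 s2 g"
  shows "lin s1 s2 (\<lambda>x. f x + g x)"
  by (rule linI) (simp_all add: lin_vs[OF assms(1)] lin_add[OF assms(1)] lin_add[OF assms(2)]
      lin_scale[OF assms(1)] lin_scale[OF assms(2)] vs_add[OF lin_vs(2)[OF assms(1)]])

lemma lin_minus:
  assumes "lin s1 s2 f" "lin s1 s2 g"
  shows "lin s1 s2 (\<lambda>x. f x - g x)"
  by (rule linI) (simp_all add: lin_vs[OF assms(1)] lin_add[OF assms(1)] lin_add[OF assms(2)]
      lin_scale[OF assms(1)] lin_scale[OF assms(2)] vs_diff[OF lin_vs(2)[OF assms(1)]])

lemma lin_null: "vector_space s1 \<Longrightarrow> vector_space s2 \<Longrightarrow> lin s1 s2 (\<lambda>x. 0)"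
  by (rule linI) (simp_all add: vs_zeror[of s2])

lemma lin_cscale:
  assumes "lin s1 s2 f" shows "lin s1 s2 (\<lambda>x. s2 a (f x))"
  by (rule linI) (simp_all add: lin_vs[OF assms(1)] lin_add[OF assms(1)] mult.commute
      lin_scale[OF assms(1)] vs_add[OF lin_vs(2)[OF assms(1)]] vs_scale[OF lin_vs(2)[OF assms(1)]])

lemma lin_scalel:
  assumes "vector_space s2" "lin s1 (*) f" shows "lin s1 s2 (\<lambda>x. s2 (f x) v)"
  by (rule linI) (simp_all add: lin_vs[OF assms(2)] assms(1) lin_add[OF assms(2)]
      lin_scale[OF assms(2)] vs_addl[OF assms(1)] vs_scale[OF assms(1)])

lemma lin_Kl: assumes "lin s1 (*) f" shows "lin s1 (*) (\<lambda>x. f x * (a::'k::field))"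
  by (rule linI) (simp_all add: lin_vs[OF assms] lin_add[OF assms] lin_scale[OF assms] algebra_simps)

lemma lin_Kr: assumes "lin s1 (*) f" shows "lin s1 (*) (\<lambda>x. (a::'k::field) * f x)"
  by (rule linI) (simp_all add: lin_vs[OF assms] lin_add[OF assms] lin_scale[OF assms] algebra_simps)

lemma bilinI: "(\<And>y. lin s1 s3 (\<lambda>x. B x y)) \<Longrightarrow> (\<And>x. lin s2 s3 (\<lambda>y. B x y)) \<Longrightarrow> bilin s1 s2 s3 B"
  by (simp add: bilin_def)

lemma trilinI: "(\<And>y z. lin s1 s4 (\<lambda>x. T x y z)) \<Longrightarrow> (\<And>x z. lin s2 s4 (\<lambda>y. T x y z))
   \<Longrightarrow> (\<And>x y. lin s3 s4 (\<lambda>z. T x y z)) \<Longrightarrow> trilin s1 s2 s3 s4 T"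
  by (simp add: trilin_def)

lemma bilin_vs: "bilin s1 s2 s3 B \<Longrightarrow> vector_space s3"
  unfolding bilin_def using lin_vs(2) by blast

lemma bilin_l: "bilin s1 s2 s3 B \<Longrightarrow> lin s s1 g \<Longrightarrow> lin s s3 (\<lambda>x. B (g x) y)"
  using lin_comp[of s1 s3 "\<lambda>x. B x y" s g] by (simp add: bilin_def)

lemma bilin_r: "bilin s1 s2 s3 B \<Longrightarrow> lin s s2 g \<Longrightarrow> lin s s3 (\<lambda>x. B y (g x))"
  using lin_comp[of s2 s3 "\<lambda>x. B y x" s g] by (simp add: bilin_def)

lemma trilin_1: "trilin s1 s2 s3 s4 T \<Longrightarrow> lin s s1 g \<Longrightarrow> lin s s4 (\<lambda>x. T (g x) y z)"
  using lin_comp[of s1 s4 "\<lambda>x. T x y z" s g] by (simp add: trilin_def)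
lemma trilin_2: "trilin s1 s2 s3 s4 T \<Longrightarrow> lin s s2 g \<Longrightarrow> lin s s4 (\<lambda>x. T y (g x) z)"
  using lin_comp[of s2 s4 "\<lambda>x. T y x z" s g] by (simp add: trilin_def)
lemma trilin_3: "trilin s1 s2 s3 s4 T \<Longrightarrow> lin s s3 g \<Longrightarrow> lin s s4 (\<lambda>x. T y z (g x))"
  using lin_comp[of s3 s4 "\<lambda>x. T y z x" s g] by (simp add: trilin_def)

lemma free_lift_superset:
  assumes "vector_space s" "finite A" "Poly_Mapping.keys t \<subseteq> A"
  shows "free_lift s f t = (\<Sum>i\<in>A. s (Poly_Mapping.lookup t i) (f i))"
  unfolding free_lift_def
  by (rule sum.mono_neutral_left) (use assms(2,3) in \<open>auto simp: in_keys_iff vs_zero[OF assms(1)]\<close>)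

lemma lin_free_lift:
  assumes "vector_space s" shows "lin free_scale s (free_lift s f)"
proof (rule linI)
  fix t u :: "'c \<Rightarrow>\<^sub>0 'a" and a
  let ?A = "Poly_Mapping.keys t \<union> Poly_Mapping.keys u"
  have k: "Poly_Mapping.keys (t + u) \<subseteq> ?A" by (rule Poly_Mapping.keys_add)
  show "free_lift s f (t + u) = free_lift s f t + free_lift s f u"
    using k by (simp add: free_lift_superset[OF assms, of ?A] lookup_add vs_addl[OF assms] sum.distrib)
  have k: "Poly_Mapping.keys (free_scale a t) \<subseteq> Poly_Mapping.keys t" by (auto simp: in_keys_iff)
  show "free_lift s f (free_scale a t) = s a (free_lift s f t)"
    using k by (simp add: free_lift_superset[OF assms, of "Poly_Mapping.keys t"] vs_sum[OF assms] vs_scale[OF assms])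
qed (use assms vector_space_free_scale in auto)

lemma free_lift_gen: "vector_space s \<Longrightarrow> free_lift s f (free_gen i) = f i"
  by (simp add: free_lift_def vs_one[of s])

lemma lin_free_lift_comp: "lin s s' L \<Longrightarrow> L (free_lift s f t) = free_lift s' (\<lambda>i. L (f i)) t"
  by (simp add: free_lift_def lin_sum[of s s' L] lin_scale[of s s' L])

lemma free_lift_free_lift:
  "vector_space s \<Longrightarrow> free_lift s f (free_lift free_scale g t) = free_lift s (\<lambda>i. free_lift s f (g i)) t"
  by (rule lin_free_lift_comp[OF lin_free_lift])

text \<open>\<open>sw s (\<Delta> c) B\<close> is the Sweedler sum \<open>\<Sum> B c\<^sub>1 c\<^sub>2\<close>. Keeping both legs bound by the
  function \<open>B\<close> turns coassociativity and the counit laws into rewrite rules for nested sums, whose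
  only side conditions are (multi)linearity.\<close>

definition sw :: "('k::field \<Rightarrow> 'v \<Rightarrow> 'v::ab_group_add) \<Rightarrow> ('i \<times> 'j \<Rightarrow>\<^sub>0 'k) \<Rightarrow> ('i \<Rightarrow> 'j \<Rightarrow> 'v) \<Rightarrow> 'v" where
  "sw s t B = free_lift s (\<lambda>(x, y). B x y) t"

lemma sw_sum: "sw s t B = (\<Sum>i\<in>Poly_Mapping.keys t. s (Poly_Mapping.lookup t i) (B (fst i) (snd i)))"
  by (simp add: sw_def free_lift_def case_prod_unfold)

lemma sw_plus: "vector_space s \<Longrightarrow> sw s (t + u) B = sw s t B + sw s u B"
  and sw_minus: "vector_space s \<Longrightarrow> sw s (t - u) B = sw s t B - sw s u B"
  and sw_scale: "vector_space s \<Longrightarrow> sw s (free_scale a t) B = s a (sw s t B)"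
  and sw_gen: "vector_space s \<Longrightarrow> sw s (free_gen (x, y)) B = B x y"
  unfolding sw_def by (simp_all add: lin_add[OF lin_free_lift] lin_diff[OF lin_free_lift]
      lin_scale[OF lin_free_lift] free_lift_gen)

lemma sw_add: "vector_space s \<Longrightarrow> sw s t (\<lambda>x y. B x y + B' x y) = sw s t B + sw s t B'"
  and sw_diff: "vector_space s \<Longrightarrow> sw s t (\<lambda>x y. B x y - B' x y) = sw s t B - sw s t B'"
  and sw_zero: "vector_space s \<Longrightarrow> sw s t (\<lambda>x y. 0) = 0"
  by (simp_all add: sw_sum vs_add[of s] vs_diff[of s] vs_zeror[of s] sum.distrib sum_subtractf)

lemma sw_cong: "(\<And>x y. (x, y) \<in> Poly_Mapping.keys t \<Longrightarrow> B x y = B' x y) \<Longrightarrow> sw s t B = sw s t B'"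
  unfolding sw_sum by (rule sum.cong) auto

lemma lin_sw: "lin s s' L \<Longrightarrow> L (sw s t B) = sw s' t (\<lambda>x y. L (B x y))"
  unfolding sw_def by (simp add: lin_free_lift_comp case_prod_unfold)

lemma sw_Kl: "sw (*) t B * (a::'k::field) = sw (*) t (\<lambda>x y. B x y * a)"
  by (simp add: sw_sum sum_distrib_right mult.assoc)
lemma sw_Kr: "(a::'k::field) * sw (*) t B = sw (*) t (\<lambda>x y. a * B x y)"
  by (simp add: sw_sum sum_distrib_left mult.left_commute)

lemma lin_swB: assumes "\<And>u v. lin s1 s2 (\<lambda>x. B x u v)" shows "lin s1 s2 (\<lambda>x. sw s2 t (\<lambda>u v. B x u v))"
proof -
  have v: "vector_space s1" "vector_space s2" using assms lin_vs by blast+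
  show ?thesis
    by (rule linI) (auto simp: v sw_sum lin_add[OF assms] lin_scale[OF assms] vs_add[OF v(2)]
       sum.distrib vs_sum[OF v(2)] vs_scale[OF v(2)] mult.commute)
qed

lemma sw_swap: "vector_space s \<Longrightarrow> sw s t (\<lambda>x y. sw s u (\<lambda>v w. B x y v w)) = sw s u (\<lambda>v w. sw s t (\<lambda>x y. B x y v w))"
  unfolding sw_sum
  by (simp add: vs_sum[of s] vs_scale[of s], subst sum.swap, simp add: mult.commute)

lemma span_lin_zero:
  assumes "lin s1 s2 f" "\<And>x. x \<in> A \<Longrightarrow> f x = 0" "x \<in> module.span s1 A"
  shows "f x = 0"
proof -
  interpret vector_space s1 using assms lin_vs by blast
  show ?thesis using assms(3)
    by (induction rule: span_induct_alt) (use assms in \<open>auto simp: lin_zero[OF assms(1)] lin_add[OF assms(1)] lin_scale[OF assms(1)] vs_zeror[OF lin_vs(2)[OF assms(1)]]\<close>)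
qed

text \<open>The universal property of the tensor square in contracted form: a bilinear map kills
  each of the four kinds of relation, hence their span.\<close>

lemma sw_eq:
  assumes "bilin s1 s1 s B" "tensor2_eq s1 t u" shows "sw s t B = sw s u B"
proof -
  have l: "lin s1 s (\<lambda>x. B x y)" "lin s1 s (\<lambda>x. B y x)" for y using assms by (auto simp: bilin_def)
  have v: "vector_space s" using l lin_vs by blast
  have "free_lift s (\<lambda>(x, y). B x y) (t - u) = 0"
  proof (rule span_lin_zero[OF lin_free_lift[OF v]])
    fix r assume "r \<in> tensor2_rels s1"
    then show "free_lift s (\<lambda>(x, y). B x y) r = 0"
      by (cases) (auto simp: lin_diff[OF lin_free_lift[OF v]] lin_scale[OF lin_free_lift[OF v]] free_lift_gen[OF v]
        lin_add[OF l(1)] lin_add[OF l(2)] lin_scale[OF l(1)] lin_scale[OF l(2)])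
  qed (use assms in \<open>simp add: tensor2_eq_def\<close>)
  then show ?thesis by (simp add: sw_def lin_diff[OF lin_free_lift[OF v]])
qed

lemma free_lift3_eq:
  assumes "trilin s1 s1 s1 s T" "tensor3_eq s1 t u"
  shows "free_lift s (\<lambda>(x, y, z). T x y z) t = free_lift s (\<lambda>(x, y, z). T x y z) u"
proof -
  have l: "lin s1 s (\<lambda>x. T x y z)" "lin s1 s (\<lambda>x. T y x z)"  "lin s1 s (\<lambda>x. T y z x)" for y z
    using assms by (auto simp: trilin_def)
  have v: "vector_space s" using l lin_vs by blast
  have "free_lift s (\<lambda>(x, y, z). T x y z) (t - u) = 0"
  proof (rule span_lin_zero[OF lin_free_lift[OF v]])
    fix r assume "r \<in> tensor3_rels s1"
    then show "free_lift s (\<lambda>(x, y, z). T x y z) r = 0"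
      by (cases) (auto simp: lin_diff[OF lin_free_lift[OF v]] lin_scale[OF lin_free_lift[OF v]] free_lift_gen[OF v]
        lin_add[OF l(1)] lin_add[OF l(2)] lin_scale[OF l(1)] lin_scale[OF l(2)] lin_add[OF l(3)] lin_scale[OF l(3)])
  qed (use assms in \<open>simp add: tensor3_eq_def\<close>)
  then show ?thesis by (simp add: lin_diff[OF lin_free_lift[OF v]])
qed

lemma sw_map: "vector_space s \<Longrightarrow> sw s (tensor2_map f g t) B = sw s t (\<lambda>x y. B (f x) (g y))"
  unfolding sw_def tensor2_map_def
  by (simp add: free_lift_free_lift case_prod_unfold free_lift_gen)

lemma sw_act: "vector_space s \<Longrightarrow> sw s (tensor2_act a t t') B = sw s t (\<lambda>x y. sw s t' (\<lambda>u v. B (a x u) (a y v)))"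
  unfolding sw_def tensor2_act_def
  by (simp add: free_lift_free_lift case_prod_unfold free_lift_gen)

section \<open>Functionals detect subspaces and tensors\<close>

lemma subspace_projection:
  assumes "vector_space s" "module.subspace s W"
  obtains p where "lin s s p" "\<And>x. p x \<in> W" "\<And>x. x \<in> W \<Longrightarrow> p x = x"
proof -
  interpret vector_space s by fact
  interpret P: vector_space_pair s s by unfold_locales
  obtain B where B: "B \<subseteq> W" "independent B" "W \<subseteq> span B" by (metis basis_exists)
  have sp: "span B = W" using B assms(2) by (simp add: span_minimal subset_antisym)
  let ?p = "P.construct B (\<lambda>x. x)"
  have lp: "lin s s ?p" by (rule P.linear_construct[OF B(2)])
  have "?p x \<in> W" for x using P.construct_in_span[OF B(2), of "\<lambda>x. x" x] sp by simp
  moreover have "?p x = x" if "x \<in> W" for x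
    using P.linear_eq_on[OF lp lin_id[OF assms(1)]] P.construct_basis[OF B(2)] that sp by metis
  ultimately show ?thesis using that lp by blast
qed

lemma separating_functional:
  assumes "vector_space s" "module.subspace s W" "x \<notin> W"
  obtains f where "lin s (*) f" "\<And>w. w \<in> W \<Longrightarrow> f w = (0::'k::field)" "f x = 1"
proof -
  interpret vector_space s by fact
  interpret P: vector_space_pair s "(*)" by unfold_locales (auto simp: algebra_simps)
  obtain B where B: "B \<subseteq> W" "independent B" "W \<subseteq> span B" by (metis basis_exists)
  have sp: "span B = W" using B assms(2) by (simp add: span_minimal subset_antisym)
  have i: "independent (insert x B)" using B assms sp by (simp add: independent_insertI)
  obtain g where g: "lin s (*) g" "\<forall>y\<in>insert x B. g y = (if y = x then 1 else 0)"
    using P.linear_independent_extend[OF i, of "\<lambda>y. if y = x then 1 else 0"] by blast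
  have "g w = 0" if "w \<in> W" for w
    by (rule span_lin_zero[OF g(1), of B]) (use g B assms that sp in auto)
  then show ?thesis using that g by auto
qed

lemma functionals_separate:
  assumes "vector_space s" "\<And>f. lin s (*) f \<Longrightarrow> f x = (f y :: 'k::field)"
  shows "x = y"
proof (rule ccontr)
  assume "x \<noteq> y"
  interpret vector_space s by fact
  have "x - y \<notin> {0}" using \<open>x \<noteq> y\<close> by simp
  obtain f where f: "lin s (*) f" "f (x - y) = 1"
    by (rule separating_functional[OF assms(1) subspace_single_0 \<open>x - y \<notin> {0}\<close>]) blast
  then show False using assms(2)[OF f(1)] by (simp add: lin_diff[OF f(1)])
qed

text \<open>\<open>E\<close> is a basis of the span of \<open>Y\<close>; its coordinate functionals
  are extended to the whole space, which may be infinite-dimensional, so the expansion is claimed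
  only on \<open>Y\<close>.\<close>

lemma coordinates:
  assumes "vector_space s" "finite Y"
  obtains E and c :: "'v::ab_group_add \<Rightarrow> 'v \<Rightarrow> 'k::field" where "finite E" "\<And>e. lin s (*) (c e)"
    "\<And>y. y \<in> Y \<Longrightarrow> y = (\<Sum>e\<in>E. s (c e y) e)"
proof -
  interpret vector_space s by fact
  interpret P: vector_space_pair s "(*)" by unfold_locales (auto simp: algebra_simps)
  obtain E where E: "E \<subseteq> Y" "independent E" "Y \<subseteq> span E" using basis_exists[of Y] by metis
  have fin: "finite E" using E assms finite_subset by blast
  have "\<exists>g. lin s (*) g \<and> (\<forall>y\<in>E. g y = (if y = e then 1 else 0))" for e
    using P.linear_independent_extend[OF E(2), of "\<lambda>y. if y = e then 1 else 0" for e] by blast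
  then obtain c where c: "\<And>e. lin s (*) (c e)" "\<And>e y. y \<in> E \<Longrightarrow> c e y = (if y = e then 1 else 0)" by metis
  have l: "lin s s (\<lambda>y. (\<Sum>e\<in>E. s (c e y) e) - y)"
    by (rule linI) (auto simp: assms lin_add[OF c(1)] lin_scale[OF c(1)] scale_left_distrib sum.distrib
       scale_right_diff_distrib scale_sum_right)
  have "(\<Sum>e\<in>E. s (c e y) e) - y = 0" if "y \<in> Y" for y
  proof (rule span_lin_zero[OF l])
    fix x assume "x \<in> E"
    then have "(\<Sum>e\<in>E. s (c e x) e) = (\<Sum>e\<in>E. if e = x then x else 0)"
      by (intro sum.cong) (auto simp: c(2) split: if_splits)
    then show "(\<Sum>e\<in>E. s (c e x) e) - x = 0" using \<open>x \<in> E\<close> fin by simp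
  qed (use E that in auto)
  then have "y = (\<Sum>e\<in>E. s (c e y) e)" if "y \<in> Y" for y using that by simp
  then show ?thesis by (rule that[OF fin c(1)])
qed

text \<open>Brings a tensor into the form of a finite sum of a_e \<otimes> e by expanding its
  finitely many right legs in coordinates. The left coefficients a_e are Sweedler sums that do not
  depend on \<open>B\<close>.\<close>

lemma tensor2_expand:
  assumes "vector_space s"
  obtains E :: "'v::ab_group_add set" and c :: "'v \<Rightarrow> 'v \<Rightarrow> 'k::field" where "finite E" "\<And>e. lin s (*) (c e)"
    "\<And>(s2 :: 'k \<Rightarrow> 'w::ab_group_add \<Rightarrow> 'w) B. bilin s s s2 B \<Longrightarrow>
       sw s2 t B = (\<Sum>e\<in>E. B (sw s t (\<lambda>x y. s (c e y) x)) e)"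
proof -
  obtain E and c :: "'v \<Rightarrow> 'v \<Rightarrow> 'k::field" where E: "finite E" "\<And>e. lin s (*) (c e)"
    "\<And>y. y \<in> snd ` Poly_Mapping.keys t \<Longrightarrow> y = (\<Sum>e\<in>E. s (c e y) e)"
    by (rule coordinates[OF assms, of "snd ` Poly_Mapping.keys t"]) (auto intro: finite_imageI finite_keys)
  show ?thesis
  proof (rule that[OF E(1,2)])
    fix s2 :: "'k \<Rightarrow> 'w \<Rightarrow> 'w" and B assume B: "bilin s s s2 B"
    have l: "lin s s2 (\<lambda>x. B x y)" "lin s s2 (\<lambda>x. B y x)" for y using B by (auto simp: bilin_def)
    have v: "vector_space s2" using l lin_vs by blast
    have "sw s2 t B = sw s2 t (\<lambda>x y. \<Sum>e\<in>E. B (s (c e y) x) e)"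
    proof (rule sw_cong)
      fix x y assume "(x, y) \<in> Poly_Mapping.keys t"
      then have "y = (\<Sum>e\<in>E. s (c e y) e)" by (intro E(3)) force
      then have "B x y = B x (\<Sum>e\<in>E. s (c e y) e)" by simp
      also have "\<dots> = (\<Sum>e\<in>E. B (s (c e y) x) e)"
        by (simp add: lin_sum[OF l(2)] lin_scale[OF l(2)] lin_scale[OF l(1)])
      finally show "B x y = (\<Sum>e\<in>E. B (s (c e y) x) e)" .
    qed
    also have "\<dots> = (\<Sum>e\<in>E. sw s2 t (\<lambda>x y. B (s (c e y) x) e))"
      using E(1) by (induction rule: finite_induct) (auto simp: sw_zero[OF v] sw_add[OF v])
    also have "\<dots> = (\<Sum>e\<in>E. B (sw s t (\<lambda>x y. s (c e y) x)) e)"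
      by (simp add: lin_sw[OF l(1)])
    finally show "sw s2 t B = (\<Sum>e\<in>E. B (sw s t (\<lambda>x y. s (c e y) x)) e)" .
  qed
qed

lemma sw_free_gen: "sw free_scale t (\<lambda>x y. free_gen (x, y)) = t"
proof (rule poly_mapping_eqI)
  fix i
  have "Poly_Mapping.lookup (sw free_scale t (\<lambda>x y. free_gen (x, y))) i
      = (\<Sum>k\<in>Poly_Mapping.keys t. if k = i then Poly_Mapping.lookup t k else 0)"
    unfolding sw_sum lookup_sum by (intro sum.cong) (auto simp: lookup_single when_def)
  also have "\<dots> = Poly_Mapping.lookup t i" by (simp add: in_keys_iff)
  finally show "Poly_Mapping.lookup (sw free_scale t (\<lambda>x y. free_gen (x, y))) i = Poly_Mapping.lookup t i" .
qed

lemma span_base: "vector_space s \<Longrightarrow> x \<in> A \<Longrightarrow> x \<in> module.span s A"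
  by (rule module.span_base) (simp_all add: module_iff_vector_space)

text \<open>The converse of \<open>sw_eq\<close>, with products of functionals as the only test
  maps. Subtracting a linear projection onto the span of the relations gives a map \<open>q\<close>
  that models the quotient inside the free space, and \<open>B\<close> is the universal bilinear map
  into it. After expansion of the right legs every left coefficient of \<open>t - u\<close> is
  killed by all functionals, so \<open>q\<close> vanishes at \<open>t - u\<close>.\<close>

lemma tensor2_eqI:
  fixes s :: "'k::field \<Rightarrow> 'v \<Rightarrow> 'v::ab_group_add"
  assumes "vector_space s"
    and eq: "\<And>f g. lin s (*) f \<Longrightarrow> lin s (*) g \<Longrightarrow> sw (*) t (\<lambda>x y. f x * g y) = sw (*) u (\<lambda>x y. f x * g y)"
  shows "tensor2_eq s t u"
proof -
  let ?R = "module.span free_scale (tensor2_rels s)"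
  interpret F: vector_space "free_scale :: 'k \<Rightarrow> ('v \<times> 'v \<Rightarrow>\<^sub>0 'k) \<Rightarrow> _" by (rule vector_space_free_scale)
  obtain p :: "('v \<times> 'v \<Rightarrow>\<^sub>0 'k) \<Rightarrow> ('v \<times> 'v \<Rightarrow>\<^sub>0 'k)" where p: "lin free_scale free_scale p" "\<And>x. p x \<in> ?R"
      "\<And>x. x \<in> ?R \<Longrightarrow> p x = x"
    by (rule subspace_projection[OF vector_space_free_scale F.subspace_span]) blast
  define q where "q w = w - p w" for w
  have q: "lin free_scale free_scale q" unfolding q_def
    by (intro lin_minus lin_id p vector_space_free_scale)
  have q0: "q r = 0" if "r \<in> tensor2_rels s" for r
    using p(3)[OF span_base[OF vector_space_free_scale that]] by (simp add: q_def)
  define B where "B x y = q (free_gen (x, y))" for x y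
  have B: "bilin s s free_scale B"
  proof (intro bilinI linI assms vector_space_free_scale)
    fix x y z a
    show "B (x + y) z = B x z + B y z"
      using q0[OF tensor2_rels.intros(1), of x y z] by (simp add: lin_diff[OF q] lin_add[OF q] B_def algebra_simps)
    show "B z (x + y) = B z x + B z y"
      using q0[OF tensor2_rels.intros(2), of z x y] by (simp add: lin_diff[OF q] lin_add[OF q] B_def algebra_simps)
    show "B (s a x) z = free_scale a (B x z)"
      using q0[OF tensor2_rels.intros(3), of a x z] by (simp add: lin_diff[OF q] lin_scale[OF q] B_def algebra_simps)
    show "B z (s a x) = free_scale a (B z x)"
      using q0[OF tensor2_rels.intros(4), of z a x] by (simp add: lin_diff[OF q] lin_scale[OF q] B_def algebra_simps)
  qed
  have "q (t - u) = sw free_scale (t - u) B"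
    unfolding B_def by (subst lin_sw[OF q, symmetric]) (simp add: sw_free_gen)
  also have "\<dots> = 0"
  proof -
    obtain E :: "'v set" and c where E: "finite E" "\<And>e. lin s (*) (c e)"
      "\<And>B :: 'v \<Rightarrow> 'v \<Rightarrow> ('v \<times> 'v \<Rightarrow>\<^sub>0 'k). bilin s s free_scale B \<Longrightarrow>
       sw free_scale (t - u) B = (\<Sum>e\<in>E. B (sw s (t - u) (\<lambda>x y. s (c e y) x)) e)"
      by (rule tensor2_expand[where s = s and t = "t - u" and 'w = "'v \<times> 'v \<Rightarrow>\<^sub>0 'k", OF assms(1)]) blast
    have "sw s (t - u) (\<lambda>x y. s (c e y) x) = 0" for e
    proof (rule functionals_separate[OF assms(1)])
      fix f assume f: "lin s (*) f"
      show "f (sw s (t - u) (\<lambda>x y. s (c e y) x)) = f 0"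
        using eq[OF f E(2)]
        by (simp add: lin_sw[OF f] lin_scale[OF f] sw_minus[OF vs_K] lin_zero[OF f] mult.commute)
    qed
    moreover have "B 0 e = 0" for e using B lin_zero[of s free_scale "\<lambda>x. B x e"] by (simp add: bilin_def)
    ultimately show ?thesis by (simp add: E(3)[OF B])
  qed
  finally have "p (t - u) = t - u" by (simp add: q_def)
  with p(2)[of "t - u"] show ?thesis by (simp add: tensor2_eq_def)
qed

lemma keys_free_lift:
  assumes "\<And>i. i \<in> Poly_Mapping.keys t \<Longrightarrow> Poly_Mapping.keys (g i) \<subseteq> A"
  shows "Poly_Mapping.keys (free_lift free_scale g t) \<subseteq> A"
proof
  fix k assume k: "k \<in> Poly_Mapping.keys (free_lift free_scale g t)"
  show "k \<in> A"
  proof (rule ccontr)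
    assume "k \<notin> A"
    then have "Poly_Mapping.lookup (free_lift free_scale g t) k = 0"
      unfolding free_lift_def lookup_sum using assms by (intro sum.neutral) (auto simp: in_keys_iff subset_iff)
    with k show False by (simp add: in_keys_iff)
  qed
qed

lemma keys_tensor2_map:
  assumes "\<And>x. f x \<in> A" "\<And>x. g x \<in> B"
  shows "Poly_Mapping.keys (tensor2_map f g t) \<subseteq> A \<times> B"
  unfolding tensor2_map_def by (rule keys_free_lift) (use assms in \<open>auto split: if_splits\<close>)

lemma tensor2_subI:
  assumes "vector_space s" "\<And>x. p x \<in> A" "\<And>x. q x \<in> B"
    and "\<And>f g. lin s (*) f \<Longrightarrow> lin s (*) g \<Longrightarrow> sw (*) t (\<lambda>x y. f x * g y) = sw (*) t (\<lambda>x y. f (p x) * g (q y))"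
  shows "t \<in> tensor2_sub s A B"
  unfolding tensor2_sub_def mem_Collect_eq
  by (intro exI[of _ "tensor2_map p q t"] conjI keys_tensor2_map assms tensor2_eqI)
    (simp add: sw_map[OF vs_K] assms(4)[symmetric])

lemma sw_in_subspace:
  assumes "vector_space s" "module.subspace s D" "\<And>x y. (x, y) \<in> Poly_Mapping.keys t \<Longrightarrow> B x y \<in> D"
  shows "sw s t B \<in> D"
proof -
  interpret vector_space s by fact
  show ?thesis unfolding sw_sum by (intro subspace_sum[OF assms(2)] subspace_scale[OF assms(2)]) (use assms(3) in auto)
qed

lemma subspace_separate:
  assumes "vector_space s" "module.subspace s W" "\<And>f. lin s (*) f \<Longrightarrow> (\<And>w. w \<in> W \<Longrightarrow> f w = 0) \<Longrightarrow> f x = (0::'k::field)"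
  shows "x \<in> W"
proof (rule ccontr)
  assume "x \<notin> W"
  then obtain f where "lin s (*) f" "\<And>w. w \<in> W \<Longrightarrow> f w = (0::'k)" "f x = 1"
    by (rule separating_functional[OF assms(1,2)]) blast
  then show False using assms(3)[of f] by simp
qed

lemmas lin_rules = lin_plus lin_minus lin_Kl lin_Kr lin_cscale lin_scalel lin_swB bilinI trilinI vs_K lin_id

section \<open>Sweedler calculus in a coalgebra and the actions of its dual algebra\<close>

context coalgebra
begin

abbreviation functional where "functional \<equiv> lin scale ((*) :: 'k \<Rightarrow> 'k \<Rightarrow> 'k)"

lemma vs: "vector_space scale" by (rule vector_space_axioms)

lemma sw_comult_add:
  "bilin scale scale s B \<Longrightarrow> sw s (comult (x + y)) B = sw s (comult x) B + sw s (comult y) B"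
  by (subst sw_eq[OF _ comult_add], assumption, rule sw_plus[OF bilin_vs])

lemma sw_comult_scale:
  "bilin scale scale s B \<Longrightarrow> sw s (comult (scale a x)) B = s a (sw s (comult x) B)"
  by (subst sw_eq[OF _ comult_scale], assumption, rule sw_scale[OF bilin_vs])

lemma lin_comult0: assumes "bilin scale scale s B" shows "lin scale s (\<lambda>x. sw s (comult x) B)"
proof (rule linI)
  show "vector_space s" by (rule bilin_vs[OF assms])
qed (auto simp: vs sw_comult_add[OF assms] sw_comult_scale[OF assms])

lemma lin_comult:
  "lin s1 scale g \<Longrightarrow> (\<And>y. lin scale s (\<lambda>x. B x y)) \<Longrightarrow> (\<And>x. lin scale s (\<lambda>y. B x y))
  \<Longrightarrow> lin s1 s (\<lambda>x. sw s (comult (g x)) (\<lambda>u v. B u v))"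
  by (rule lin_comp[OF lin_comult0 _]) (auto simp: bilin_def)

lemmas lrules = lin_rules lin_comult vs

lemma coassoc_sw:
  assumes "trilin scale scale scale s T"
  shows "sw s (comult c) (\<lambda>x y. sw s (comult x) (\<lambda>x1 x2. T x1 x2 y)) =
   sw s (comult c) (\<lambda>x y. sw s (comult y) (\<lambda>y1 y2. T x y1 y2))"
proof -
  have v: "vector_space s" using assms unfolding trilin_def using lin_vs(2) by blast
  show ?thesis using free_lift3_eq[OF assms coassoc, of c]
    by (simp add: sw_def free_lift_free_lift[OF v] case_prod_unfold free_lift_gen[OF v])
qed

lemma counit_sw_left: "lin scale s L \<Longrightarrow> sw s (comult c) (\<lambda>x y. s (counit x) (L y)) = L c"
  using lin_sw[of scale s L "comult c" "\<lambda>x y. scale (counit x) y"] counit_left[of c]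
  by (simp add: lin_scale[of scale s L] sw_def)

lemma counit_sw_right: "lin scale s L \<Longrightarrow> sw s (comult c) (\<lambda>x y. s (counit y) (L x)) = L c"
  using lin_sw[of scale s L "comult c" "\<lambda>x y. scale (counit y) x"] counit_right[of c]
  by (simp add: lin_scale[of scale s L] sw_def)

text \<open>The actions of the dual algebra on \<open>C\<close> through the left and the right leg of \<open>\<Delta>\<close>; \<open>hitl\<close> is a
  right action in spite of its argument order, whence the reversed product in \<open>hitl_hitl\<close>.\<close>

definition hitl where "hitl f c = sw scale (comult c) (\<lambda>x y. scale (f x) y)"
definition hitr where "hitr f c = sw scale (comult c) (\<lambda>x y. scale (f y) x)"
definition conv where "conv f g c = sw (*) (comult c) (\<lambda>x y. f x * g y :: 'k)"

lemma lin_hitl: assumes "functional f" "lin s scale g" shows "lin s scale (\<lambda>x. hitl f (g x))"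
  unfolding hitl_def by (intro lrules lin_comp[OF assms(1)] assms(2))
lemma lin_hitr: assumes "functional f" "lin s scale g" shows "lin s scale (\<lambda>x. hitr f (g x))"
  unfolding hitr_def by (intro lrules lin_comp[OF assms(1)] assms(2))
lemma lin_conv: assumes "functional f" "functional g" shows "functional (conv f g)"
  unfolding conv_def by (intro lrules lin_comp[OF assms(1)] lin_comp[OF assms(2)])

lemma apply_hitl: "lin scale s L \<Longrightarrow> L (hitl f c) = sw s (comult c) (\<lambda>x y. s (f x) (L y))"
  unfolding hitl_def by (simp add: lin_sw[of scale s L] lin_scale[of scale s L])
lemma apply_hitr: "lin scale s L \<Longrightarrow> L (hitr f c) = sw s (comult c) (\<lambda>x y. s (f y) (L x))"
  unfolding hitr_def by (simp add: lin_sw[of scale s L] lin_scale[of scale s L])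

lemma functional_hitl: "functional g \<Longrightarrow> g (hitl f c) = conv f g c"
  using apply_hitl[of "(*)" g f c] by (simp add: conv_def)
lemma functional_hitr: "functional g \<Longrightarrow> g (hitr f c) = conv g f c"
  using apply_hitr[of "(*)" g f c] by (simp add: conv_def mult.commute)

lemma conv_assoc: assumes "functional f" "functional g" "functional h"
  shows "conv (conv f g) h c = conv f (conv g h) c"
proof -
  have "conv (conv f g) h c = sw (*) (comult c) (\<lambda>x y. sw (*) (comult x) (\<lambda>x1 x2. f x1 * g x2 * h y))"
    unfolding conv_def sw_Kl ..
  also have "\<dots> = sw (*) (comult c) (\<lambda>x y. sw (*) (comult y) (\<lambda>y1 y2. f x * g y1 * h y2))"
    by (rule coassoc_sw) (intro lrules lin_comp[OF assms(1)] lin_comp[OF assms(2)] lin_comp[OF assms(3)])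
  also have "\<dots> = conv f (conv g h) c"
    unfolding conv_def sw_Kr mult.assoc ..
  finally show ?thesis .
qed

lemma hitl_hitl: assumes "functional f" "functional g" shows "hitl f (hitl g c) = hitl (conv g f) c"
proof (rule functionals_separate[OF vs])
  fix h assume h: "functional h"
  show "h (hitl f (hitl g c)) = h (hitl (conv g f) c)"
    unfolding functional_hitl[OF h] using functional_hitl[OF lin_conv[OF assms(1) h], of g c]
      conv_assoc[OF assms(2,1) h] by simp
qed

lemma hitr_hitr: assumes "functional f" "functional g" shows "hitr f (hitr g c) = hitr (conv f g) c"
proof (rule functionals_separate[OF vs])
  fix h assume h: "functional h"
  show "h (hitr f (hitr g c)) = h (hitr (conv f g) c)"
    unfolding functional_hitr[OF h] using functional_hitr[OF lin_conv[OF h assms(1)], of g c]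
      conv_assoc[OF h assms(1,2)] by simp
qed

lemma hitl_hitr: assumes "functional f" "functional g" shows "hitl f (hitr g c) = hitr g (hitl f c)"
proof (rule functionals_separate[OF vs])
  fix h assume h: "functional h"
  show "h (hitl f (hitr g c)) = h (hitr g (hitl f c))"
    unfolding functional_hitr[OF h] functional_hitl[OF h]
    using functional_hitr[OF lin_conv[OF assms(1) h], of g c] functional_hitl[OF lin_conv[OF h assms(2)], of f c]
      conv_assoc[OF assms(1) h assms(2)] by simp
qed

lemma hitl_counit: "hitl counit c = c"
  unfolding hitl_def by (rule counit_sw_left) (rule lin_id[OF vs])

lemma hitl_plus: "hitl (\<lambda>x. f x + g x) c = hitl f c + hitl g c"
  unfolding hitl_def scale_left_distrib by (rule sw_add[OF vs])
lemma hitl_minus: "hitl (\<lambda>x. f x - g x) c = hitl f c - hitl g c"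
  unfolding hitl_def scale_left_diff_distrib by (rule sw_diff[OF vs])

text \<open>The source of local finiteness: the finitely many right legs of the chosen
  representative of \<Delta> c do not depend on \<open>f\<close>.\<close>

lemma hitl_in_span: "hitl f c \<in> span (snd ` Poly_Mapping.keys (comult c))"
  unfolding hitl_def
  by (rule sw_in_subspace[OF vs subspace_span]) (force intro: span_scale span_base)

text \<open>Subcoalgebras are the sub-bimodules for the dual algebra. For the harder direction the
  legs are projected to \<open>D\<close> one at a time: stability under \<open>hitl\<close> allows
  \<open>g\<close> to be replaced by its composite with \<open>p\<close>, and then stability under
  \<open>hitr\<close> does the same for \<open>f\<close>.\<close>

lemma subcoalgebra_iff:
  "subcoalgebra scale comult D \<longleftrightarrow> subspace D \<and> (\<forall>f. functional f \<longrightarrow> (\<forall>d\<in>D. hitl f d \<in> D \<and> hitr f d \<in> D))"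
proof (intro iffI conjI allI impI ballI)
  assume D: "subcoalgebra scale comult D"
  then show sD: "subspace D" by (simp add: subcoalgebra_def)
  fix f d assume f: "functional f" and d: "d \<in> D"
  obtain u where u: "Poly_Mapping.keys u \<subseteq> D \<times> D" "tensor2_eq scale (comult d) u"
    using D d by (auto simp: subcoalgebra_def tensor2_sub_def)
  have "hitl f d = sw scale u (\<lambda>x y. scale (f x) y)"
    unfolding hitl_def by (rule sw_eq[OF _ u(2)]) (intro lrules f)
  then show "hitl f d \<in> D" using u by (auto intro!: sw_in_subspace[OF vs sD] subspace_scale[OF sD])
  have "hitr f d = sw scale u (\<lambda>x y. scale (f y) x)"
    unfolding hitr_def by (rule sw_eq[OF _ u(2)]) (intro lrules f)
  then show "hitr f d \<in> D" using u by (auto intro!: sw_in_subspace[OF vs sD] subspace_scale[OF sD])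
next
  assume D: "subspace D \<and> (\<forall>f. functional f \<longrightarrow> (\<forall>d\<in>D. hitl f d \<in> D \<and> hitr f d \<in> D))"
  obtain p where p: "lin scale scale p" "\<And>x. p x \<in> D" "\<And>x. x \<in> D \<Longrightarrow> p x = x"
    using subspace_projection[OF vs] D by metis
  have "comult d \<in> tensor2_sub scale D D" if d: "d \<in> D" for d
  proof (rule tensor2_subI[OF vs p(2) p(2)])
    fix f g assume f: "functional f" and g: "functional g"
    have fp: "functional (\<lambda>x. f (p x))" and gp: "functional (\<lambda>x. g (p x))" by (intro lin_comp[OF f] lin_comp[OF g] p)+
    have "sw (*) (comult d) (\<lambda>x y. f x * g y) = conv f g d" by (simp add: conv_def)
    also have "\<dots> = g (p (hitl f d))" using p(3) D f d functional_hitl[OF g] by simp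
    also have "\<dots> = conv f (\<lambda>x. g (p x)) d" using functional_hitl[OF gp] by simp
    also have "\<dots> = f (p (hitr (\<lambda>x. g (p x)) d))" using p(3) D gp d functional_hitr[OF f] by simp
    also have "\<dots> = conv (\<lambda>x. f (p x)) (\<lambda>x. g (p x)) d" using functional_hitr[OF fp] by simp
    finally show "sw (*) (comult d) (\<lambda>x y. f x * g y) = sw (*) (comult d) (\<lambda>x y. f (p x) * g (p y))"
      by (simp add: conv_def)
  qed
  then show "subcoalgebra scale comult D" using D by (simp add: subcoalgebra_def)
qed

section \<open>The coradical filtration\<close>

abbreviation "C0 \<equiv> coradical scale comult"
abbreviation "CF \<equiv> coradical_filtration scale comult"

text \<open>The annihilator of \<open>C\<^sub>0\<close>; it is the Jacobson radical of the dual algebra.\<close>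

definition radical_functional where "radical_functional f \<longleftrightarrow> functional f \<and> (\<forall>x\<in>C0. f x = 0)"

lemma radical_functionalD: "radical_functional f \<Longrightarrow> functional f" "radical_functional f \<Longrightarrow> x \<in> C0 \<Longrightarrow> f x = 0" by (auto simp: radical_functional_def)

lemma subcoalgebra_C0: "subcoalgebra scale comult C0"
  unfolding subcoalgebra_iff
proof (intro conjI allI impI ballI)
  show s: "subspace C0" unfolding coradical_def by (rule subspace_span)
  fix f d assume f: "functional f" and d: "d \<in> C0"
  have *: "hitl f d \<in> C0 \<and> hitr f d \<in> C0" using d unfolding coradical_def
  proof (induction rule: span_induct_alt)
    case base
    then show ?case using lin_zero[OF lin_hitl[OF f lin_id[OF vs]]] lin_zero[OF lin_hitr[OF f lin_id[OF vs]]] span_zero by simp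
  next
    case (step c x y)
    then obtain D where D: "simple_subcoalgebra scale comult D" "x \<in> D" by blast
    then have "hitl f x \<in> D" "hitr f x \<in> D" using f subcoalgebra_iff by (auto simp: simple_subcoalgebra_def)
    then have "hitl f x \<in> span (\<Union> {D. simple_subcoalgebra scale comult D})"
      "hitr f x \<in> span (\<Union> {D. simple_subcoalgebra scale comult D})"
      using D by (auto intro!: span_base)
    then show ?case using step
      by (simp add: lin_add[OF lin_hitl[OF f lin_id[OF vs]]] lin_add[OF lin_hitr[OF f lin_id[OF vs]]]
          lin_scale[OF lin_hitl[OF f lin_id[OF vs]]] lin_scale[OF lin_hitr[OF f lin_id[OF vs]]] span_add span_scale)
  qed
  then show "hitl f d \<in> C0" "hitr f d \<in> C0" by auto
qed

text \<open>The form in which membership in \<open>CF (Suc n)\<close> is used: it discards an error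
  term whose left factor vanishes on the coradical and whose right factor vanishes on
  \<open>CF n\<close>.\<close>

lemma filtration_vanish:
  assumes c: "c \<in> CF (Suc n)" and B: "bilin scale scale s B"
    and 0: "\<And>x y. x \<in> C0 \<Longrightarrow> B x y = 0" and n: "\<And>x y. y \<in> CF n \<Longrightarrow> B x y = 0"
  shows "sw s (comult c) B = 0"
proof -
  have v: "vector_space s" using B by (rule bilin_vs)
  obtain t u t' u' where t: "Poly_Mapping.keys t' \<subseteq> UNIV \<times> CF n" "tensor2_eq scale t t'"
    and u: "Poly_Mapping.keys u' \<subseteq> C0 \<times> UNIV" "tensor2_eq scale u u'" and c: "tensor2_eq scale (comult c) (t + u)"
    using c by (auto simp: tensor2_sub_def)
  have "sw s (comult c) B = sw s t B + sw s u B" using sw_eq[OF B c] by (simp add: sw_plus[OF v])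
  also have "sw s t B = sw s t' B" by (rule sw_eq[OF B t(2)])
  also have "\<dots> = sw s t' (\<lambda>x y. 0)" by (rule sw_cong) (use t(1) n in auto)
  also have "sw s u B = sw s u' B" by (rule sw_eq[OF B u(2)])
  also have "\<dots> = sw s u' (\<lambda>x y. 0)" by (rule sw_cong) (use u(1) 0 in auto)
  finally show ?thesis by (simp add: sw_zero[OF v])
qed

text \<open>For the converse let \<open>q\<close> and \<open>p\<close> project onto
  \<open>C0\<close> and \<open>CF n\<close>, and split the left leg as (id - q) + q. A functional
  composed with id - q is radical, so against it the right leg may be projected by \<open>p\<close>;
  the two summands then lie in the two subspaces of the definition. That \<open>CF n\<close> is a
  subspace is a hypothesis here because the induction proving it relies on this lemma.\<close>

lemma filtration_Suc_iff0:
  assumes n: "subspace (CF n)"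
  shows "c \<in> CF (Suc n) \<longleftrightarrow> (\<forall>f. radical_functional f \<longrightarrow> hitl f c \<in> CF n)"
proof (intro iffI allI impI)
  fix f assume c: "c \<in> CF (Suc n)" and f: "radical_functional f"
  show "hitl f c \<in> CF n"
  proof (rule subspace_separate[OF vs n])
    fix \<phi> assume p: "functional \<phi>" "\<And>w. w \<in> CF n \<Longrightarrow> \<phi> w = 0"
    have "conv f \<phi> c = 0" unfolding conv_def
      by (rule filtration_vanish[OF c]) (use f p in \<open>auto intro!: lrules lin_comp[OF radical_functionalD(1)[OF f]] lin_comp[OF p(1)] dest: radical_functionalD\<close>)
    then show "\<phi> (hitl f c) = 0" by (simp add: functional_hitl p)
  qed
next
  assume c: "\<forall>f. radical_functional f \<longrightarrow> hitl f c \<in> CF n"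
  have s0: "subspace C0" using subcoalgebra_C0 by (simp add: subcoalgebra_def)
  obtain p where p: "lin scale scale p" "\<And>x. p x \<in> CF n" "\<And>x. x \<in> CF n \<Longrightarrow> p x = x"
    using subspace_projection[OF vs n] by metis
  obtain q where q: "lin scale scale q" "\<And>x. q x \<in> C0" "\<And>x. x \<in> C0 \<Longrightarrow> q x = x"
    using subspace_projection[OF vs s0] by metis
  let ?t = "tensor2_map (\<lambda>x. x - q x) p (comult c)" and ?u = "tensor2_map q (\<lambda>x. x) (comult c)"
  have "tensor2_eq scale (comult c) (?t + ?u)"
  proof (rule tensor2_eqI[OF vs])
    fix f g assume f: "functional f" and g: "functional g"
    have gp: "functional (\<lambda>x. g (p x))" by (intro lin_comp[OF g] p)
    have "radical_functional (\<lambda>x. f (x - q x))"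
      unfolding radical_functional_def using q(3) by (auto intro!: lin_comp[OF f] lrules lin_comp[OF q(1)] simp: lin_zero[OF f])
    then have "p (hitl (\<lambda>x. f (x - q x)) c) = hitl (\<lambda>x. f (x - q x)) c" using c p by blast
    then have "conv (\<lambda>x. f (x - q x)) (\<lambda>x. g (p x)) c = conv (\<lambda>x. f (x - q x)) g c"
      using functional_hitl[OF gp, of "\<lambda>x. f (x - q x)" c] by (simp add: functional_hitl[OF g])
    then show "sw (*) (comult c) (\<lambda>x y. f x * g y) = sw (*) (?t + ?u) (\<lambda>x y. f x * g y)"
      by (simp add: sw_plus[OF vs_K] sw_map[OF vs_K] conv_def lin_diff[OF f] left_diff_distrib sw_diff[OF vs_K])
  qed
  moreover have "?t \<in> tensor2_sub scale UNIV (CF n)" "?u \<in> tensor2_sub scale C0 UNIV"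
    unfolding tensor2_sub_def using keys_tensor2_map[of "\<lambda>x. x - q x" UNIV p "CF n" "comult c"] p(2)
      keys_tensor2_map[of q C0 "\<lambda>x. x" UNIV "comult c"] q(2)
    by (auto intro!: exI tensor2_eqI[OF vs])
  ultimately show "c \<in> CF (Suc n)" by auto
qed

lemma subspace_CF: "subspace (CF n)"
proof (induction n)
  case 0
  then show ?case using subcoalgebra_C0 by (simp add: subcoalgebra_def)
next
  case (Suc n)
  note i = filtration_Suc_iff0[OF Suc] and l = lin_hitl[OF radical_functionalD(1) lin_id[OF vs]]
  show ?case
    by (rule subspaceI) (use Suc in \<open>auto simp del: coradical_filtration.simps simp: i lin_zero[OF l] lin_add[OF l] lin_scale[OF l]
      intro: subspace_0 subspace_add subspace_scale\<close>)
qed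

lemmas filtration_Suc_iff = filtration_Suc_iff0[OF subspace_CF]

text \<open>Both sides say that all products of \<open>n + 2\<close> functionals in the annihilator of \<open>C\<^sub>0\<close> vanish
  at \<open>c\<close>, which makes the one-sided definition of the filtration symmetric.\<close>

lemma filtration_Suc_iff_r: "c \<in> CF (Suc n) \<longleftrightarrow> (\<forall>f. radical_functional f \<longrightarrow> hitr f c \<in> CF n)"
proof (induction n arbitrary: c)
  case 0
  have iff0: "x \<in> C0 \<longleftrightarrow> (\<forall>g. radical_functional g \<longrightarrow> g x = 0)" for x
    using subspace_separate[OF vs subspace_CF[of 0], of x] by (auto simp: radical_functional_def)
  have "c \<in> CF (Suc 0) \<longleftrightarrow> (\<forall>f. radical_functional f \<longrightarrow> (\<forall>g. radical_functional g \<longrightarrow> conv f g c = 0))"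
    unfolding filtration_Suc_iff coradical_filtration.simps(1) iff0 by (auto simp: functional_hitl radical_functionalD)
  also have "\<dots> \<longleftrightarrow> (\<forall>f. radical_functional f \<longrightarrow> hitr f c \<in> CF 0)"
    unfolding coradical_filtration.simps(1) iff0 by (auto simp: functional_hitr radical_functionalD)
  finally show ?case .
next
  case (Suc n)
  have "c \<in> CF (Suc (Suc n)) \<longleftrightarrow> (\<forall>f. radical_functional f \<longrightarrow> (\<forall>g. radical_functional g \<longrightarrow> hitr g (hitl f c) \<in> CF n))"
    unfolding filtration_Suc_iff[of _ "Suc n"] Suc ..
  also have "\<dots> \<longleftrightarrow> (\<forall>g. radical_functional g \<longrightarrow> (\<forall>f. radical_functional f \<longrightarrow> hitl f (hitr g c) \<in> CF n))"
    by (auto simp: hitl_hitr radical_functionalD(1))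
  also have "\<dots> \<longleftrightarrow> (\<forall>f. radical_functional f \<longrightarrow> hitr f c \<in> CF (Suc n))"
    unfolding filtration_Suc_iff[of _ "n"] ..
  finally show ?case .
qed

text \<open>The two actions commute, so stability under \<open>hitl\<close> follows from the
  description of the next layer by \<open>hitr\<close>, and conversely. This is where the symmetry
  of the filtration pays off.\<close>

lemma subcoalgebra_CF: "subcoalgebra scale comult (CF n)"
proof (induction n)
  case 0
  then show ?case using subcoalgebra_C0 by simp
next
  case (Suc n)
  have st: "hitl f x \<in> CF n" "hitr f x \<in> CF n" if "functional f" "x \<in> CF n" for f x
    using Suc that by (auto simp: subcoalgebra_iff)
  have "hitl f d \<in> CF (Suc n)" if f: "functional f" and d: "d \<in> CF (Suc n)" for f d
    using d st(1)[OF f] by (simp add: filtration_Suc_iff_r hitl_hitr[OF f radical_functionalD(1), symmetric] del: coradical_filtration.simps)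
  moreover have "hitr f d \<in> CF (Suc n)" if f: "functional f" and d: "d \<in> CF (Suc n)" for f d
    using d st(2)[OF f] by (simp add: filtration_Suc_iff hitl_hitr[OF radical_functionalD(1) f] del: coradical_filtration.simps)
  ultimately show ?case using subcoalgebra_iff subspace_CF by blast
qed

lemma CF_Suc: "CF n \<subseteq> CF (Suc n)"
proof (induction n)
  case 0
  have "hitl f x = 0" if f: "radical_functional f" and x: "x \<in> C0" for f x
  proof (rule functionals_separate[OF vs])
    fix g assume g: "functional g"
    then have "hitr g x \<in> C0" using subcoalgebra_C0 subcoalgebra_iff x by blast
    then show "g (hitl f x) = g 0" using functional_hitr[OF radical_functionalD(1)[OF f], of g x] functional_hitl[OF g] radical_functionalD(2)[OF f]
      by (simp add: lin_zero[OF g])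
  qed
  then show ?case using subspace_0[OF subspace_CF[of 0]]
    by (auto simp only: coradical_filtration.simps(1) filtration_Suc_iff)
next
  case (Suc n)
  then show ?case unfolding subset_iff filtration_Suc_iff[of _ "Suc n"] filtration_Suc_iff[of _ n] by blast
qed

lemma CF_mono: "m \<le> n \<Longrightarrow> CF m \<subseteq> CF n"
  by (rule lift_Suc_mono_le[of CF]) (use CF_Suc in auto)

text \<open>The mirror image of \<open>filtration_vanish\<close>. It does not come from the
  definition but from \<open>filtration_Suc_iff_r\<close>, by splitting the right leg with a
  projection onto the coradical.\<close>

lemma filtration_vanish_r:
  assumes c: "c \<in> CF (Suc n)" and B: "bilin scale scale s B"
    and 0: "\<And>x y. y \<in> C0 \<Longrightarrow> B x y = 0" and n: "\<And>x y. x \<in> CF n \<Longrightarrow> B x y = 0"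
  shows "sw s (comult c) B = 0"
proof -
  have v: "vector_space s" using B by (rule bilin_vs)
  obtain p where p: "lin scale scale p" "\<And>x. p x \<in> CF n" "\<And>x. x \<in> CF n \<Longrightarrow> p x = x"
    using subspace_projection[OF vs subspace_CF] by metis
  have s0: "subspace C0" using subcoalgebra_C0 by (simp add: subcoalgebra_def)
  obtain q where q: "lin scale scale q" "\<And>x. q x \<in> C0" "\<And>x. x \<in> C0 \<Longrightarrow> q x = x"
    using subspace_projection[OF vs s0] by metis
  let ?t = "tensor2_map p (\<lambda>x. x - q x) (comult c)" and ?u = "tensor2_map (\<lambda>x. x) q (comult c)"
  have "tensor2_eq scale (comult c) (?t + ?u)"
  proof (rule tensor2_eqI[OF vs])
    fix f g assume f: "functional f" and g: "functional g"
    have fp: "functional (\<lambda>x. f (p x))" by (intro lin_comp[OF f] p)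
    have "radical_functional (\<lambda>x. g (x - q x))"
      unfolding radical_functional_def using q(3) by (auto intro!: lin_comp[OF g] lrules lin_comp[OF q(1)] simp: lin_zero[OF g])
    then have "p (hitr (\<lambda>x. g (x - q x)) c) = hitr (\<lambda>x. g (x - q x)) c" using c p filtration_Suc_iff_r by blast
    then have "conv (\<lambda>x. f (p x)) (\<lambda>x. g (x - q x)) c = conv f (\<lambda>x. g (x - q x)) c"
      using functional_hitr[OF fp, of "\<lambda>x. g (x - q x)" c] by (simp add: functional_hitr[OF f])
    then show "sw (*) (comult c) (\<lambda>x y. f x * g y) = sw (*) (?t + ?u) (\<lambda>x y. f x * g y)"
      by (simp add: sw_plus[OF vs_K] sw_map[OF vs_K] conv_def lin_diff[OF g] right_diff_distrib sw_diff[OF vs_K])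
  qed
  then have "sw s (comult c) B = sw s (?t + ?u) B" by (rule sw_eq[OF B])
  also have "\<dots> = 0" by (simp add: sw_plus[OF v] sw_map[OF v] sw_zero[OF v] n p(2) 0 q(2))
  finally show ?thesis .
qed

section \<open>The coradical filtration exhausts the coalgebra\<close>

definition CF_union where "CF_union = (\<Union>n. CF n)"

lemma subspace_CF_union: "subspace CF_union"
proof (rule subspaceI)
  show "0 \<in> CF_union" unfolding CF_union_def using subspace_0[OF subspace_CF[of 0]] by blast
next
  fix x y assume "x \<in> CF_union" "y \<in> CF_union"
  then obtain m n where "x \<in> CF m" "y \<in> CF n" unfolding CF_union_def by blast
  then have "x \<in> CF (max m n)" "y \<in> CF (max m n)" using CF_mono[of m "max m n"] CF_mono[of n "max m n"] by auto
  then show "x + y \<in> CF_union" unfolding CF_union_def using subspace_add[OF subspace_CF] by blast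
next
  fix a x assume "x \<in> CF_union"
  then show "scale a x \<in> CF_union" unfolding CF_union_def using subspace_scale[OF subspace_CF] by blast
qed

lemma hit_CF_union: "functional f \<Longrightarrow> x \<in> CF_union \<Longrightarrow> hitl f x \<in> CF_union"
  using subcoalgebra_CF unfolding CF_union_def subcoalgebra_iff by blast

lemma finite_CF_union: assumes "finite B" "B \<subseteq> CF_union" obtains n where "B \<subseteq> CF n"
proof -
  have "\<exists>n. B \<subseteq> CF n" using assms
  proof (induction rule: finite_induct)
    case (insert x B)
    then obtain m n where "x \<in> CF m" "B \<subseteq> CF n" unfolding CF_union_def by blast
    then have "insert x B \<subseteq> CF (max m n)" using CF_mono[of m "max m n"] CF_mono[of n "max m n"] by auto
    then show ?case ..
  qed simp
  then show ?thesis using that by blast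
qed

text \<open>These are the left coideals, the subspaces N with \<Delta> N inside C \<otimes>
  N.\<close>

definition hit_stable where "hit_stable N \<longleftrightarrow> subspace N \<and> (\<forall>f x. functional f \<longrightarrow> x \<in> N \<longrightarrow> hitl f x \<in> N)"

lemma hit_stableD: "hit_stable N \<Longrightarrow> subspace N" "hit_stable N \<Longrightarrow> functional f \<Longrightarrow> x \<in> N \<Longrightarrow> hitl f x \<in> N"
  by (auto simp: hit_stable_def)

text \<open>The submodule generated by \<open>c\<close> contains \<open>c\<close>, as its image
  under the counit, and is finite-dimensional by \<open>hitl_in_span\<close>. So among the
  finite-dimensional stable subspaces outside \<open>CF_union\<close> one of least dimension can be
  taken; only competitors that are themselves outside \<open>CF_union\<close> are compared with
  it.\<close>

lemma minimal_hit_stable: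
  assumes "c \<notin> CF_union"
  obtains M B where "hit_stable M" "\<not> M \<subseteq> CF_union" "finite B" "M = span B"
    "\<And>N. hit_stable N \<Longrightarrow> N \<subseteq> M \<Longrightarrow> \<not> N \<subseteq> CF_union \<Longrightarrow> N = M"
proof -
  let ?P = "\<lambda>k M. hit_stable M \<and> \<not> M \<subseteq> CF_union \<and> (\<exists>B. finite B \<and> card B = k \<and> M = span B)"
  let ?V = "{hitl f c |f. functional f}"
  have sV: "subspace ?V"
  proof (rule subspaceI)
    have "hitl (\<lambda>x. 0) c = 0" by (simp add: hitl_def sw_zero[OF vs])
    then show "0 \<in> ?V" using lin_null[OF vs vs_K] by (auto intro!: exI[of _ "\<lambda>x. 0"])
  next
    fix x y assume "x \<in> ?V" "y \<in> ?V"
    then show "x + y \<in> ?V" using hitl_plus[symmetric] lin_plus by blast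
  next
    fix a x assume "x \<in> ?V"
    then obtain f where f: "x = hitl f c" "functional f" by blast
    have "scale a x = hitl (\<lambda>y. a * f y) c"
      unfolding f hitl_def by (subst lin_sw[OF lin_cscale[OF lin_id[OF vs]]]) simp
    then show "scale a x \<in> ?V" using lin_Kr[OF f(2)] by blast
  qed
  have "hitl f x \<in> ?V" if "functional f" "x \<in> ?V" for f x
    using that(2) hitl_hitl[OF that(1)] lin_conv[OF _ that(1)] by blast
  then have "hit_stable ?V" unfolding hit_stable_def using sV by blast
  moreover have "c \<in> ?V" unfolding mem_Collect_eq
    by (rule exI[of _ counit], rule conjI, rule hitl_counit[symmetric], rule counit_linear)
  moreover have fV: "\<exists>B. finite B \<and> ?V = span B"
  proof -
    obtain B where B: "B \<subseteq> ?V" "independent B" "?V \<subseteq> span B" by (rule basis_exists[of ?V]) blast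
    have "B \<subseteq> span (snd ` Poly_Mapping.keys (comult c))" using B(1) hitl_in_span by blast
    then have "finite B" using independent_span_bound[of "snd ` Poly_Mapping.keys (comult c)" B] B(2) by auto
    moreover have "?V = span B" using B sV by (simp add: span_minimal subset_antisym)
    ultimately show ?thesis by blast
  qed
  ultimately have VV: "hit_stable ?V" "c \<in> ?V" "\<exists>B. finite B \<and> ?V = span B" by auto
  then obtain B0 where B0: "finite B0" "?V = span B0" by blast
  have "?P (card B0) ?V" using VV(1,2) B0 assms by blast
  then have "\<exists>k M. ?P k M" by blast
  then obtain k where k: "\<exists>M. ?P k M" "\<And>j. j < k \<Longrightarrow> \<not> (\<exists>M. ?P j M)" using exists_least_iff[of "\<lambda>k. \<exists>M. ?P k M"] by blast
  then obtain M B where M: "hit_stable M" "\<not> M \<subseteq> CF_union" "finite B" "card B = k" "M = span B" by blast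
  show ?thesis
  proof (rule that[OF M(1-3) M(5)])
    fix N assume N: "hit_stable N" "N \<subseteq> M" "\<not> N \<subseteq> CF_union"
    obtain A where A: "A \<subseteq> N" "independent A" "N \<subseteq> span A" by (metis basis_exists)
    have sA: "N = span A" using A N(1) by (simp add: hit_stable_def span_minimal subset_antisym)
    have fA: "finite A \<and> card A \<le> card B" using independent_span_bound[of B A] M A N by blast
    then have "?P (card A) N" using N sA by blast
    then have "\<not> card A < k" using k(2)[of "card A"] by blast
    then have cA: "finite A" "card A = k" using fA M(4) by auto
    show "N = M"
    proof (rule ccontr)
      assume "N \<noteq> M"
      then obtain x where x: "x \<in> M" "x \<notin> N" using N by blast
      then have "independent (insert x A)" "x \<notin> A" using A sA independent_insertI[of x A] by auto
      moreover have "insert x A \<subseteq> span B" using M(5) A(1) N(2) x(1) by blast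
      ultimately have "card (insert x A) \<le> card B" using independent_span_bound[OF M(3)] by blast
      then show False using cA \<open>x \<notin> A\<close> M by simp
    qed
  qed
qed

text \<open>Otherwise some element generates a finite-dimensional submodule outside \<open>U = \<Union>C\<^sub>n\<close>; let \<open>M\<close> be
  a minimal one, so \<open>M\<close> is simple modulo \<open>U\<close>. Its coefficient coalgebra \<open>E\<close> is simple: the annihilator
  \<open>L\<close> of a proper subcoalgebra of \<open>E\<close> is an ideal acting nontrivially on \<open>M/(M \<inter> U)\<close>, and a density
  argument produces an element of \<open>L\<close> acting as the identity, which forces the subcoalgebra to
  be \<open>0\<close>. Hence \<open>E \<subseteq> C\<^sub>0\<close>, so the annihilator of \<open>C\<^sub>0\<close> maps \<open>M\<close> into some \<open>C\<^sub>n\<close> and \<open>M \<subseteq> C\<^sub>n\<^sub>+\<^sub>1\<close>.\<close>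

lemma exhaustive: "c \<in> CF_union"
proof (rule ccontr)
  assume "c \<notin> CF_union"
  then obtain M B where M: "hit_stable M" "\<not> M \<subseteq> CF_union" and B: "finite B" "M = span B"
    and Mmin: "\<And>N. hit_stable N \<Longrightarrow> N \<subseteq> M \<Longrightarrow> \<not> N \<subseteq> CF_union \<Longrightarrow> N = M"
    by (rule minimal_hit_stable) blast
  have sM: "subspace M" using M by (simp add: hit_stable_def)
  \<comment> \<open>The matrix coefficients of \<open>M\<close> modulo \<open>CF_union\<close>:
    letting \<open>\<phi>\<close> vanish on \<open>CF_union\<close> is what passes to the quotient.
    Dually, a functional kills \<open>E\<close> exactly if it acts as 0 on that quotient.\<close>
  define E where "E = span {hitr \<phi> m |\<phi> m. functional \<phi> \<and> (\<forall>x\<in>CF_union. \<phi> x = 0) \<and> m \<in> M}"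
  have sE: "subspace E" unfolding E_def by (rule subspace_span)
  have annE: "(\<forall>x\<in>E. f x = 0) \<longleftrightarrow> (\<forall>m\<in>M. hitl f m \<in> CF_union)" if f: "functional f" for f
  proof
    assume 0: "\<forall>x\<in>E. f x = 0"
    show "\<forall>m\<in>M. hitl f m \<in> CF_union"
    proof
      fix m assume m: "m \<in> M"
      show "hitl f m \<in> CF_union"
      proof (rule subspace_separate[OF vs subspace_CF_union])
        fix \<phi> assume p: "functional \<phi>" "\<And>w. w \<in> CF_union \<Longrightarrow> \<phi> w = 0"
        then have "hitr \<phi> m \<in> E" unfolding E_def using m by (blast intro: span_base)
        then show "\<phi> (hitl f m) = 0" using 0 by (simp add: functional_hitl[OF p(1)] flip: functional_hitr[OF f])
      qed
    qed
  next
    assume P: "\<forall>m\<in>M. hitl f m \<in> CF_union"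
    show "\<forall>x\<in>E. f x = 0"
    proof
      fix x assume x: "x \<in> E"
      show "f x = 0"
        by (rule span_lin_zero[OF f _ x[unfolded E_def]])
          (use P in \<open>auto simp: functional_hitr[OF f] simp flip: functional_hitl\<close>)
    qed
  qed
  have subE: "subcoalgebra scale comult E"
    unfolding subcoalgebra_iff
  proof (intro conjI sE allI impI ballI)
    fix f d assume f: "functional f" and d: "d \<in> E"
    note ll = lin_hitl[OF f lin_id[OF vs]] and lr = lin_hitr[OF f lin_id[OF vs]]
    have "hitl f d \<in> E \<and> hitr f d \<in> E" using d[unfolded E_def]
    proof (induction rule: span_induct_alt)
      case base
      then show ?case by (simp add: lin_zero[OF ll] lin_zero[OF lr] subspace_0[OF sE])
    next
      case (step a x y)
      then obtain \<phi> m where x: "x = hitr \<phi> m" "functional \<phi>" "\<forall>x\<in>CF_union. \<phi> x = 0" "m \<in> M" by blast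
      have "hitl f x = hitr \<phi> (hitl f m)" by (simp add: x f hitl_hitr)
      then have 1: "hitl f x \<in> E" unfolding E_def using x hit_stableD(2)[OF M(1) f] by (blast intro: span_base)
      have "hitr f x = hitr (conv f \<phi>) m" by (simp add: x f hitr_hitr)
      moreover have "conv f \<phi> y = 0" if "y \<in> CF_union" for y
        using x(3) hit_CF_union[OF f that] by (simp flip: functional_hitl[OF x(2)])
      ultimately have 2: "hitr f x \<in> E" unfolding E_def using x lin_conv[OF f x(2)] by (blast intro: span_base)
      show ?case using step 1 2
        by (simp add: lin_add[OF ll] lin_add[OF lr] lin_scale[OF ll] lin_scale[OF lr] subspace_add[OF sE] subspace_scale[OF sE])
    qed
    then show "hitl f d \<in> E" "hitr f d \<in> E" by auto
  qed
  have simple: "F = {0} \<or> F = E" if F: "subcoalgebra scale comult F" "F \<subseteq> E" for F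
  proof (rule ccontr)
    assume nF: "\<not> (F = {0} \<or> F = E)"
    have sF: "subspace F" and hF: "\<And>f x. functional f \<Longrightarrow> x \<in> F \<Longrightarrow> hitl f x \<in> F \<and> hitr f x \<in> F"
      using F(1) by (auto simp: subcoalgebra_iff)
    define L where "L = {f. functional f \<and> (\<forall>x\<in>F. f x = 0)}"
    have LI: "conv f l \<in> L" "conv l f \<in> L" if f: "functional f" and l: "l \<in> L" for f l
      using hF[OF f] f l functional_hitl[of l f, symmetric] functional_hitr[of l f, symmetric] by (auto simp: L_def lin_conv)
    have Lplus: "(\<lambda>x. l x + l' x) \<in> L" "(\<lambda>x. l x - l' x) \<in> L" if "l \<in> L" "l' \<in> L" for l l'
      using that by (auto simp: L_def intro: lin_plus lin_minus)
    have Lf: "functional l" if "l \<in> L" for l using that by (simp add: L_def)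
    have Lhit: "hitl l x \<in> M" if "l \<in> L" "x \<in> M" for l x using hit_stableD(2)[OF M(1)] Lf that by blast
    \<comment> \<open>The elements of \<open>M\<close> that \<open>L\<close> sends into
      \<open>CF_union\<close> form a stable subspace. It is proper, because some \<open>l\<close> in
      \<open>L\<close> is nonzero at a point of \<open>E\<close> outside \<open>F\<close>, so
      minimality of \<open>M\<close> pushes it into \<open>CF_union\<close>.\<close>
    have Z: "m \<in> CF_union" if m: "m \<in> M" "\<And>l. l \<in> L \<Longrightarrow> hitl l m \<in> CF_union" for m
    proof -
      let ?N = "{m \<in> M. \<forall>l\<in>L. hitl l m \<in> CF_union}"
      have "subspace ?N"
        by (rule subspaceI) (use subspace_0[OF sM] subspace_add[OF sM] subspace_scale[OF sM]
          subspace_0[OF subspace_CF_union] subspace_add[OF subspace_CF_union] subspace_scale[OF subspace_CF_union] in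
          \<open>auto simp: lin_zero[OF lin_hitl[OF Lf lin_id[OF vs]]] lin_add[OF lin_hitl[OF Lf lin_id[OF vs]]]
            lin_scale[OF lin_hitl[OF Lf lin_id[OF vs]]]\<close>)
      then have N: "hit_stable ?N"
        unfolding hit_stable_def using hit_stableD(2)[OF M(1)] LI Lf by (auto simp: hitl_hitl)
      have "\<not> E \<subseteq> F" using nF F by auto
      then obtain e where e: "e \<in> E" "e \<notin> F" by blast
      obtain l where l: "functional l" "\<And>x. x \<in> F \<Longrightarrow> l x = 0" "l e = 1"
        by (rule separating_functional[OF vs sF e(2)]) blast
      then have "\<not> (\<forall>m\<in>M. hitl l m \<in> CF_union)" using annE[OF l(1)] e(1) by force
      then have "?N \<noteq> M" using l by (auto simp: L_def)
      then have "?N \<subseteq> CF_union" using Mmin[OF N] by blast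
      then show ?thesis using m by blast
    qed
    \<comment> \<open>The density argument. Given \<open>b\<close> for \<open>X\<close>, let
      \<open>?N\<close> be the orbit of \<open>m\<close> under those elements of \<open>L\<close>
      that already act as 0 on \<open>X\<close> modulo \<open>CF_union\<close>. Either
      \<open>?N = M\<close>, and some such element repairs \<open>b\<close> at \<open>m\<close>
      without disturbing \<open>X\<close>; or \<open>?N\<close> lies in \<open>CF_union\<close>, and
      since \<open>l - conv b l\<close> is one of these elements for every \<open>l\<close> in
      \<open>L\<close>, \<open>Z\<close> shows that \<open>b\<close> is already right at
      \<open>m\<close>.\<close>
    have unit: "\<exists>l\<in>L. \<forall>x\<in>X. hitl l x - x \<in> CF_union" if X: "finite X" "X \<subseteq> M" for X
      using X
    proof (induction rule: finite_induct)
      case empty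
      have "(\<lambda>x. 0) \<in> L" using lin_null[OF vs vs_K] by (simp add: L_def)
      then show ?case by auto
    next
      case (insert m X)
      then obtain b where b: "b \<in> L" "\<And>x. x \<in> X \<Longrightarrow> hitl b x - x \<in> CF_union" by blast
      have mM: "m \<in> M" using insert by auto
      let ?L' = "{l \<in> L. \<forall>x\<in>X. hitl l x \<in> CF_union}"
      let ?N = "{hitl l m |l. l \<in> ?L'}"
      have h0: "hitl (\<lambda>x. 0) y = 0" for y unfolding hitl_def by (simp add: sw_sum)
      then have l0: "(\<lambda>x. 0) \<in> ?L'" using lin_null[OF vs vs_K] subspace_0[OF subspace_CF_union]
        by (simp add: L_def)
      have hs: "hitl (\<lambda>x. a * f x) y = scale a (hitl f y)" for a f y
        unfolding hitl_def by (subst lin_sw[OF lin_cscale[OF lin_id[OF vs]]]) simp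
      have NI: "x \<in> ?N" if "l \<in> ?L'" "hitl l m = x" for l x using that by blast
      have "subspace ?N"
      proof (rule subspaceI)
        show "0 \<in> ?N" using NI[OF l0 h0] .
      next
        fix x y assume "x \<in> ?N" "y \<in> ?N"
        then obtain l l' where l: "l \<in> ?L'" "l' \<in> ?L'" "x = hitl l m" "y = hitl l' m" by blast
        then have "(\<lambda>x. l x + l' x) \<in> ?L'" using Lplus(1) by (auto simp: hitl_plus subspace_add[OF subspace_CF_union])
        then show "x + y \<in> ?N" by (rule NI) (simp add: hitl_plus l)
      next
        fix a x assume "x \<in> ?N"
        then obtain l where l: "l \<in> ?L'" "x = hitl l m" by blast
        then have "(\<lambda>x. a * l x) \<in> ?L'" using lin_Kr by (auto simp: hs subspace_scale[OF subspace_CF_union] L_def)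
        then show "scale a x \<in> ?N" by (rule NI) (simp add: hs l)
      qed
      moreover have "hitl f (hitl l m) \<in> ?N" if f: "functional f" and l: "l \<in> ?L'" for f l
      proof -
        have lL: "l \<in> L" and lX: "\<And>x. x \<in> X \<Longrightarrow> hitl l x \<in> CF_union" using l by auto
        have e: "hitl (conv l f) x = hitl f (hitl l x)" for x by (rule hitl_hitl[OF f Lf[OF lL], symmetric])
        have "conv l f \<in> ?L'" unfolding mem_Collect_eq e using LI(2)[OF f lL] lX hit_CF_union[OF f] by blast
        then show ?thesis by (rule NI) (rule e)
      qed
      ultimately have N: "hit_stable ?N" unfolding hit_stable_def by blast
      have NM: "?N \<subseteq> M" using Lhit mM by blast
      show ?case
      proof (cases "?N \<subseteq> CF_union")
        case False
        then have "?N = M" using Mmin[OF N NM] by blast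
        then have "m - hitl b m \<in> ?N" using mM Lhit[OF b(1) mM] subspace_diff[OF sM] by blast
        then obtain b' where b': "b' \<in> ?L'" "hitl b' m = m - hitl b m" by auto
        let ?l = "\<lambda>x. b x + b' x"
        have "hitl ?l x - x \<in> CF_union" if "x \<in> X" for x
          using subspace_add[OF subspace_CF_union b(2)[OF that], of "hitl b' x"] b' that by (simp add: hitl_plus algebra_simps)
        moreover have "hitl ?l m - m = 0" using b' by (simp add: hitl_plus)
        ultimately show ?thesis using Lplus(1)[OF b(1)] b' subspace_0[OF subspace_CF_union] by (intro bexI[of _ ?l]) auto
      next
        case True
        have "m - hitl b m \<in> CF_union"
        proof (rule Z)
          show "m - hitl b m \<in> M" using mM Lhit[OF b(1) mM] subspace_diff[OF sM] by blast
          fix l assume l: "l \<in> L"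
          have e: "hitl (\<lambda>x. l x - conv b l x) y = hitl l (y - hitl b y)" for y
            by (simp add: hitl_minus lin_diff[OF lin_hitl[OF Lf[OF l] lin_id[OF vs]]] hitl_hitl Lf l b)
          have "hitl l (y - hitl b y) \<in> CF_union" if "y \<in> X" for y
          proof (rule hit_CF_union[OF Lf[OF l]])
            show "y - hitl b y \<in> CF_union" using subspace_neg[OF subspace_CF_union b(2)[OF that]] by simp
          qed
          then have "(\<lambda>x. l x - conv b l x) \<in> ?L'" using Lplus(2)[OF l LI(1)[OF Lf[OF b(1)] l]] e by auto
          then have "hitl (\<lambda>x. l x - conv b l x) m \<in> CF_union" using True by blast
          then show "hitl l (m - hitl b m) \<in> CF_union" by (simp add: e)
        qed
        then have "hitl b m - m \<in> CF_union" using subspace_neg[OF subspace_CF_union] by fastforce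
        then show ?thesis using b by auto
      qed
    qed
    have "B \<subseteq> M" using B span_superset by blast
    then obtain l where l: "l \<in> L" "\<And>x. x \<in> B \<Longrightarrow> hitl l x - x \<in> CF_union" using unit[OF B(1)] by blast
    have "hitl l m - m \<in> CF_union" if "m \<in> M" for m
    proof -
      have "m \<in> span B" using that B by simp
      then show ?thesis
      proof (induction rule: span_induct_alt)
        case base
        then show ?case by (simp add: lin_zero[OF lin_hitl[OF Lf[OF l(1)] lin_id[OF vs]]] subspace_0[OF subspace_CF_union])
      next
        case (step a x y)
        have e: "hitl l (scale a x + y) - (scale a x + y) = scale a (hitl l x - x) + (hitl l y - y)"
          by (simp add: lin_add[OF lin_hitl[OF Lf[OF l(1)] lin_id[OF vs]]] lin_scale[OF lin_hitl[OF Lf[OF l(1)] lin_id[OF vs]]]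
            scale_right_diff_distrib)
        show ?case unfolding e
          by (intro subspace_add[OF subspace_CF_union] subspace_scale[OF subspace_CF_union]) (use step l(2) in auto)
      qed
    qed
    \<comment> \<open>Modulo \<open>CF_union\<close> both \<open>l\<close> and the counit act on
      \<open>M\<close> as the identity, so they agree on \<open>E\<close>. On \<open>F\<close> the
      functional \<open>l\<close> is 0, hence so is the counit, and a subcoalgebra with zero counit
      is zero.\<close>
    then have "\<forall>m\<in>M. hitl (\<lambda>x. l x - counit x) m \<in> CF_union" by (simp add: hitl_minus hitl_counit)
    then have "\<forall>x\<in>E. l x - counit x = 0"
      using annE[OF lin_minus[OF Lf[OF l(1)] counit_linear]] by blast
    then have "\<And>x. x \<in> F \<Longrightarrow> l x - counit x = 0" using F(2) by blast
    then have eF: "\<And>x. x \<in> F \<Longrightarrow> counit x = 0" using l(1) by (simp add: L_def)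
    have "x = 0" if x: "x \<in> F" for x
    proof (rule functionals_separate[OF vs])
      fix g assume g: "functional g"
      have "g x = g (hitl counit x)" by (simp add: hitl_counit)
      also have "\<dots> = counit (hitr g x)" by (simp add: functional_hitl[OF g] functional_hitr[OF counit_linear])
      also have "\<dots> = 0" using eF hF[OF g x] by blast
      finally show "g x = g 0" by (simp add: lin_zero[OF g])
    qed
    then show False using nF subspace_0[OF sF] by blast
  qed
  have "E \<noteq> {0}"
  proof
    assume "E = {0}"
    then have "\<forall>x\<in>E. counit x = 0" using lin_zero[OF counit_linear] by simp
    then have "\<forall>m\<in>M. m \<in> CF_union" using annE[OF counit_linear] hitl_counit by simp
    then show False using M(2) by blast
  qed
  then have "simple_subcoalgebra scale comult E" unfolding simple_subcoalgebra_def using subE simple by blast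
  then have "E \<subseteq> C0" unfolding coradical_def by (blast intro: span_base)
  then have "\<forall>x\<in>E. f x = 0" if "radical_functional f" for f using radical_functionalD(2)[OF that] by blast
  then have JM: "hitl f m \<in> CF_union" if "radical_functional f" "m \<in> M" for f m using annE[OF radical_functionalD(1)[OF that(1)]] that by blast
  have "m \<in> CF_union" if m: "m \<in> M" for m
  proof -
    \<comment> \<open>Finite dimension places the whole of \<open>M \<inter> CF_union\<close> in one
      layer, which gives an \<open>n\<close> that works for all radical functionals at once.\<close>
    obtain A where A: "A \<subseteq> M \<inter> CF_union" "independent A" "M \<inter> CF_union \<subseteq> span A" by (rule basis_exists[of "M \<inter> CF_union"]) blast
    have "finite A" using independent_span_bound[OF B(1) A(2)] A(1) B(2) by blast
    then obtain n where "A \<subseteq> CF n" by (rule finite_CF_union) (use A(1) in auto)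
    then have "M \<inter> CF_union \<subseteq> CF n" by (rule order_trans[OF A(3) span_minimal[OF _ subspace_CF]])
    then have "hitl f m \<in> CF n" if f: "radical_functional f" for f
      using subsetD[OF _ IntI[OF hit_stableD(2)[OF M(1) radical_functionalD(1)[OF f] m] JM[OF f m]]] by simp
    then have "m \<in> CF (Suc n)" unfolding filtration_Suc_iff by blast
    then show ?thesis unfolding CF_union_def by blast
  qed
  then show False using M(2) by blast
qed

end

section \<open>Bialgebras, and the antipode as an anti-homomorphism\<close>

context bialgebra
begin

lemma lin_mult_l: assumes "lin s scale g" shows "lin s scale (\<lambda>x. g x * a)"
  by (rule linI) (simp_all add: vs lin_vs[OF assms] lin_add[OF assms] lin_scale[OF assms] distrib_right scale_mult_left)
lemma lin_mult_r: assumes "lin s scale g" shows "lin s scale (\<lambda>x. a * g x)"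
  by (rule linI) (simp_all add: vs lin_vs[OF assms] lin_add[OF assms] lin_scale[OF assms] distrib_left scale_mult_right)

lemmas lin_eps = lin_comp[OF counit_linear]

lemmas brules = lrules lin_mult_l lin_mult_r lin_eps

lemma mult_sw: assumes B: "bilin scale scale s B"
  shows "sw s (comult (x * y)) B = sw s (comult x) (\<lambda>a b. sw s (comult y) (\<lambda>c d. B (a * c) (b * d)))"
  by (subst sw_eq[OF B comult_mult], rule sw_act[OF bilin_vs[OF B]])

lemma one_sw: assumes B: "bilin scale scale s B"
  shows "sw s (comult 1) B = B 1 1"
  by (subst sw_eq[OF B comult_one], rule sw_gen[OF bilin_vs[OF B]])

end

context hopf_algebra
begin

abbreviation (input) S where "S \<equiv> antipode"

lemmas lin_S = lin_comp[OF antipode_linear]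
lemmas hrules = brules lin_S

lemma antipode_sw_left:
  assumes "lin scale s L" shows "sw s (comult h) (\<lambda>x y. L (S x * y)) = s (counit h) (L 1)"
  using lin_sw[OF assms, of "comult h" "\<lambda>x y. S x * y"] antipode_left[of h]
  by (simp add: sw_def lin_scale[OF assms])

lemma antipode_sw_right:
  assumes "lin scale s L" shows "sw s (comult h) (\<lambda>x y. L (x * S y)) = s (counit h) (L 1)"
  using lin_sw[OF assms, of "comult h" "\<lambda>x y. x * S y"] antipode_right[of h]
  by (simp add: sw_def lin_scale[OF assms])

text \<open>Both sides are convolution inverses of the multiplication.\<close>

lemma antipode_mult: "S (x * y) = S y * S x"
proof -
  let ?w = "sw scale"
  have L: "lin scale scale (\<lambda>z. S u * z * v)" for u v by (intro hrules)
  have e1: "?w (comult x2) (\<lambda>a b. ?w (comult y2) (\<lambda>c d. S (x1 * y1) * (a * c) * (S d * S b)))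
    = scale (counit x2) (scale (counit y2) (S (x1 * y1)))" for x1 x2 y1 y2
  proof -
    have "?w (comult y2) (\<lambda>c d. S (x1 * y1) * (a * c) * (S d * S b)) = scale (counit y2) (S (x1 * y1) * (a * S b))" for a b
    proof -
      have "lin scale scale (\<lambda>z. S (x1 * y1) * a * z * S b)" by (intro hrules)
      from antipode_sw_right[OF this, of y2] show ?thesis by (simp add: mult.assoc)
    qed
    moreover have "?w (comult x2) (\<lambda>a b. scale (counit y2) (S (x1 * y1) * (a * S b))) =
       scale (counit x2) (scale (counit y2) (S (x1 * y1)))"
    proof -
      have "lin scale scale (\<lambda>z. scale (counit y2) (S (x1 * y1) * z))" by (intro hrules)
      from antipode_sw_right[OF this, of x2] show ?thesis by simp
    qed
    ultimately show ?thesis by simp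
  qed
  have e2: "?w (comult x1) (\<lambda>a b. ?w (comult y1) (\<lambda>c d. S (a * c) * (b * d) * (S y2 * S x2)))
    = scale (counit x1) (scale (counit y1) (S y2 * S x2))" for x1 x2 y1 y2
  proof -
    have B: "bilin scale scale scale (\<lambda>a b. S a * b * (S y2 * S x2))" by (intro hrules)
    have l: "lin scale scale (\<lambda>z. z * (S y2 * S x2))" by (intro hrules)
    show ?thesis
      unfolding mult_sw[OF B, symmetric]
      using antipode_sw_left[OF l, of "x1 * y1"] by (simp add: counit_mult)
  qed
  have "S (x * y) = ?w (comult x) (\<lambda>x1 x2. scale (counit x2) (S (x1 * y)))"
    by (rule counit_sw_right[symmetric]) (intro hrules)
  also have "\<dots> = ?w (comult x) (\<lambda>x1 x2. ?w (comult y) (\<lambda>y1 y2. scale (counit y2) (scale (counit x2) (S (x1 * y1)))))"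
    by (subst counit_sw_right) (intro hrules refl)+
  also have "\<dots> = ?w (comult x) (\<lambda>x1 x2. ?w (comult y) (\<lambda>y1 y2.
      ?w (comult x2) (\<lambda>a b. ?w (comult y2) (\<lambda>c d. S (x1 * y1) * (a * c) * (S d * S b)))))"
    unfolding e1 by (simp add: mult.commute)
  also have "\<dots> = ?w (comult x) (\<lambda>x1 x2. ?w (comult x2) (\<lambda>a b. ?w (comult y) (\<lambda>y1 y2.
      ?w (comult y2) (\<lambda>c d. S (x1 * y1) * (a * c) * (S d * S b)))))"
    by (subst sw_swap[OF vs]) (rule refl)
  also have "\<dots> = ?w (comult x) (\<lambda>x1 x2. ?w (comult x1) (\<lambda>a b. ?w (comult y) (\<lambda>y1 y2.
      ?w (comult y2) (\<lambda>c d. S (a * y1) * (b * c) * (S d * S x2)))))"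
    by (rule coassoc_sw[symmetric]) (intro hrules)
  also have "\<dots> = ?w (comult x) (\<lambda>x1 x2. ?w (comult x1) (\<lambda>a b. ?w (comult y) (\<lambda>y1 y2.
      ?w (comult y1) (\<lambda>c d. S (a * c) * (b * d) * (S y2 * S x2)))))"
    by (subst coassoc_sw) (intro hrules refl)+
  also have "\<dots> = ?w (comult x) (\<lambda>x1 x2. ?w (comult y) (\<lambda>y1 y2. ?w (comult x1) (\<lambda>a b.
      ?w (comult y1) (\<lambda>c d. S (a * c) * (b * d) * (S y2 * S x2)))))"
    by (subst sw_swap[OF vs]) (rule refl)
  also have "\<dots> = ?w (comult x) (\<lambda>x1 x2. ?w (comult y) (\<lambda>y1 y2. scale (counit y1) (scale (counit x1) (S y2 * S x2))))"
    unfolding e2 by (simp add: mult.commute)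
  also have "\<dots> = ?w (comult x) (\<lambda>x1 x2. scale (counit x1) (S y * S x2))"
    by (subst counit_sw_left) (intro hrules refl)+
  also have "\<dots> = S y * S x"
    by (rule counit_sw_left) (intro hrules)
  finally show ?thesis .
qed

lemma antipode_one: "S 1 = 1"
proof -
  have "bilin scale scale scale (\<lambda>x y. S x * y)" by (intro hrules)
  from one_sw[OF this] antipode_sw_left[OF lin_id[OF vs], of 1] show ?thesis by (simp add: counit_one)
qed

text \<open>Both sides are convolution inverses of \<Delta>. The trilinear \<open>G\<close>
  contracts \<Delta>(S p) \<Delta>(q) (S \<otimes> S)(\<Delta> r with its legs exchanged); summed
  over the three legs of \<open>h\<close>, it collapses in \<open>p\<close>, \<open>q\<close> to one
  side and in \<open>q\<close>, \<open>r\<close> to the other.\<close>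

lemma antipode_comult:
  assumes B: "bilin scale scale s B"
  shows "sw s (comult (S h)) B = sw s (comult h) (\<lambda>x y. B (S y) (S x))"
proof -
  note v = bilin_vs[OF B]
  note hr = hrules v bilin_l[OF B] bilin_r[OF B]
  define G where "G p q r = sw s (comult (S p)) (\<lambda>u v. sw s (comult q) (\<lambda>a b. sw s (comult r) (\<lambda>c d.
     B (u * a * S d) (v * b * S c))))" for p q r
  have G: "trilin scale scale scale s G" unfolding G_def by (intro hr)
  \<comment> \<open>With the four legs of \<open>t\<close> in the order \<open>a\<close>,
    \<open>b\<close>, \<open>c\<close>, \<open>d\<close>, the inner pair \<open>b\<close>,
    \<open>c\<close> cancels first; this brings \<open>a\<close> and \<open>d\<close>
    together.\<close>
  have e: "sw s (comult t) (\<lambda>q r. sw s (comult q) (\<lambda>a b. sw s (comult r) (\<lambda>c d. F (a * S d) (b * S c)))) = s (counit t) (F 1 1)"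
    if F: "bilin scale scale s F" for F t
  proof -
    note fr = hr bilin_l[OF F] bilin_r[OF F]
    have "sw s (comult t) (\<lambda>q r. sw s (comult q) (\<lambda>a b. sw s (comult r) (\<lambda>c d. F (a * S d) (b * S c)))) =
      sw s (comult t) (\<lambda>a w. sw s (comult w) (\<lambda>b r. sw s (comult r) (\<lambda>c d. F (a * S d) (b * S c))))"
      by (rule coassoc_sw) (intro fr)
    also have "\<dots> = sw s (comult t) (\<lambda>a w. sw s (comult w) (\<lambda>e d. sw s (comult e) (\<lambda>b c. F (a * S d) (b * S c))))"
      by (subst coassoc_sw[symmetric]) (intro fr refl)+
    also have "\<dots> = sw s (comult t) (\<lambda>a w. sw s (comult w) (\<lambda>e d. s (counit e) (F (a * S d) 1)))"
      by (subst antipode_sw_right) (intro fr refl)+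
    also have "\<dots> = sw s (comult t) (\<lambda>a w. F (a * S w) 1)"
      by (subst counit_sw_left) (intro fr refl)+
    also have "\<dots> = s (counit t) (F 1 1)"
      by (rule antipode_sw_right) (intro fr)
    finally show ?thesis .
  qed
  have "sw s (comult h) (\<lambda>x y. B (S y) (S x)) = sw s (comult h) (\<lambda>t r. s (counit t) (sw s (comult r) (\<lambda>c d. B (S d) (S c))))"
    by (rule counit_sw_left[symmetric]) (intro hr)
  also have "\<dots> = sw s (comult h) (\<lambda>t r. sw s (comult t) (\<lambda>p q. G p q r))"
  proof (rule sw_cong)
    fix t r
    let ?F = "\<lambda>x y. sw s (comult r) (\<lambda>c d. B (x * S d) (y * S c))"
    have F: "bilin scale scale s ?F" by (intro hr)
    have "sw s (comult t) (\<lambda>p q. G p q r) = sw s (comult t) (\<lambda>p q. sw s (comult (S p * q)) ?F)"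
      unfolding mult_sw[OF F] G_def ..
    also have "\<dots> = s (counit t) (sw s (comult 1) ?F)"
      by (rule antipode_sw_left) (intro hr)
    finally show "s (counit t) (sw s (comult r) (\<lambda>c d. B (S d) (S c))) = sw s (comult t) (\<lambda>p q. G p q r)"
      unfolding one_sw[OF F] by simp
  qed
  also have "\<dots> = sw s (comult h) (\<lambda>p t. sw s (comult t) (\<lambda>q r. G p q r))"
    by (rule coassoc_sw[OF G])
  also have "\<dots> = sw s (comult h) (\<lambda>p t. s (counit t) (sw s (comult (S p)) B))"
  proof (rule sw_cong)
    fix p t
    have "sw s (comult t) (\<lambda>q r. G p q r) = sw s (comult (S p)) (\<lambda>u v. sw s (comult t) (\<lambda>q r. sw s (comult q) (\<lambda>a b. sw s (comult r) (\<lambda>c d.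
     B (u * a * S d) (v * b * S c)))))"
      unfolding G_def by (rule sw_swap[OF v])
    also have "\<dots> = sw s (comult (S p)) (\<lambda>u v. s (counit t) (B u v))"
    proof (rule sw_cong)
      fix u v
      have F: "bilin scale scale s (\<lambda>x y. B (u * x) (v * y))" by (intro hr)
      show "sw s (comult t) (\<lambda>q r. sw s (comult q) (\<lambda>a b. sw s (comult r) (\<lambda>c d. B (u * a * S d) (v * b * S c)))) = s (counit t) (B u v)"
        using e[OF F, of t] by (simp add: mult.assoc)
    qed
    also have "\<dots> = s (counit t) (sw s (comult (S p)) B)"
      by (rule lin_sw[OF lin_cscale[OF lin_id[OF v]], symmetric])
    finally show "sw s (comult t) (\<lambda>q r. G p q r) = s (counit t) (sw s (comult (S p)) B)" .
  qed
  also have "\<dots> = sw s (comult (S h)) B"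
    by (rule counit_sw_right) (intro hr)
  finally show ?thesis by simp
qed

section \<open>Integrals\<close>

text \<open>The definition tests integrals with functionals only; since these separate points,
  vector-valued \<open>L\<close> are allowed as well.\<close>

lemma left_integral_sw:
  assumes lam: "left_integral scale comult lam" and L: "lin scale s L"
  shows "sw s (comult h) (\<lambda>x y. s (lam y) (L x)) = s (lam h) (L 1)"
proof (rule functionals_separate[OF lin_vs(2)[OF L]])
  fix f assume f: "lin s (*) f"
  have fL: "functional (\<lambda>x. f (L x))" by (rule lin_comp[OF f L])
  have "convolution comult (\<lambda>x. f (L x)) lam h = f (L 1) * lam h"
    using lam fL by (simp add: left_integral_def)
  then show "f (sw s (comult h) (\<lambda>x y. s (lam y) (L x))) = f (s (lam h) (L 1))"
    unfolding lin_sw[OF f] lin_scale[OF f] unfolding convolution_def sw_def by (simp add: mult.commute)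
qed

lemma right_integral_sw:
  assumes lam: "right_integral scale comult lam" and L: "lin scale s L"
  shows "sw s (comult h) (\<lambda>x y. s (lam x) (L y)) = s (lam h) (L 1)"
proof (rule functionals_separate[OF lin_vs(2)[OF L]])
  fix f assume f: "lin s (*) f"
  have fL: "functional (\<lambda>x. f (L x))" by (rule lin_comp[OF f L])
  have "convolution comult lam (\<lambda>x. f (L x)) h = lam h * f (L 1)"
    using lam fL by (simp add: right_integral_def)
  then show "f (sw s (comult h) (\<lambda>x y. s (lam x) (L y))) = f (s (lam h) (L 1))"
    unfolding lin_sw[OF f] lin_scale[OF f] unfolding convolution_def sw_def by (simp add: mult.commute)
qed

text \<open>The form \<open>\<theta>(x, y) = \<lambda>(x S(y))\<close> induces the bicomodule map \<open>x \<otimes> y \<mapsto> x\<^sub>1 \<theta>(x\<^sub>2, y) = \<theta>(x, y\<^sub>1) y\<^sub>2\<close> from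
  \<open>H \<otimes> H\<close> to \<open>H\<close>, which splits \<open>\<Delta>\<close>: it exhibits \<open>H\<close> as a coseparable coalgebra. It is always right
  \<open>H\<close>-linear; ad-invariance makes it left \<open>H\<close>-linear.\<close>

lemma theta_bicolinear:
  assumes lam: "left_integral scale comult lam" and L: "lin scale s L"
  shows "sw s (comult x) (\<lambda>a b. s (lam (b * S y)) (L a)) = sw s (comult y) (\<lambda>a b. s (lam (x * S a)) (L b))"
proof -
  have ll: "functional lam" using lam by (simp add: left_integral_def)
  note hr = hrules lin_comp[OF ll] lin_comp[OF L] lin_vs(2)[OF L]
  \<comment> \<open>Invariance of \<open>lam\<close> at \<open>x * S a\<close> introduces the left
    leg of that product. Its factor \<open>S a2\<close> is placed next to \<open>b\<close>, with
    which it cancels once the sum over \<Delta> y is taken.\<close>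
  have 1: "s (lam (x * S a)) (L b) = sw s (comult x) (\<lambda>x1 x2. sw s (comult a) (\<lambda>a1 a2. s (lam (x2 * S a1)) (L (x1 * (S a2 * b)))))" for a b
  proof -
    have "s (lam (x * S a)) (L b) = sw s (comult (x * S a)) (\<lambda>u v. s (lam v) (L (u * b)))"
      by (subst left_integral_sw[OF lam]) (intro hr, simp)
    also have "\<dots> = sw s (comult x) (\<lambda>x1 x2. sw s (comult (S a)) (\<lambda>c d. s (lam (x2 * d)) (L (x1 * c * b))))"
      by (rule mult_sw) (intro hr)
    also have "\<dots> = sw s (comult x) (\<lambda>x1 x2. sw s (comult a) (\<lambda>a1 a2. s (lam (x2 * S a1)) (L (x1 * (S a2 * b)))))"
      unfolding mult.assoc by (subst antipode_comult) (intro hr refl)+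
    finally show ?thesis .
  qed
  have "sw s (comult y) (\<lambda>a b. s (lam (x * S a)) (L b)) =
     sw s (comult x) (\<lambda>x1 x2. sw s (comult y) (\<lambda>a b. sw s (comult a) (\<lambda>a1 a2. s (lam (x2 * S a1)) (L (x1 * (S a2 * b))))))"
    unfolding 1 by (rule sw_swap[OF lin_vs(2)[OF L]])
  also have "\<dots> = sw s (comult x) (\<lambda>x1 x2. sw s (comult y) (\<lambda>a1 w. sw s (comult w) (\<lambda>a2 b. s (lam (x2 * S a1)) (L (x1 * (S a2 * b))))))"
    by (subst coassoc_sw) (intro hr refl)+
  also have "\<dots> = sw s (comult x) (\<lambda>x1 x2. sw s (comult y) (\<lambda>a1 w. s (counit w) (s (lam (x2 * S a1)) (L (x1 * 1)))))"
    by (subst antipode_sw_left) (intro hr refl)+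
  also have "\<dots> = sw s (comult x) (\<lambda>x1 x2. s (lam (x2 * S y)) (L (x1 * 1)))"
    by (subst counit_sw_right) (intro hr refl)+
  finally show ?thesis by simp
qed

lemma theta_comult:
  assumes "functional lam" "lam 1 = 1"
  shows "sw (*) (comult h) (\<lambda>x y. lam (x * S y)) = counit h"
  using antipode_sw_right[OF assms(1), of h] assms(2) by simp

text \<open>Because S reverses products, the two legs of \<open>h\<close> meet in the middle of the
  argument of \<open>lam\<close> and cancel there; no invariance of \<open>lam\<close> is
  involved.\<close>

lemma theta_right:
  assumes "functional lam"
  shows "sw (*) (comult h) (\<lambda>g k. lam (x * g * S (y * k))) = counit h * lam (x * S y)"
proof -
  have "functional (\<lambda>z. lam (x * z * S y))" by (intro hrules lin_comp[OF assms])
  from antipode_sw_right[OF this, of h] show ?thesis by (simp add: antipode_mult mult.assoc)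
qed

text \<open>In contrast to \<open>theta_right\<close>, the legs of \<open>h\<close> end up at the
  two outer ends of the argument, which is exactly the situation of the first ad-invariance
  identity.\<close>

lemma theta_left:
  assumes "ad_invariant_integral scale comult counit S lam"
  shows "sw (*) (comult h) (\<lambda>g k. lam (g * x * S (k * y))) = counit h * lam (x * S y)"
proof -
  have l: "functional lam" and ad: "lam (free_lift scale (\<lambda>(h1, h2). h1 * z * S h2) (comult h)) = counit h * lam z" for z
    using assms by (auto simp: ad_invariant_integral_def left_integral_def)
  have "sw (*) (comult h) (\<lambda>g k. lam (g * x * S (k * y))) = lam (sw scale (comult h) (\<lambda>g k. g * (x * S y) * S k))"
    by (simp add: lin_sw[OF l] antipode_mult mult.assoc)
  then show ?thesis using ad[of "x * S y"] by (simp add: sw_def)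
qed

section \<open>Integral elements of a semisimple Hopf algebra\<close>

text \<open>The minimal left ideals span \<open>H\<close> and the counit is 1 at the unit, so the
  counit is nonzero on some minimal left ideal. By minimality it is injective there, hence
  \<open>H\<close> acts on this ideal through the counit; \<open>\<Lambda>\<close> is its normalised
  element.\<close>

lemma semisimple_integral_element:
  assumes ss: "semisimple_algebra scale"
  obtains \<Lambda> where "\<And>h. h * \<Lambda> = scale (counit h) \<Lambda>" "\<And>h. \<Lambda> * h = scale (counit h) \<Lambda>" "counit \<Lambda> = 1"
proof -
  have sp: "span (\<Union> {I. minimal_left_ideal scale I}) = UNIV" using ss by (simp add: semisimple_algebra_def)
  have "\<exists>I. minimal_left_ideal scale I \<and> (\<exists>x\<in>I. counit x \<noteq> 0)"
  proof (rule ccontr)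
    assume n: "\<not> ?thesis"
    have "counit 1 = 0"
      by (rule span_lin_zero[OF counit_linear, of "\<Union> {I. minimal_left_ideal scale I}"]) (use n sp in auto)
    then show False by (simp add: counit_one)
  qed
  then obtain I x0 where I: "minimal_left_ideal scale I" "x0 \<in> I" "counit x0 \<noteq> 0" by blast
  have sI: "subspace I" and mI: "\<And>h x. x \<in> I \<Longrightarrow> h * x \<in> I" using I by (auto simp: minimal_left_ideal_def left_ideal_def)
  have "left_ideal scale (I \<inter> {x. counit x = 0})"
    unfolding left_ideal_def
    by (auto intro!: subspaceI simp: subspace_0[OF sI] subspace_add[OF sI] subspace_scale[OF sI] mI lin_zero[OF counit_linear]
        lin_add[OF counit_linear] lin_scale[OF counit_linear] counit_mult)
  moreover have "I \<inter> {x. counit x = 0} \<noteq> I" using I by blast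
  ultimately have I0: "I \<inter> {x. counit x = 0} = {0}" using I(1) unfolding minimal_left_ideal_def by blast
  define \<Lambda> where "\<Lambda> = scale (inverse (counit x0)) x0"
  have LI: "\<Lambda> \<in> I" and eL: "counit \<Lambda> = 1" using I by (auto simp: \<Lambda>_def subspace_scale[OF sI] lin_scale[OF counit_linear])
  have left: "h * \<Lambda> = scale (counit h) \<Lambda>" for h
  proof -
    have "h * \<Lambda> - scale (counit h) \<Lambda> \<in> I" by (intro subspace_diff[OF sI] subspace_scale[OF sI] mI LI)
    moreover have "counit (h * \<Lambda> - scale (counit h) \<Lambda>) = 0"
      by (simp add: lin_diff[OF counit_linear] lin_scale[OF counit_linear] counit_mult eL)
    ultimately have "h * \<Lambda> - scale (counit h) \<Lambda> \<in> {0}" using I0 by blast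
    then show ?thesis by simp
  qed
  have right: "\<Lambda> * h = scale (counit h) \<Lambda>" for h
    \<comment> \<open>\<open>u\<close> spans a left ideal of square \<open>0\<close>, so it annihilates every minimal left ideal.\<close>
  proof -
    define u where "u = \<Lambda> * h - scale (counit h) \<Lambda>"
    have gu: "g * u = scale (counit g) u" for g
      unfolding u_def right_diff_distrib mult.assoc[symmetric] left scale_right_diff_distrib
      by (simp add: scale_mult_left[symmetric] scale_mult_right[symmetric] left mult.commute)
    have eu: "counit u = 0" by (simp add: u_def lin_diff[OF counit_linear] lin_scale[OF counit_linear] counit_mult eL)
    have "u * 1 = 0"
    proof (rule span_lin_zero[where f = "\<lambda>z. u * z" and A = "\<Union> {I. minimal_left_ideal scale I}" and ?s2.0 = scale])
      show "lin scale scale (\<lambda>z. u * z)" by (intro hrules)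
      fix x assume "x \<in> \<Union> {I. minimal_left_ideal scale I}"
      then obtain K where K: "minimal_left_ideal scale K" "x \<in> K" by blast
      have sK: "subspace K" and mK: "\<And>h x. x \<in> K \<Longrightarrow> h * x \<in> K" using K by (auto simp: minimal_left_ideal_def left_ideal_def)
      let ?N = "range (\<lambda>a. scale a (u * x))"
      have "g * scale a (u * x) = scale (a * counit g) (u * x)" for g a
        by (simp add: scale_mult_right[symmetric] mult.assoc[symmetric] gu scale_mult_left[symmetric])
      moreover have "subspace ?N"
      proof (rule subspaceI)
        show "0 \<in> ?N" by (rule image_eqI[of _ _ 0]) simp_all
      next
        fix y z assume "y \<in> ?N" "z \<in> ?N"
        then obtain a b where "y = scale a (u * x)" "z = scale b (u * x)" by blast
        then show "y + z \<in> ?N" by (intro image_eqI[of _ _ "a + b"]) (simp_all add: scale_left_distrib)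
      next
        fix c y assume "y \<in> ?N"
        then obtain a where "y = scale a (u * x)" by blast
        then show "scale c y \<in> ?N" by (intro image_eqI[of _ _ "c * a"]) simp_all
      qed
      ultimately have "left_ideal scale ?N" by (auto simp: left_ideal_def)
      moreover have "?N \<subseteq> K" using subspace_scale[OF sK mK[OF K(2)]] by blast
      ultimately consider "?N = {0}" | "?N = K" using K(1) unfolding minimal_left_ideal_def by blast
      then show "u * x = 0"
      proof cases
        case 1
        have "scale 1 (u * x) \<in> ?N" by blast
        then show ?thesis using 1 by simp
      next
        case 2
        then obtain a where "x = scale a (u * x)" using K(2) by blast
        then have "u * x = u * scale a (u * x)" by simp
        also have "\<dots> = scale a (u * u * x)" by (simp add: scale_mult_right mult.assoc)
        also have "\<dots> = 0" by (simp add: gu eu)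
        finally show ?thesis .
      qed
    qed (simp add: sp)
    then show ?thesis by (simp add: u_def)
  qed
  show ?thesis by (rule that[OF left right eL])
qed

text \<open>The Casimir property of \<Lambda>_1 \<otimes> S(\<Lambda>_2), which makes averaging
  \<open>H\<close>-linear. Insert S(h_2) h_3 at the right end; then h_1 and h_2 combine with
  \<open>\<Lambda>\<close> to h_1 \<Lambda> under \<Delta>, in new numbering, and are
  absorbed.\<close>

lemma integral_element_left:
  assumes L: "\<And>h. h * \<Lambda> = scale (counit h) \<Lambda>" and B: "bilin scale scale s B"
  shows "sw s (comult \<Lambda>) (\<lambda>a b. B (h * a) (S b)) = sw s (comult \<Lambda>) (\<lambda>a b. B a (S b * h))"
proof -
  note v = bilin_vs[OF B]
  note hr = hrules v bilin_l[OF B] bilin_r[OF B]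
  have "sw s (comult \<Lambda>) (\<lambda>a b. B (h * a) (S b)) = sw s (comult h) (\<lambda>h1 w. s (counit w) (sw s (comult \<Lambda>) (\<lambda>a b. B (h1 * a) (S b * 1))))"
    by (subst counit_sw_right) (intro hr, simp)
  also have "\<dots> = sw s (comult h) (\<lambda>h1 w. sw s (comult w) (\<lambda>h2 h3. sw s (comult \<Lambda>) (\<lambda>a b. B (h1 * a) (S b * (S h2 * h3)))))"
    by (subst antipode_sw_left[where L = "\<lambda>z. sw s (comult \<Lambda>) (\<lambda>a b. B (x * a) (S b * z))" for x]) (intro hr refl)+
  also have "\<dots> = sw s (comult h) (\<lambda>u h3. sw s (comult u) (\<lambda>h1 h2. sw s (comult \<Lambda>) (\<lambda>a b. B (h1 * a) (S b * (S h2 * h3)))))"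
    by (rule coassoc_sw[symmetric]) (intro hr)
  also have "\<dots> = sw s (comult h) (\<lambda>u h3. sw s (comult (u * \<Lambda>)) (\<lambda>a b. B a (S b * h3)))"
    by (subst mult_sw) (intro hr, simp add: antipode_mult mult.assoc)
  also have "\<dots> = sw s (comult h) (\<lambda>u h3. s (counit u) (sw s (comult \<Lambda>) (\<lambda>a b. B a (S b * h3))))"
    unfolding L by (subst sw_comult_scale) (intro hr refl)+
  also have "\<dots> = sw s (comult \<Lambda>) (\<lambda>a b. B a (S b * h))"
    by (rule counit_sw_left) (intro hr)
  finally show ?thesis .
qed

text \<open>The Casimir property of S(\<Lambda>_1) \<otimes> \<Lambda>_2. Here the integral absorbs
  from the right: write \<epsilon>(h_2) \<Lambda> as \<Lambda> h_2, and h_1 S(h_2) cancels after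
  expansion.\<close>

lemma integral_element_right:
  assumes L: "\<And>h. \<Lambda> * h = scale (counit h) \<Lambda>" and B: "bilin scale scale s B"
  shows "sw s (comult \<Lambda>) (\<lambda>a b. B (h * S a) b) = sw s (comult \<Lambda>) (\<lambda>a b. B (S a) (b * h))"
proof -
  note v = bilin_vs[OF B]
  note hr = hrules v bilin_l[OF B] bilin_r[OF B]
  have "sw s (comult \<Lambda>) (\<lambda>a b. B (h * S a) b) = sw s (comult h) (\<lambda>u w. s (counit w) (sw s (comult \<Lambda>) (\<lambda>a b. B (u * S a) b)))"
    by (rule counit_sw_right[symmetric]) (intro hr)
  also have "\<dots> = sw s (comult h) (\<lambda>u w. sw s (comult (\<Lambda> * w)) (\<lambda>a b. B (u * S a) b))"
    unfolding L by (subst sw_comult_scale) (intro hr refl)+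
  also have "\<dots> = sw s (comult h) (\<lambda>u w. sw s (comult \<Lambda>) (\<lambda>a b. sw s (comult w) (\<lambda>c d. B (u * S c * S a) (b * d))))"
    by (subst mult_sw) (intro hr, simp add: antipode_mult mult.assoc)
  also have "\<dots> = sw s (comult h) (\<lambda>u w. sw s (comult w) (\<lambda>c d. sw s (comult \<Lambda>) (\<lambda>a b. B (u * S c * S a) (b * d))))"
    by (subst sw_swap[OF v]) (rule refl)
  also have "\<dots> = sw s (comult h) (\<lambda>w d. sw s (comult w) (\<lambda>u c. sw s (comult \<Lambda>) (\<lambda>a b. B (u * S c * S a) (b * d))))"
    by (rule coassoc_sw[symmetric]) (intro hr)
  also have "\<dots> = sw s (comult h) (\<lambda>w d. s (counit w) (sw s (comult \<Lambda>) (\<lambda>a b. B (1 * S a) (b * d))))"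
    by (subst antipode_sw_right[where L = "\<lambda>z. sw s (comult \<Lambda>) (\<lambda>a b. B (z * S a) (b * x))" for x]) (intro hr refl)+
  also have "\<dots> = sw s (comult \<Lambda>) (\<lambda>a b. B (1 * S a) (b * h))"
    by (rule counit_sw_left) (intro hr)
  finally show ?thesis by simp
qed

text \<open>The integral and the integral element recover the antipode: \<lambda>(\<Lambda>) S(y) =
  \<lambda>(\<Lambda> y_1) S(y_2) = \<lambda>(\<Lambda>_1 y_1) \<Lambda>_2 y_2 S(y_3), where the
  last two factors cancel.\<close>

lemma integral_pairing_left:
  assumes lam: "right_integral scale comult lam" and L: "\<And>h. \<Lambda> * h = scale (counit h) \<Lambda>" and l: "lin scale s f"
  shows "sw s (comult \<Lambda>) (\<lambda>a b. s (lam (a * y)) (f b)) = s (lam \<Lambda>) (f (S y))"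
proof -
  have ll: "functional lam" using lam by (simp add: right_integral_def)
  note v = lin_vs(2)[OF l]
  note hr = hrules v lin_comp[OF ll] lin_comp[OF l]
  have "s (lam \<Lambda>) (f (S y)) = sw s (comult y) (\<lambda>u r. s (counit u) (s (lam \<Lambda>) (f (S r))))"
    by (rule counit_sw_left[symmetric]) (intro hr)
  also have "\<dots> = sw s (comult y) (\<lambda>u r. s (lam (\<Lambda> * u)) (f (1 * S r)))"
    by (simp add: L lin_scale[OF ll] vs_scale[OF v])
  also have "\<dots> = sw s (comult y) (\<lambda>u r. sw s (comult (\<Lambda> * u)) (\<lambda>a b. s (lam a) (f (b * S r))))"
    by (subst right_integral_sw[OF lam, where L = "\<lambda>z. f (z * S x)" for x]) (intro hr refl)+
  also have "\<dots> = sw s (comult y) (\<lambda>u r. sw s (comult \<Lambda>) (\<lambda>a b. sw s (comult u) (\<lambda>p q. s (lam (a * p)) (f (b * (q * S r))))))"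
    by (subst mult_sw) (intro hr, simp add: mult.assoc)
  also have "\<dots> = sw s (comult \<Lambda>) (\<lambda>a b. sw s (comult y) (\<lambda>u r. sw s (comult u) (\<lambda>p q. s (lam (a * p)) (f (b * (q * S r))))))"
    by (rule sw_swap[OF v])
  also have "\<dots> = sw s (comult \<Lambda>) (\<lambda>a b. sw s (comult y) (\<lambda>p w. sw s (comult w) (\<lambda>q r. s (lam (a * p)) (f (b * (q * S r))))))"
    by (subst coassoc_sw) (intro hr refl)+
  also have "\<dots> = sw s (comult \<Lambda>) (\<lambda>a b. sw s (comult y) (\<lambda>p w. s (counit w) (s (lam (a * p)) (f (b * 1)))))"
    by (subst antipode_sw_right[where L = "\<lambda>z. s (lam (a * p)) (f (b * z))" for a p b]) (intro hr refl)+
  also have "\<dots> = sw s (comult \<Lambda>) (\<lambda>a b. s (lam (a * y)) (f (b * 1)))"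
    by (subst counit_sw_right) (intro hr refl)+
  finally show ?thesis by simp
qed

lemma integral_pairing_right:
  assumes lam: "left_integral scale comult lam" and L: "\<And>h. h * \<Lambda> = scale (counit h) \<Lambda>" and l: "lin scale s f"
  shows "sw s (comult \<Lambda>) (\<lambda>a b. s (lam (x * b)) (f a)) = s (lam \<Lambda>) (f (S x))"
proof -
  have ll: "functional lam" using lam by (simp add: left_integral_def)
  note v = lin_vs(2)[OF l]
  note hr = hrules v lin_comp[OF ll] lin_comp[OF l]
  have "s (lam \<Lambda>) (f (S x)) = sw s (comult x) (\<lambda>r u. s (counit u) (s (lam \<Lambda>) (f (S r))))"
    by (rule counit_sw_right[symmetric]) (intro hr)
  also have "\<dots> = sw s (comult x) (\<lambda>r u. s (lam (u * \<Lambda>)) (f (S r * 1)))"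
    by (simp add: L lin_scale[OF ll] vs_scale[OF v])
  also have "\<dots> = sw s (comult x) (\<lambda>r u. sw s (comult (u * \<Lambda>)) (\<lambda>a b. s (lam b) (f (S r * a))))"
    by (subst left_integral_sw[OF lam, where L = "\<lambda>z. f (S x * z)" for x]) (intro hr refl)+
  also have "\<dots> = sw s (comult x) (\<lambda>r u. sw s (comult u) (\<lambda>p q. sw s (comult \<Lambda>) (\<lambda>a b. s (lam (q * b)) (f (S r * p * a)))))"
    by (subst mult_sw) (intro hr, simp add: mult.assoc)
  also have "\<dots> = sw s (comult x) (\<lambda>w q. sw s (comult w) (\<lambda>r p. sw s (comult \<Lambda>) (\<lambda>a b. s (lam (q * b)) (f (S r * p * a)))))"
    by (rule coassoc_sw[symmetric]) (intro hr)
  also have "\<dots> = sw s (comult x) (\<lambda>w q. s (counit w) (sw s (comult \<Lambda>) (\<lambda>a b. s (lam (q * b)) (f (1 * a)))))"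
    by (subst antipode_sw_left[where L = "\<lambda>z. sw s (comult \<Lambda>) (\<lambda>a b. s (lam (q * b)) (f (z * a)))" for q]) (intro hr refl)+
  also have "\<dots> = sw s (comult \<Lambda>) (\<lambda>a b. s (lam (x * b)) (f (1 * a)))"
    by (rule counit_sw_left) (intro hr)
  finally show ?thesis by simp
qed

text \<open>Evaluating \<open>\<lambda>(\<Lambda>\<^sub>1 y) \<lambda>(x \<Lambda>\<^sub>2)\<close> in two ways gives \<open>\<lambda>(x S(y)) = \<lambda>(S(x) y)\<close> as soon as \<open>\<lambda>(\<Lambda>) \<noteq> 0\<close>, and
  both invariance identities follow from it without any knowledge of \<open>S\<^sup>2\<close>.\<close>

lemma semisimple_ad_invariant:
  assumes ss: "semisimple_algebra scale"
    and l: "left_integral scale comult lam" and r: "right_integral scale comult lam" and 1: "lam 1 = 1"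
  shows "ad_invariant_integral scale comult counit S lam"
proof -
  obtain \<Lambda> where L: "\<And>h. h * \<Lambda> = scale (counit h) \<Lambda>" "\<And>h. \<Lambda> * h = scale (counit h) \<Lambda>" "counit \<Lambda> = 1"
    by (rule semisimple_integral_element[OF ss]) blast
  have ll: "functional lam" using l by (simp add: left_integral_def)
  note hr = hrules lin_comp[OF ll]
  \<comment> \<open>Normalisation gives \<lambda>(\<Lambda>_1 S(\<Lambda>_2)) =
    \<epsilon>(\<Lambda>) = 1. The pairing formula needs a factor \<open>y\<close> that does not
    vary with \<Lambda>_2, so \<Delta> \<Lambda> is first expanded along fixed right legs
    \<open>e\<close>; if \<open>lam \<Lambda>\<close> were 0, every summand would vanish.\<close>
  have nz: "lam \<Lambda> \<noteq> 0"
  proof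
    assume 0: "lam \<Lambda> = 0"
    obtain E :: "'h set" and c where E: "finite E" "\<And>e. functional (c e)"
      "\<And>B :: 'h \<Rightarrow> 'h \<Rightarrow> 'k. bilin scale scale (*) B \<Longrightarrow>
       sw (*) (comult \<Lambda>) B = (\<Sum>e\<in>E. B (sw scale (comult \<Lambda>) (\<lambda>x y. scale (c e y) x)) e)"
      by (rule tensor2_expand[where s = scale and t = "comult \<Lambda>" and 'w = "'k", OF vs]) blast
    have "sw (*) (comult \<Lambda>) (\<lambda>a b. lam (a * S b)) =
        (\<Sum>e\<in>E. lam (sw scale (comult \<Lambda>) (\<lambda>x y. scale (c e y) x) * S e))"
      by (rule E(3)) (intro hr)
    also have "\<dots> = 0"
    proof (rule sum.neutral, rule ballI)
      fix e
      have "lin scale (*) (\<lambda>z. lam (z * S e))" by (intro hr)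
      from lin_sw[OF this] have "lam (sw scale (comult \<Lambda>) (\<lambda>x y. scale (c e y) x) * S e)
        = sw (*) (comult \<Lambda>) (\<lambda>x y. lam (scale (c e y) x * S e))" .
      also have "\<dots> = sw (*) (comult \<Lambda>) (\<lambda>x y. lam (x * S e) * c e y)"
        by (simp add: scale_mult_left[symmetric] lin_scale[OF ll] mult.commute)
      also have "\<dots> = lam \<Lambda> * c e (S (S e))" by (rule integral_pairing_left[OF r L(2) E(2)])
      finally show "lam (sw scale (comult \<Lambda>) (\<lambda>x y. scale (c e y) x) * S e) = 0" by (simp add: 0)
    qed
    finally show False using theta_comult[OF ll 1, of \<Lambda>] L(3) by simp
  qed
  have swap: "lam (x * S y) = lam (S x * y)" for x y
  proof -
    have "lam \<Lambda> * lam (x * S y) = sw (*) (comult \<Lambda>) (\<lambda>a b. lam (a * y) * lam (x * b))"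
      by (rule integral_pairing_left[OF r L(2), symmetric]) (intro hr)
    also have "\<dots> = sw (*) (comult \<Lambda>) (\<lambda>a b. lam (x * b) * lam (a * y))" by (simp add: mult.commute)
    also have "\<dots> = lam \<Lambda> * lam (S x * y)"
      by (rule integral_pairing_right[OF l L(1)]) (intro hr)
    finally show ?thesis using nz by simp
  qed
  have lS: "lam (S x) = lam x" for x using swap[of 1 x] by (simp add: antipode_one)
  have "lam (free_lift scale (\<lambda>(h1, h2). h1 * x * S h2) (comult h)) = counit h * lam x" for h x
  proof -
    have "lam (sw scale (comult h) (\<lambda>g k. g * x * S k)) = sw (*) (comult h) (\<lambda>g k. lam (S x * (S g * k)))"
      unfolding lin_sw[OF ll] swap unfolding antipode_mult mult.assoc ..
    also have "\<dots> = counit h * lam (S x * 1)"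
      by (rule antipode_sw_left) (intro hr)
    finally show ?thesis by (simp add: sw_def lS)
  qed
  moreover have "lam (free_lift scale (\<lambda>(h1, h2). S h1 * x * h2) (comult h)) = counit h * lam x" for h x
  proof -
    have "lam (sw scale (comult h) (\<lambda>g k. S g * x * k)) = sw (*) (comult h) (\<lambda>g k. lam (g * S k * S x))"
      unfolding lin_sw[OF ll] mult.assoc swap[symmetric] unfolding antipode_mult ..
    also have "\<dots> = counit h * lam (1 * S x)"
      by (rule antipode_sw_right) (intro hr)
    finally show ?thesis by (simp add: sw_def lS)
  qed
  ultimately show ?thesis using l r 1 by (simp add: ad_invariant_integral_def)
qed

end

section \<open>Grouplike elements, and limits along the coradical filtration\<close>

context coalgebra
begin

text \<open>\<open>\<phi>\<close> is the projection to \<open>K e\<close> along a maximal subcoalgebra avoiding \<open>e\<close>; transported to \<open>H\<close>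
  with \<open>e = \<iota> 1\<close> it becomes a normalised integral.\<close>

lemma grouplike_functional:
  assumes e: "tensor2_eq scale (comult e) (free_gen (e, e))" and e1: "counit e = 1"
  obtains \<phi> where "functional \<phi>" "\<phi> e = 1" "\<And>x. x \<in> C0 \<Longrightarrow> hitl \<phi> x = scale (\<phi> x) e" "\<And>x. x \<in> C0 \<Longrightarrow> hitr \<phi> x = scale (\<phi> x) e"
proof -
  have he: "hitl f e = scale (f e) e" "hitr f e = scale (f e) e" if "functional f" for f
    unfolding hitl_def hitr_def by (subst sw_eq[OF _ e], intro lrules lin_comp[OF that], simp add: sw_gen[OF vs])+
  have ne: "e \<noteq> 0" using e1 lin_zero[OF counit_linear] by auto
  let ?A = "{E. subcoalgebra scale comult E \<and> e \<notin> E}"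
  have "{0} \<in> ?A" using ne lin_zero[OF lin_hitl[OF _ lin_id[OF vs]]] lin_zero[OF lin_hitr[OF _ lin_id[OF vs]]]
    by (auto simp: subcoalgebra_iff)
  then have ne: "?A \<noteq> {}" by blast
  have "\<exists>E\<in>?A. \<forall>X\<in>?A. E \<subseteq> X \<longrightarrow> X = E"
  proof (rule subset_Zorn_nonempty[OF ne])
    fix \<C> assume c: "\<C> \<noteq> {}" "subset.chain ?A \<C>"
    have cA: "\<And>E. E \<in> \<C> \<Longrightarrow> subcoalgebra scale comult E \<and> e \<notin> E"
      and ch: "\<And>E F. E \<in> \<C> \<Longrightarrow> F \<in> \<C> \<Longrightarrow> E \<subseteq> F \<or> F \<subseteq> E"
      using c(2) by (auto simp: subset.chain_def subset_chain_def)
    have sE: "subspace E" if "E \<in> \<C>" for E using cA[OF that] by (simp add: subcoalgebra_def)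
    have "subspace (\<Union>\<C>)"
    proof (rule subspaceI)
      show "0 \<in> \<Union>\<C>" using c(1) subspace_0[OF sE] by blast
    next
      fix x y assume "x \<in> \<Union>\<C>" "y \<in> \<Union>\<C>"
      then obtain E F where EF: "E \<in> \<C>" "F \<in> \<C>" "x \<in> E" "y \<in> F" by blast
      then consider "x \<in> F" | "y \<in> E" using ch[of E F] by blast
      then show "x + y \<in> \<Union>\<C>" using EF subspace_add[OF sE] by cases blast+
    next
      fix a x assume "x \<in> \<Union>\<C>"
      then show "scale a x \<in> \<Union>\<C>" using subspace_scale[OF sE] by blast
    qed
    then show "\<Union>\<C> \<in> ?A" using cA unfolding subcoalgebra_iff by blast
  qed
  then obtain E where E: "subcoalgebra scale comult E" "e \<notin> E"
     and max: "\<And>X. subcoalgebra scale comult X \<Longrightarrow> e \<notin> X \<Longrightarrow> E \<subseteq> X \<Longrightarrow> X = E" by blast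
  have sE: "subspace E" and hE: "\<And>f x. functional f \<Longrightarrow> x \<in> E \<Longrightarrow> hitl f x \<in> E \<and> hitr f x \<in> E"
    using E by (auto simp: subcoalgebra_iff)
  obtain \<phi> where p: "functional \<phi>" "\<And>x. x \<in> E \<Longrightarrow> \<phi> x = 0" "\<phi> e = 1"
    by (rule separating_functional[OF vs sE E(2)]) blast
  have E0: "hitl \<phi> x = 0" "hitr \<phi> x = 0" if x: "x \<in> E" for x
  proof -
    have "f (hitl \<phi> x) = f 0" "f (hitr \<phi> x) = f 0" if f: "functional f" for f
      using hE[OF f x] p(2) functional_hitl[OF p(1), of f x] functional_hitr[OF p(1), of f x]
      by (simp_all add: functional_hitl[OF f] functional_hitr[OF f] lin_zero[OF f])
    then show "hitl \<phi> x = 0" "hitr \<phi> x = 0" using functionals_separate[OF vs] by blast+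
  qed
  note ll = lin_hitl[OF p(1) lin_id[OF vs]] and lr = lin_hitr[OF p(1) lin_id[OF vs]]
  let ?G = "{x. hitl \<phi> x = scale (\<phi> x) e \<and> hitr \<phi> x = scale (\<phi> x) e}"
  have sG: "subspace ?G"
    by (rule subspaceI) (simp_all add: lin_zero[OF ll] lin_zero[OF lr] lin_zero[OF p(1)] lin_add[OF ll] lin_add[OF lr]
        lin_add[OF p(1)] lin_scale[OF ll] lin_scale[OF lr] lin_scale[OF p(1)] scale_left_distrib)
  have eG: "e \<in> ?G" using he[OF p(1)] by simp
  have EG: "E \<subseteq> ?G" using E0 p(2) by auto
  \<comment> \<open>If a simple \<open>D\<close> is not inside \<open>E\<close>, maximality puts
    \<open>e\<close> into \<open>E + D\<close>. Since \<open>hitr \<phi>\<close> fixes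
    \<open>e\<close> and kills \<open>E\<close>, it moves \<open>e\<close> into \<open>D\<close>,
    and simplicity reduces \<open>D\<close> to the line through \<open>e\<close>.\<close>
  have "D \<subseteq> ?G" if D: "simple_subcoalgebra scale comult D" for D
  proof (cases "D \<subseteq> E")
    case False
    have cD: "subcoalgebra scale comult D" using D by (simp add: simple_subcoalgebra_def)
    have sD: "subspace D" and hD: "\<And>f x. functional f \<Longrightarrow> x \<in> D \<Longrightarrow> hitl f x \<in> D \<and> hitr f x \<in> D"
      using cD by (auto simp: subcoalgebra_iff)
    let ?X = "{x + y |x y. x \<in> E \<and> y \<in> D}"
    have XI: "x + y \<in> ?X" if "x \<in> E" "y \<in> D" for x y using that by blast
    have X: "subcoalgebra scale comult ?X"
      unfolding subcoalgebra_iff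
    proof (intro conjI allI impI ballI)
      show "subspace ?X" by (rule subspace_sums[OF sE sD])
      fix f d assume f: "functional f" and "d \<in> ?X"
      then obtain x y where d: "d = x + y" "x \<in> E" "y \<in> D" by blast
      note ll = lin_hitl[OF f lin_id[OF vs]] and lr = lin_hitr[OF f lin_id[OF vs]]
      show "hitl f d \<in> ?X" unfolding d lin_add[OF ll] using hE[OF f d(2)] hD[OF f d(3)] by (intro XI) auto
      show "hitr f d \<in> ?X" unfolding d lin_add[OF lr] using hE[OF f d(2)] hD[OF f d(3)] by (intro XI) auto
    qed
    have EX: "E \<subseteq> ?X" using XI[OF _ subspace_0[OF sD]] by auto
    have DX: "D \<subseteq> ?X" using XI[OF subspace_0[OF sE]] by auto
    have "e \<in> ?X"
    proof (rule ccontr)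
      assume "e \<notin> ?X"
      from max[OF X this EX] DX False show False by simp
    qed
    then obtain x d where xd: "e = x + d" "x \<in> E" "d \<in> D" by blast
    have "e = hitr \<phi> (x + d)" using he(2)[OF p(1)] p(3) xd(1) by simp
    also have "\<dots> = hitr \<phi> d" by (simp add: lin_add[OF lr] E0 xd)
    also have "\<dots> \<in> D" using hD p(1) xd by blast
    finally have eD: "e \<in> D" .
    let ?K = "range (\<lambda>a. scale a e)"
    have "subspace ?K"
    proof (rule subspaceI)
      show "0 \<in> ?K" by (rule image_eqI[of _ _ 0]) simp_all
    next
      fix y z assume "y \<in> ?K" "z \<in> ?K"
      then obtain a b where "y = scale a e" "z = scale b e" by blast
      then show "y + z \<in> ?K" by (intro image_eqI[of _ _ "a + b"]) (simp_all add: scale_left_distrib)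
    next
      fix c y assume "y \<in> ?K"
      then obtain a where "y = scale a e" by blast
      then show "scale c y \<in> ?K" by (intro image_eqI[of _ _ "c * a"]) simp_all
    qed
    moreover have "hitl f (scale a e) \<in> ?K" "hitr f (scale a e) \<in> ?K" if f: "functional f" for f a
      using he[OF f] by (simp_all add: lin_scale[OF lin_hitl[OF f lin_id[OF vs]]] lin_scale[OF lin_hitr[OF f lin_id[OF vs]]] image_iff exI[of _ "a * f e"])
    ultimately have cK: "subcoalgebra scale comult ?K" unfolding subcoalgebra_iff by blast
    have KD: "?K \<subseteq> D" using subspace_scale[OF sD eD] by blast
    have "?K \<noteq> {0}"
    proof
      assume K0: "?K = {0}"
      have "scale 1 e \<in> ?K" by blast
      with K0 show False using p(3) lin_zero[OF p(1)] by simp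
    qed
    then have "?K = D" using D cK KD unfolding simple_subcoalgebra_def by blast
    then show ?thesis using subspace_scale[OF sG eG] by blast
  qed (use EG in blast)
  then have "C0 \<subseteq> ?G" unfolding coradical_def by (intro span_minimal[OF _ sG]) blast
  then show ?thesis using that[OF p(1,3)] by blast
qed

lemma subcoalgebra_vanish:
  assumes D: "subcoalgebra scale comult D" and c: "c \<in> D" and B: "bilin scale scale s B"
    and 0: "\<And>x y. x \<in> D \<Longrightarrow> y \<in> D \<Longrightarrow> B x y = 0"
  shows "sw s (comult c) B = 0"
proof -
  obtain u where u: "Poly_Mapping.keys u \<subseteq> D \<times> D" "tensor2_eq scale (comult c) u"
    using D c by (auto simp: subcoalgebra_def tensor2_sub_def)
  have "sw s (comult c) B = sw s u B" by (rule sw_eq[OF B u(2)])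
  also have "\<dots> = sw s u (\<lambda>x y. 0)" by (rule sw_cong) (use u(1) 0 in auto)
  finally show ?thesis by (simp add: sw_zero[OF bilin_vs[OF B]])
qed

text \<open>The least layer is only a canonical choice: for a sequence whose members
  \<open>F n\<close> and \<open>F (Suc n)\<close> agree on \<open>CF n\<close>, every layer
  containing \<open>c\<close> yields the same value. Some layer does contain \<open>c\<close>, by
  \<open>exhaustive\<close>.\<close>

definition stable_limit :: "(nat \<Rightarrow> 'c \<Rightarrow> 'd) \<Rightarrow> 'c \<Rightarrow> 'd" where
  "stable_limit F c = F (LEAST n. c \<in> CF n) c"

lemma common_CF: obtains n where "x \<in> CF n" "y \<in> CF n" "z \<in> CF n"
proof -
  obtain i j k where "x \<in> CF i" "y \<in> CF j" "z \<in> CF k" using exhaustive unfolding CF_union_def by blast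
  moreover have "i \<le> i + j + k" "j \<le> i + j + k" "k \<le> i + j + k" by simp_all
  ultimately have "x \<in> CF (i + j + k)" "y \<in> CF (i + j + k)" "z \<in> CF (i + j + k)"
    using CF_mono by blast+
  then show ?thesis by (rule that)
qed

lemma stable_limit:
  assumes F: "\<And>n c. c \<in> CF n \<Longrightarrow> F (Suc n) c = F n c" and c: "c \<in> CF n"
  shows "stable_limit F c = F n c"
proof -
  have "F (m + k) c = F m c" if "c \<in> CF m" for m k
  proof (induction k)
    case (Suc k)
    have "c \<in> CF (m + k)" using CF_mono[of m "m + k"] that by auto
    then show ?case using F Suc by simp
  qed simp
  moreover have "c \<in> CF (LEAST n. c \<in> CF n)" "(LEAST n. c \<in> CF n) \<le> n" using c by (auto intro: LeastI Least_le)
  ultimately show ?thesis unfolding stable_limit_def by (metis le_add_diff_inverse)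
qed

lemma lin_stable_limit:
  assumes F: "\<And>n c. c \<in> CF n \<Longrightarrow> F (Suc n) c = F n c" and l: "\<And>n. lin scale s (F n)"
  shows "lin scale s (stable_limit F)"
proof (rule linI[OF vs lin_vs(2)[OF l]])
  fix x y a
  obtain n where n: "x \<in> CF n" "y \<in> CF n" by (rule common_CF[of x y y])
  have SL: "stable_limit F c = F n c" if "c \<in> CF n" for c by (rule stable_limit) (use F that in auto)
  show "stable_limit F (x + y) = stable_limit F x + stable_limit F y"
    using SL n subspace_add[OF subspace_CF n] lin_add[OF l] by simp
  show "stable_limit F (scale a x) = s a (stable_limit F x)"
    using SL n(1) subspace_scale[OF subspace_CF n(1)] lin_scale[OF l] by simp
qed

end

section \<open>Right module coalgebras whose coradical is a Hopf algebra\<close>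

locale hopf_coradical =
  H: hopf_algebra scaleH comultH counitH antipode +
  right_module_coalgebra scaleH comultH counitH scale comult counit ract
  for scaleH :: "'k::field \<Rightarrow> 'h::ring_1 \<Rightarrow> 'h" and comultH counitH antipode
    and scale :: "'k \<Rightarrow> 'c::ab_group_add \<Rightarrow> 'c" and comult counit and ract +
  fixes iota :: "'h \<Rightarrow> 'c"
  assumes ident: "coradical_identification scaleH comultH counitH scale comult counit iota"
    and iota_ract: "iota (x * h) = ract (iota x) h"
begin

abbreviation (input) "S \<equiv> antipode"

lemma lin_iota: "lin scaleH scale iota" and inj_iota: "inj iota" and range_iota: "range iota = C.C0"
  and comult_iota: "tensor2_eq scale (comult (iota h)) (tensor2_map iota iota (comultH h))"
  and counit_iota: "counit (iota h) = counitH h"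
  using ident by (auto simp: coradical_identification_def coalgebra_map_def)

lemma iota_C0: "iota x \<in> C.C0" using range_iota by blast
lemma C0_iota: "c \<in> C.C0 \<Longrightarrow> \<exists>x. c = iota x" using range_iota by blast

lemma lin_ract_l: assumes "lin s scale g" shows "lin s scale (\<lambda>x. ract (g x) a)"
  by (rule linI) (simp_all add: C.vs lin_vs[OF assms] lin_add[OF assms] lin_scale[OF assms] ract_add_left ract_scale_left)
lemma lin_ract_r: assumes "lin s scaleH g" shows "lin s scale (\<lambda>x. ract a (g x))"
  by (rule linI) (simp_all add: C.vs lin_vs[OF assms] lin_add[OF assms] lin_scale[OF assms] ract_add_right ract_scale_right)

lemmas rules = H.hrules C.lrules lin_ract_l lin_ract_r lin_comp[OF C.counit_linear] lin_comp[OF lin_iota]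

lemma ract_sw: assumes B: "bilin scale scale s B"
  shows "sw s (comult (ract c h)) B = sw s (comult c) (\<lambda>x y. sw s (comultH h) (\<lambda>g k. B (ract x g) (ract y k)))"
  by (subst sw_eq[OF B comult_ract], rule sw_act[OF bilin_vs[OF B]])

lemma iota_sw: assumes B: "bilin scale scale s B"
  shows "sw s (comult (iota h)) B = sw s (comultH h) (\<lambda>x y. B (iota x) (iota y))"
  by (subst sw_eq[OF B comult_iota], rule sw_map[OF bilin_vs[OF B]])

text \<open>The element \<open>iota 1\<close> is grouplike. The functional that
  \<open>grouplike_functional\<close> attaches to it satisfies vector identities on the coradical;
  pulled back along the injective coalgebra map \<open>iota\<close> they say that its restriction to
  \<open>H\<close> is a two-sided integral.\<close>

lemma exists_integral:
  obtains lam where "left_integral scaleH comultH lam" "right_integral scaleH comultH lam" "lam 1 = 1"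
proof -
  have e: "tensor2_eq scale (comult (iota 1)) (free_gen (iota 1, iota 1))"
  proof (rule tensor2_eqI[OF C.vs])
    fix f g assume f: "C.functional f" and g: "C.functional g"
    have "sw (*) (comult (iota 1)) (\<lambda>x y. f x * g y) = sw (*) (comultH 1) (\<lambda>x y. f (iota x) * g (iota y))"
      by (rule iota_sw) (intro rules lin_comp[OF f] lin_comp[OF g])
    also have "\<dots> = f (iota 1) * g (iota 1)"
      by (rule H.one_sw) (intro rules lin_comp[OF f] lin_comp[OF g])
    finally show "sw (*) (comult (iota 1)) (\<lambda>x y. f x * g y) = sw (*) (free_gen (iota 1, iota 1)) (\<lambda>x y. f x * g y)"
      by (simp add: sw_gen[OF vs_K])
  qed
  obtain \<phi> where p: "C.functional \<phi>" "\<phi> (iota 1) = 1"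
    "\<And>x. x \<in> C.C0 \<Longrightarrow> C.hitl \<phi> x = scale (\<phi> x) (iota 1)" "\<And>x. x \<in> C.C0 \<Longrightarrow> C.hitr \<phi> x = scale (\<phi> x) (iota 1)"
    by (rule C.grouplike_functional[OF e]) (simp_all add: counit_iota H.counit_one)
  let ?l = "\<lambda>h. \<phi> (iota h)"
  have ll: "lin scaleH (*) ?l" by (intro lin_comp[OF p(1)] lin_iota)
  have r: "sw scaleH (comultH h) (\<lambda>x y. scaleH (?l y) x) = scaleH (?l h) 1" for h
  proof (rule injD[OF inj_iota])
    have "iota (sw scaleH (comultH h) (\<lambda>x y. scaleH (?l y) x)) = sw scale (comultH h) (\<lambda>x y. scale (\<phi> (iota y)) (iota x))"
      by (simp add: lin_sw[OF lin_iota] lin_scale[OF lin_iota])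
    also have "\<dots> = C.hitr \<phi> (iota h)" unfolding C.hitr_def
      by (rule iota_sw[symmetric]) (intro rules lin_comp[OF p(1)])
    finally show "iota (sw scaleH (comultH h) (\<lambda>x y. scaleH (?l y) x)) = iota (scaleH (?l h) 1)"
      using p(4)[OF iota_C0] by (simp add: lin_scale[OF lin_iota])
  qed
  have l: "sw scaleH (comultH h) (\<lambda>x y. scaleH (?l x) y) = scaleH (?l h) 1" for h
  proof (rule injD[OF inj_iota])
    have "iota (sw scaleH (comultH h) (\<lambda>x y. scaleH (?l x) y)) = sw scale (comultH h) (\<lambda>x y. scale (\<phi> (iota x)) (iota y))"
      by (simp add: lin_sw[OF lin_iota] lin_scale[OF lin_iota])
    also have "\<dots> = C.hitl \<phi> (iota h)" unfolding C.hitl_def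
      by (rule iota_sw[symmetric]) (intro rules lin_comp[OF p(1)])
    finally show "iota (sw scaleH (comultH h) (\<lambda>x y. scaleH (?l x) y)) = iota (scaleH (?l h) 1)"
      using p(3)[OF iota_C0] by (simp add: lin_scale[OF lin_iota])
  qed
  have "convolution comultH f ?l h = f 1 * ?l h" "convolution comultH ?l f h = ?l h * f 1" if f: "lin scaleH (*) f" for f h
    using arg_cong[OF r[of h], of f] arg_cong[OF l[of h], of f]
    by (simp_all add: lin_sw[OF f] lin_scale[OF f] convolution_def mult.commute) (simp_all add: sw_def mult.commute)
  then have "left_integral scaleH comultH ?l" "right_integral scaleH comultH ?l"
    using ll by (auto simp: left_integral_def right_integral_def)
  then show ?thesis using p(2) that by blast
qed

section \<open>Correcting a linear retraction to a coalgebra map\<close>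

text \<open>\<open>dev s f B\<close> is the failure \<open>\<Delta> f - (f \<otimes> f) \<Delta>\<close> of \<open>f\<close> to be comultiplicative, contracted with the
  bilinear map \<open>B\<close>. It is a Hochschild 2-cocycle up to terms quadratic in itself, and the map
  \<open>correction lam f\<close> is the cochain bounding it that the coseparability of \<open>H\<close> provides.\<close>

definition dev :: "('k \<Rightarrow> 'v::ab_group_add \<Rightarrow> 'v) \<Rightarrow> ('c \<Rightarrow> 'h) \<Rightarrow> ('h \<Rightarrow> 'h \<Rightarrow> 'v) \<Rightarrow> 'c \<Rightarrow> 'v" where
  "dev s f B c = sw s (comultH (f c)) B - sw s (comult c) (\<lambda>x y. B (f x) (f y))"

lemma lin_dev:
  assumes f: "lin scale scaleH f" and g: "lin s1 scale g"
    and B: "\<And>y. lin scaleH s (\<lambda>x. B x y)" "\<And>x. lin scaleH s (\<lambda>y. B x y)"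
  shows "lin s1 s (\<lambda>x. dev s f (\<lambda>u v. B u v) (g x))"
proof -
  have b: "bilin scaleH scaleH s B" using B by (simp add: bilin_def)
  show ?thesis unfolding dev_def by (intro rules lin_comp[OF f] g bilin_l[OF b] bilin_r[OF b])
qed

lemma lin_devB:
  assumes B: "\<And>u v. lin s1 s (\<lambda>x. B x u v)"
  shows "lin s1 s (\<lambda>x. dev s f (\<lambda>u v. B x u v) c)"
  unfolding dev_def by (intro lin_minus lin_swB B)

lemma lin_dev_comp: assumes "lin s s' L" shows "L (dev s f B c) = dev s' f (\<lambda>x y. L (B x y)) c"
  unfolding dev_def by (simp add: lin_diff[OF assms] lin_sw[OF assms])

lemma sw_dev: "vector_space s \<Longrightarrow> sw s t (\<lambda>x y. dev s f (\<lambda>u v. B x y u v) c) = dev s f (\<lambda>u v. sw s t (\<lambda>x y. B x y u v)) c"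
  unfolding dev_def by (simp add: sw_diff sw_swap[of s t "comultH (f c)"] sw_swap[of s t "comult c"])

text \<open>An exact identity, without error terms: both sides are the threefold comultiplication of
  \<open>f y\<close> minus the threefold comultiplication of \<open>y\<close> with \<open>f\<close>
  applied to all legs, and the mixed terms cancel. The outer legs carry \<open>f\<close> in place of
  a coaction of \<open>H\<close>.\<close>

lemma dev_cocycle:
  assumes f: "lin scale scaleH f" and T: "trilin scaleH scaleH scaleH s T"
  shows "dev s f (\<lambda>p q. sw s (comultH p) (\<lambda>p1 p2. T p1 p2 q)) y + sw s (comult y) (\<lambda>u v. dev s f (\<lambda>p q. T p q (f v)) u)
    = dev s f (\<lambda>p q. sw s (comultH q) (\<lambda>q1 q2. T p q1 q2)) y + sw s (comult y) (\<lambda>u v. dev s f (\<lambda>p q. T (f u) p q) v)"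
proof -
  have v: "vector_space s" using T unfolding trilin_def using lin_vs(2) by blast
  have 1: "sw s (comultH (f y)) (\<lambda>p q. sw s (comultH p) (\<lambda>p1 p2. T p1 p2 q)) = sw s (comultH (f y)) (\<lambda>p q. sw s (comultH q) (\<lambda>q1 q2. T p q1 q2))"
    by (rule H.coassoc_sw[OF T])
  have 2: "sw s (comult y) (\<lambda>u v. sw s (comult u) (\<lambda>a b. T (f a) (f b) (f v))) = sw s (comult y) (\<lambda>u v. sw s (comult v) (\<lambda>a b. T (f u) (f a) (f b)))"
    by (rule C.coassoc_sw) (intro rules trilin_1[OF T] trilin_2[OF T] trilin_3[OF T] lin_comp[OF f])
  show ?thesis unfolding dev_def sw_diff[OF v] 1 2 by simp
qed

definition coalg_upto where
  "coalg_upto f n \<longleftrightarrow> (\<forall>c\<in>C.CF n. tensor2_eq scaleH (comultH (f c)) (tensor2_map f f (comult c)))"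

lemma dev_zero:
  assumes "coalg_upto f n" "c \<in> C.CF n" "bilin scaleH scaleH s B" shows "dev s f B c = 0"
  using sw_eq[OF assms(3), of "comultH (f c)" "tensor2_map f f (comult c)"] assms(1,2)
  by (simp add: dev_def coalg_upto_def sw_map[OF bilin_vs[OF assms(3)]])

lemma coalg_uptoI:
  assumes "\<And>c g h. c \<in> C.CF n \<Longrightarrow> lin scaleH (*) g \<Longrightarrow> lin scaleH (*) h \<Longrightarrow> dev (*) f (\<lambda>x y. g x * h y) c = 0"
  shows "coalg_upto f n"
  unfolding coalg_upto_def by (intro ballI tensor2_eqI[OF H.vs]) (use assms in \<open>simp add: dev_def sw_map[OF vs_K]\<close>)

definition correction where
  "correction lam f c = sw scaleH (comult c) (\<lambda>x y. dev scaleH f (\<lambda>p q. scaleH (lam (f x * S p)) q) y)"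

definition newton where "newton lam f c = f c + correction lam f c"

context
  fixes lam f and n :: nat
  assumes lam: "left_integral scaleH comultH lam" "lam 1 = 1"
    and f: "lin scale scaleH f" and f_iota: "\<And>x. f (iota x) = x"
begin

lemma lin_lam: "lin scaleH (*) lam" using lam by (simp add: left_integral_def)

lemmas nrules = rules lin_dev[OF f] lin_devB lin_comp[OF lin_lam] lin_comp[OF f]

lemma lin_correction: "lin scale scaleH (correction lam f)"
  unfolding correction_def by (intro nrules)

lemma lin_newton: "lin scale scaleH (newton lam f)"
  unfolding newton_def by (intro nrules lin_comp[OF lin_correction])

context assumes co: "coalg_upto f n"
begin

lemma correction_zero:
  assumes "c \<in> C.CF n" shows "correction lam f c = 0"
  unfolding correction_def
proof (rule C.subcoalgebra_vanish[OF C.subcoalgebra_CF assms])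
  show "bilin scale scale scaleH (\<lambda>x y. dev scaleH f (\<lambda>p q. scaleH (lam (f x * S p)) q) y)" by (intro nrules)
  fix x y assume "y \<in> C.CF n"
  then show "dev scaleH f (\<lambda>p q. scaleH (lam (f x * S p)) q) y = 0" by (rule dev_zero[OF co]) (intro nrules)
qed

lemma newton_agree: "c \<in> C.CF n \<Longrightarrow> newton lam f c = f c"
  by (simp add: newton_def correction_zero)

lemma C0_CF: "x \<in> C.C0 \<Longrightarrow> x \<in> C.CF n"
  using C.CF_mono[of 0 n] by auto

text \<open>Bicolinearity of \<theta> turns the coproduct of \<open>f x\<close> into a coproduct of
  the left leg of the deviation. The cocycle identity then yields three terms: the coproduct of the
  correction, the deviation itself since \<theta> \<Delta> = \<epsilon>, and, with a minus sign, the
  correction tensored with \<open>f\<close>.\<close>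

lemma correction_coboundary:
  assumes c: "c \<in> C.CF (Suc n)" and B: "bilin scaleH scaleH (*) B"
  shows "sw (*) (comult c) (\<lambda>x y. B (f x) (correction lam f y)) + sw (*) (comult c) (\<lambda>x y. B (correction lam f x) (f y))
    = sw (*) (comultH (correction lam f c)) B + dev (*) f B c"
proof -
  note r = nrules bilin_l[OF B] bilin_r[OF B]
  have cor: "L (correction lam f z) = sw (*) (comult z) (\<lambda>u v. dev (*) f (\<lambda>p q. lam (f u * S p) * L q) v)"
    if "lin scaleH (*) L" for L z
    unfolding correction_def by (simp add: lin_sw[OF that] lin_dev_comp[OF that] lin_scale[OF that])
  have "sw (*) (comult c) (\<lambda>x y. B (f x) (correction lam f y)) =
     sw (*) (comult c) (\<lambda>x y. sw (*) (comult y) (\<lambda>u v. dev (*) f (\<lambda>p q. lam (f u * S p) * B (f x) q) v))"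
    by (subst cor) (intro r refl)+
  also have "\<dots> = sw (*) (comult c) (\<lambda>x y. sw (*) (comult x) (\<lambda>u v. dev (*) f (\<lambda>p q. lam (f v * S p) * B (f u) q) y))"
    by (rule C.coassoc_sw[symmetric]) (intro r)
  \<comment> \<open>The values \<open>f u\<close> and \<open>f v\<close> are traded for the legs of
    \<open>comultH (f x)\<close>. The price is a deviation nested in a deviation, which vanishes on
    \<open>CF (Suc n)\<close> because \<open>f\<close> is comultiplicative on \<open>CF n\<close>
    and hence on the coradical.\<close>
  also have "\<dots> = sw (*) (comult c) (\<lambda>x y. sw (*) (comultH (f x)) (\<lambda>a b. dev (*) f (\<lambda>p q. lam (b * S p) * B a q) y))
      - sw (*) (comult c) (\<lambda>x y. dev (*) f (\<lambda>a b. dev (*) f (\<lambda>p q. lam (b * S p) * B a q) y) x)"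
    unfolding sw_diff[OF vs_K, symmetric] by (simp add: dev_def[of _ _ "\<lambda>a b. dev (*) f (\<lambda>p q. lam (b * S p) * B a q) y" for y])
  also have "sw (*) (comult c) (\<lambda>x y. dev (*) f (\<lambda>a b. dev (*) f (\<lambda>p q. lam (b * S p) * B a q) y) x) = 0"
  proof (rule C.filtration_vanish[OF c])
    show "bilin scale scale (*) (\<lambda>x y. dev (*) f (\<lambda>a b. dev (*) f (\<lambda>p q. lam (b * S p) * B a q) y) x)" by (intro r)
    fix x y assume "x \<in> C.C0"
    then have x: "x \<in> C.CF n" by (rule C0_CF)
    show "dev (*) f (\<lambda>a b. dev (*) f (\<lambda>p q. lam (b * S p) * B a q) y) x = 0"
      by (rule dev_zero[OF co x]) (intro r)
  next
    fix x y assume y: "y \<in> C.CF n"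
    have "dev (*) f (\<lambda>p q. lam (b * S p) * B a q) y = 0" for a b by (rule dev_zero[OF co y]) (intro r)
    then show "dev (*) f (\<lambda>a b. dev (*) f (\<lambda>p q. lam (b * S p) * B a q) y) x = 0"
      by (simp add: dev_def[of _ _ "\<lambda>x y. 0"] sw_zero[OF vs_K])
  qed
  also have "sw (*) (comult c) (\<lambda>x y. sw (*) (comultH (f x)) (\<lambda>a b. dev (*) f (\<lambda>p q. lam (b * S p) * B a q) y)) =
     sw (*) (comult c) (\<lambda>x y. dev (*) f (\<lambda>p q. sw (*) (comultH p) (\<lambda>p1 p2. lam (f x * S p1) * B p2 q)) y)"
  proof -
    have "sw (*) (comultH x) (\<lambda>a b. lam (b * S p) * B a q) = sw (*) (comultH p) (\<lambda>p1 p2. lam (x * S p1) * B p2 q)" for x p q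
      by (rule H.theta_bicolinear[OF lam(1)]) (intro r)
    then show ?thesis unfolding sw_dev[OF vs_K] by simp
  qed
  also have "\<dots> = sw (*) (comult c) (\<lambda>x y. dev (*) f (\<lambda>p q. lam (f x * S p) * sw (*) (comultH q) B) y)
     + sw (*) (comult c) (\<lambda>x y. sw (*) (comult y) (\<lambda>u v. dev (*) f (\<lambda>p q. lam (f x * S (f u)) * B p q) v))
     - sw (*) (comult c) (\<lambda>x y. sw (*) (comult y) (\<lambda>u v. dev (*) f (\<lambda>p q. lam (f x * S p) * B q (f v)) u))"
  proof -
    have "dev (*) f (\<lambda>p q. sw (*) (comultH p) (\<lambda>p1 p2. lam (f x * S p1) * B p2 q)) y
       = dev (*) f (\<lambda>p q. lam (f x * S p) * sw (*) (comultH q) B) y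
       + sw (*) (comult y) (\<lambda>u v. dev (*) f (\<lambda>p q. lam (f x * S (f u)) * B p q) v)
       - sw (*) (comult y) (\<lambda>u v. dev (*) f (\<lambda>p q. lam (f x * S p) * B q (f v)) u)" for x y
    proof -
      have "trilin scaleH scaleH scaleH (*) (\<lambda>p1 p2 q. lam (f x * S p1) * B p2 q)" by (intro r)
      from dev_cocycle[OF f this, of y] show ?thesis unfolding sw_Kr eq_diff_eq .
    qed
    then show ?thesis by (simp add: sw_add[OF vs_K] sw_diff[OF vs_K])
  qed
  also have "sw (*) (comult c) (\<lambda>x y. dev (*) f (\<lambda>p q. lam (f x * S p) * sw (*) (comultH q) B) y)
     = sw (*) (comultH (correction lam f c)) B"
    by (rule cor[symmetric]) (intro r)
  also have "sw (*) (comult c) (\<lambda>x y. sw (*) (comult y) (\<lambda>u v. dev (*) f (\<lambda>p q. lam (f x * S (f u)) * B p q) v)) = dev (*) f B c"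
  proof -
    have "sw (*) (comult c) (\<lambda>x y. sw (*) (comult y) (\<lambda>u v. dev (*) f (\<lambda>p q. lam (f x * S (f u)) * B p q) v)) =
      sw (*) (comult c) (\<lambda>x y. sw (*) (comult x) (\<lambda>u v. dev (*) f (\<lambda>p q. lam (f u * S (f v)) * B p q) y))"
      by (rule C.coassoc_sw[symmetric]) (intro r)
    also have "\<dots> = sw (*) (comult c) (\<lambda>x y. sw (*) (comult x) (\<lambda>u v. lam (f u * S (f v))) * dev (*) f B y)"
      by (simp add: sw_Kl lin_dev_comp[OF lin_Kr[OF lin_id[OF vs_K]], symmetric])
    \<comment> \<open>For general \<open>x\<close> the form need not give \<open>counit x\<close>,
      but it does on the coradical, where \<open>f\<close> inverts \<open>iota\<close>. The other
      factor vanishes for \<open>y\<close> in \<open>CF n\<close>, so the difference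
      disappears.\<close>
    also have "\<dots> = sw (*) (comult c) (\<lambda>x y. counit x * dev (*) f B y)"
    proof -
      have "sw (*) (comult c) (\<lambda>x y. (sw (*) (comult x) (\<lambda>u v. lam (f u * S (f v))) - counit x) * dev (*) f B y) = 0"
      proof (rule C.filtration_vanish[OF c])
        show "bilin scale scale (*) (\<lambda>x y. (sw (*) (comult x) (\<lambda>u v. lam (f u * S (f v))) - counit x) * dev (*) f B y)"
          by (intro r)
        fix x y assume "x \<in> C.C0"
        then obtain h where h: "x = iota h" using C0_iota by blast
        have "sw (*) (comult x) (\<lambda>u v. lam (f u * S (f v))) = sw (*) (comultH h) (\<lambda>u v. lam (f (iota u) * S (f (iota v))))"
          unfolding h by (rule iota_sw) (intro r)
        also have "\<dots> = counit x" unfolding f_iota h counit_iota by (rule H.theta_comult[OF lin_lam lam(2)])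
        finally show "(sw (*) (comult x) (\<lambda>u v. lam (f u * S (f v))) - counit x) * dev (*) f B y = 0" by simp
      next
        fix x y assume "y \<in> C.CF n"
        then show "(sw (*) (comult x) (\<lambda>u v. lam (f u * S (f v))) - counit x) * dev (*) f B y = 0"
          using dev_zero[OF co _ B] by simp
      qed
      then show ?thesis by (simp add: left_diff_distrib sw_diff[OF vs_K])
    qed
    also have "\<dots> = dev (*) f B c" by (rule C.counit_sw_left) (intro r)
    finally show ?thesis .
  qed
  also have "sw (*) (comult c) (\<lambda>x y. sw (*) (comult y) (\<lambda>u v. dev (*) f (\<lambda>p q. lam (f x * S p) * B q (f v)) u)) =
     sw (*) (comult c) (\<lambda>x y. B (correction lam f x) (f y))"
  proof -
    have "sw (*) (comult c) (\<lambda>x y. sw (*) (comult y) (\<lambda>u v. dev (*) f (\<lambda>p q. lam (f x * S p) * B q (f v)) u)) =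
      sw (*) (comult c) (\<lambda>x y. sw (*) (comult x) (\<lambda>u v. dev (*) f (\<lambda>p q. lam (f u * S p) * B q (f y)) v))"
      by (rule C.coassoc_sw[symmetric]) (intro r)
    also have "\<dots> = sw (*) (comult c) (\<lambda>x y. B (correction lam f x) (f y))"
      by (subst cor[of "\<lambda>q. B q (f y)" for y]) (intro r refl)+
    finally show ?thesis .
  qed
  finally show ?thesis by simp
qed

text \<open>Adding the correction changes the deviation by linear terms, which cancel it by
  \<open>correction_coboundary\<close>, and by the correction tensored with itself, which vanishes
  on \<open>CF (Suc n)\<close> because the correction is 0 on \<open>CF n\<close>.\<close>

lemma newton_coalg: "coalg_upto (newton lam f) (Suc n)"
proof (rule coalg_uptoI)
  fix c g h assume c: "c \<in> C.CF (Suc n)" and g: "lin scaleH (*) g" and h: "lin scaleH (*) h"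
  have B: "bilin scaleH scaleH (*) (\<lambda>x y. g x * h y)" by (intro rules lin_comp[OF g] lin_comp[OF h])
  have z: "sw (*) (comult c) (\<lambda>x y. g (correction lam f x) * h (correction lam f y)) = 0"
    by (rule C.filtration_vanish[OF c])
      (auto intro!: rules lin_comp[OF g] lin_comp[OF h] lin_comp[OF lin_correction] simp: correction_zero C0_CF lin_zero[OF g] lin_zero[OF h])
  show "dev (*) (newton lam f) (\<lambda>x y. g x * h y) c = 0"
    using correction_coboundary[OF c B] z
    by (simp add: dev_def newton_def H.sw_comult_add[OF B] lin_add[OF g] lin_add[OF h] distrib_left distrib_right sw_add[OF vs_K])
      (simp add: algebra_simps)
qed

end

lemma newton_iota: assumes "coalg_upto f n" shows "newton lam f (iota x) = x"
  using newton_agree[OF assms C0_CF[OF assms iota_C0]] by (simp add: f_iota)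

lemma dev_ract:
  assumes fr: "\<And>c h. f (ract c h) = f c * h" and B: "bilin scaleH scaleH s B"
  shows "dev s f B (ract y k) = dev s f (\<lambda>a b. sw s (comultH k) (\<lambda>m n. B (a * m) (b * n))) y"
proof -
  note r = nrules bilin_l[OF B] bilin_r[OF B]
  have "sw s (comult (ract y k)) (\<lambda>x y. B (f x) (f y)) = sw s (comult y) (\<lambda>u v. sw s (comultH k) (\<lambda>m n. B (f (ract u m)) (f (ract v n))))"
    by (rule ract_sw) (intro r)
  then show ?thesis by (simp add: dev_def fr H.mult_sw[OF B])
qed

text \<open>The diagonal action places the three legs of \<open>h\<close> on \<open>f x\<close>,
  \<open>a\<close> and \<open>b\<close>. By \<open>theta_right\<close> the form absorbs the first
  two, and the third is left as the factor \<open>h\<close> on the right.\<close>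

lemma newton_ract:
  assumes fr: "\<And>c h. f (ract c h) = f c * h"
  shows "newton lam f (ract c h) = newton lam f c * h"
proof -
  have "correction lam f (ract c h) = sw scaleH (comult c) (\<lambda>x y. sw scaleH (comultH h) (\<lambda>g k.
     dev scaleH f (\<lambda>p q. scaleH (lam (f (ract x g) * S p)) q) (ract y k)))"
    unfolding correction_def by (rule ract_sw) (intro nrules)
  also have "\<dots> = sw scaleH (comult c) (\<lambda>x y. dev scaleH f (\<lambda>a b. sw scaleH (comultH h) (\<lambda>g k. sw scaleH (comultH k) (\<lambda>m n.
     scaleH (lam (f x * g * S (a * m))) (b * n)))) y)"
    by (subst dev_ract[OF fr]) (intro nrules, simp add: fr sw_dev[OF H.vs])
  also have "\<dots> = sw scaleH (comult c) (\<lambda>x y. dev scaleH f (\<lambda>a b. scaleH (lam (f x * S a)) (b * h)) y)"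
  proof -
    have "sw scaleH (comultH h) (\<lambda>g k. sw scaleH (comultH k) (\<lambda>m n. scaleH (lam (z * g * S (a * m))) (b * n)))
      = scaleH (lam (z * S a)) (b * h)" for z a b
    proof -
      have "sw scaleH (comultH h) (\<lambda>g k. sw scaleH (comultH k) (\<lambda>m n. scaleH (lam (z * g * S (a * m))) (b * n))) =
         sw scaleH (comultH h) (\<lambda>w n. sw scaleH (comultH w) (\<lambda>g m. scaleH (lam (z * g * S (a * m))) (b * n)))"
        by (rule H.coassoc_sw[symmetric]) (intro nrules)
      also have "\<dots> = sw scaleH (comultH h) (\<lambda>w n. scaleH (counitH w) (scaleH (lam (z * S a)) (b * n)))"
      proof (rule sw_cong)
        fix w n
        have "lin (*) scaleH (\<lambda>t. scaleH t (b * n))" by (intro nrules)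
        from lin_sw[OF this, of "comultH w" "\<lambda>g m. lam (z * g * S (a * m))"]
        show "sw scaleH (comultH w) (\<lambda>g m. scaleH (lam (z * g * S (a * m))) (b * n)) = scaleH (counitH w) (scaleH (lam (z * S a)) (b * n))"
          unfolding H.theta_right[OF lin_lam] by simp
      qed
      also have "\<dots> = scaleH (lam (z * S a)) (b * h)" by (rule H.counit_sw_left) (intro nrules)
      finally show ?thesis .
    qed
    then show ?thesis by simp
  qed
  also have "\<dots> = correction lam f c * h"
  proof -
    have l: "lin scaleH scaleH (\<lambda>z. z * h)" by (intro nrules)
    show ?thesis unfolding correction_def lin_sw[OF l] lin_dev_comp[OF l] by (simp add: H.scale_mult_left)
  qed
  finally show ?thesis by (simp add: newton_def fr distrib_right)
qed

end

abbreviation "newton_iter lam f n \<equiv> (newton lam ^^ n) f"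

context
  fixes lam f
  assumes lam: "left_integral scaleH comultH lam" "lam 1 = 1"
    and f: "lin scale scaleH f" and f_iota: "\<And>x. f (iota x) = x"
begin

lemma newton_iter:
  "lin scale scaleH (newton_iter lam f n) \<and> (\<forall>x. newton_iter lam f n (iota x) = x) \<and> coalg_upto (newton_iter lam f n) n"
proof (induction n)
  case 0
  have "coalg_upto f 0"
  proof (rule coalg_uptoI)
    fix c g h assume "c \<in> C.CF 0" and g: "lin scaleH (*) g" and h: "lin scaleH (*) h"
    then obtain x where c: "c = iota x" using C0_iota by auto
    have "sw (*) (comult (iota x)) (\<lambda>x y. g (f x) * h (f y)) = sw (*) (comultH x) (\<lambda>x y. g (f (iota x)) * h (f (iota y)))"
      by (rule iota_sw) (intro rules lin_comp[OF g] lin_comp[OF h] lin_comp[OF f])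
    then show "dev (*) f (\<lambda>x y. g x * h y) c = 0" by (simp add: c dev_def f_iota)
  qed
  then show ?case using f f_iota by simp
next
  case (Suc n)
  then have F: "lin scale scaleH (newton_iter lam f n)" "\<And>x. newton_iter lam f n (iota x) = x"
    "coalg_upto (newton_iter lam f n) n" by auto
  show ?case
    using lin_newton[OF lam F(1,2)] newton_iota[OF lam F] newton_coalg[OF lam F] by simp
qed

lemma newton_iter_agree: "c \<in> C.CF n \<Longrightarrow> newton_iter lam f (Suc n) c = newton_iter lam f n c"
  using newton_agree[OF lam, of "newton_iter lam f n" n c] newton_iter[of n] by simp

definition newton_limit where "newton_limit = C.stable_limit (newton_iter lam f)"

lemma newton_limit_CF: "c \<in> C.CF n \<Longrightarrow> newton_limit c = newton_iter lam f n c"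
  unfolding newton_limit_def by (rule C.stable_limit) (use newton_iter_agree in auto)

lemma lin_newton_limit: "lin scale scaleH newton_limit"
  unfolding newton_limit_def by (rule C.lin_stable_limit) (use newton_iter_agree newton_iter in auto)

lemma newton_limit_iota: "newton_limit (iota x) = x"
  using newton_limit_CF[of "iota x" 0] iota_C0[of x] f_iota by simp

lemma newton_limit_comult:
  assumes B: "bilin scaleH scaleH s B"
  shows "sw s (comultH (newton_limit c)) B = sw s (comult c) (\<lambda>x y. B (newton_limit x) (newton_limit y))"
proof -
  obtain n where n: "c \<in> C.CF n" by (rule C.common_CF[of c c c])
  note l = newton_iter[of n, THEN conjunct1]
  have "sw s (comult c) (\<lambda>x y. B (newton_limit x) (newton_limit y) - B (newton_iter lam f n x) (newton_iter lam f n y)) = 0"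
  proof (rule C.subcoalgebra_vanish[OF C.subcoalgebra_CF n])
    show "bilin scale scale s (\<lambda>x y. B (newton_limit x) (newton_limit y) - B (newton_iter lam f n x) (newton_iter lam f n y))"
      by (intro rules bilin_l[OF B] bilin_r[OF B] lin_newton_limit l)
  qed (simp add: newton_limit_CF)
  then show ?thesis
    using dev_zero[OF newton_iter[of n, THEN conjunct2, THEN conjunct2] n B] newton_limit_CF[OF n]
    by (simp add: dev_def sw_diff[OF bilin_vs[OF B]])
qed

lemma newton_limit_counit: "counitH (newton_limit c) = counit c"
proof -
  let ?w = "\<lambda>c. counitH (newton_limit c)"
  let ?v = "\<lambda>c. counit c - ?w c"
  note r = rules lin_comp[OF lin_newton_limit]
  have lv: "lin scale (*) ?v" by (intro r)
  have lw: "lin scale (*) ?w" by (intro r)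
  \<comment> \<open>The counit is the unit for convolution, and \<open>?w\<close> is a convolution
    idempotent because the limit is comultiplicative; so the complement \<open>?v\<close> is
    idempotent as well. This lets \<open>filtration_vanish\<close> climb the layers with
    \<open>?v\<close> in both factors.\<close>
  have id: "sw (*) (comult c) (\<lambda>x y. ?v x * ?v y) = ?v c" for c
  proof -
    have "bilin scaleH scaleH (*) (\<lambda>x y. counitH x * counitH y)" by (intro r)
    from newton_limit_comult[OF this, of c]
    have "sw (*) (comult c) (\<lambda>x y. ?w x * ?w y) = ?w c"
      using H.counit_sw_left[OF H.counit_linear] by simp
    moreover have "sw (*) (comult c) (\<lambda>x y. counit x * ?w y) = ?w c" by (rule C.counit_sw_left[OF lw])
    moreover have "sw (*) (comult c) (\<lambda>x y. counit y * ?w x) = ?w c" by (rule C.counit_sw_right[OF lw])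
    moreover have "sw (*) (comult c) (\<lambda>x y. counit x * counit y) = counit c" by (rule C.counit_sw_left[OF C.counit_linear])
    ultimately show ?thesis
      by (simp add: left_diff_distrib right_diff_distrib sw_diff[OF vs_K] mult.commute)
  qed
  have v0: "?v x = 0" if "x \<in> C.C0" for x using C0_iota[OF that] newton_limit_iota counit_iota by auto
  have "?v c = 0" if "c \<in> C.CF n" for c n using that
  proof (induction n arbitrary: c)
    case (Suc n)
    have "sw (*) (comult c) (\<lambda>x y. ?v x * ?v y) = 0"
      by (rule C.filtration_vanish[OF Suc.prems]) (use v0 Suc.IH in \<open>auto intro!: r\<close>)
    then show ?case using id by simp
  qed (use v0 in auto)
  moreover obtain n where "c \<in> C.CF n" by (rule C.common_CF[of c c c])
  ultimately show ?thesis by simp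
qed

lemma coalgebra_map_newton_limit: "coalgebra_map scale comult counit scaleH comultH counitH newton_limit"
  unfolding coalgebra_map_def
proof (intro conjI allI lin_newton_limit newton_limit_counit tensor2_eqI[OF H.vs])
  fix c g h assume g: "lin scaleH (*) g" and h: "lin scaleH (*) h"
  have "bilin scaleH scaleH (*) (\<lambda>x y. g x * h y)" by (intro rules lin_comp[OF g] lin_comp[OF h])
  from newton_limit_comult[OF this, of c]
  show "sw (*) (comultH (newton_limit c)) (\<lambda>x y. g x * h y) = sw (*) (tensor2_map newton_limit newton_limit (comult c)) (\<lambda>x y. g x * h y)"
    by (simp add: sw_map[OF vs_K])
qed

lemma newton_limit_ract:
  assumes "\<And>c h. f (ract c h) = f c * h"
  shows "newton_limit (ract c h) = newton_limit c * h"
proof -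
  have *: "newton_iter lam f n (ract c h) = newton_iter lam f n c * h" for n c h
  proof (induction n arbitrary: c h)
    case (Suc n)
    show ?case using newton_ract[OF lam newton_iter[of n, THEN conjunct1] _ Suc] newton_iter[of n] by simp
  qed (use assms in simp)
  obtain n where "c \<in> C.CF n" "ract c h \<in> C.CF n" by (rule C.common_CF[of c "ract c h" c])
  then show ?thesis by (simp add: newton_limit_CF *)
qed

end

section \<open>Linear retractions of the coradical\<close>

lemma linear_retraction: obtains p where "lin scale scaleH p" "\<And>x. p (iota x) = x"
proof -
  obtain q where q: "lin scale scale q" "\<And>x. q x \<in> C.C0" "\<And>x. x \<in> C.C0 \<Longrightarrow> q x = x"
    by (rule subspace_projection[OF C.vs C.subspace_CF[of 0]]) auto
  have i: "iota (inv iota (q x)) = q x" for x using q(2)[of x] range_iota by (metis f_inv_into_f)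
  have "lin scale scaleH (\<lambda>x. inv iota (q x))"
    by (intro linI C.vs H.vs injD[OF inj_iota]) (simp_all only: i lin_add[OF lin_iota] lin_scale[OF lin_iota] lin_add[OF q(1), symmetric] lin_scale[OF q(1), symmetric])
  moreover have "inv iota (q (iota x)) = x" for x using q(3)[OF iota_C0] inj_iota by simp
  ultimately show ?thesis by (rule that)
qed

text \<open>Hitting \<open>ract c h\<close> with a functional amounts to hitting \<open>c\<close>
  with its translates and then acting. Translates of a radical functional are radical, since the
  coradical, as the image of \<open>iota\<close>, is stable under the action.\<close>

lemma CF_ract: "c \<in> C.CF n \<Longrightarrow> ract c h \<in> C.CF n"
proof (induction n arbitrary: c h)
  case 0
  then obtain x where "c = iota x" using C0_iota by auto
  then show ?case using iota_C0[of "x * h"] by (simp add: iota_ract)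
next
  case (Suc n)
  show ?case
    unfolding C.filtration_Suc_iff
  proof (intro allI impI)
    fix f assume f: "C.radical_functional f"
    note lf = C.radical_functionalD(1)[OF f]
    have "f (ract x g) = 0" if "x \<in> C.C0" for x g
      using C0_iota[OF that] iota_C0 C.radical_functionalD(2)[OF f] by (auto simp: iota_ract[symmetric])
    then have Jg: "C.radical_functional (\<lambda>x. f (ract x g))" for g unfolding C.radical_functional_def by (auto intro!: rules lin_comp[OF lf])
    have "C.hitl f (ract c h) = sw scale (comult c) (\<lambda>x y. sw scale (comultH h) (\<lambda>g k. scale (f (ract x g)) (ract y k)))"
      unfolding C.hitl_def by (rule ract_sw) (intro rules lin_comp[OF lf])
    also have "\<dots> = sw scale (comultH h) (\<lambda>g k. sw scale (comult c) (\<lambda>x y. scale (f (ract x g)) (ract y k)))"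
      by (rule sw_swap[OF C.vs])
    also have "\<dots> = sw scale (comultH h) (\<lambda>g k. ract (C.hitl (\<lambda>x. f (ract x g)) c) k)"
      unfolding C.hitl_def by (simp add: lin_sw[OF lin_ract_l[OF lin_id[OF C.vs]]] ract_scale_left)
    also have "\<dots> \<in> C.CF n"
      by (rule sw_in_subspace[OF C.vs C.subspace_CF]) (use Suc Jg C.filtration_Suc_iff in blast)
    finally show "C.hitl f (ract c h) \<in> C.CF n" .
  qed
qed

context
  fixes p f n
  assumes p: "lin scale scaleH p" and p_iota: "\<And>x. p (iota x) = x"
    and f: "lin scale scaleH f" and fn: "\<And>c h. c \<in> C.CF n \<Longrightarrow> f (ract c h) = f c * h"
begin

text \<open>On \<open>C\<^sub>n\<^sub>+\<^sub>1\<close> the deviation \<open>rdev\<close> from right linearity is a 1-cocycle that depends only on classes in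
  the Hopf module \<open>C\<^sub>n\<^sub>+\<^sub>1/C\<^sub>n\<close>; writing \<open>m = m\<^sub>0 S(m\<^sub>1) m\<^sub>2\<close> there shows that it is the coboundary of \<open>rcorr\<close>.\<close>

definition rdev where "rdev c h = f (ract c h) - f c * h"

lemma lin_rdev_l: "lin s scale g \<Longrightarrow> lin s scaleH (\<lambda>x. rdev (g x) h)"
  unfolding rdev_def by (intro rules lin_comp[OF f])
lemma lin_rdev_r: "lin s scaleH g \<Longrightarrow> lin s scaleH (\<lambda>x. rdev c (g x))"
  unfolding rdev_def by (intro rules lin_comp[OF f])

lemmas rrules = rules lin_rdev_l lin_rdev_r lin_comp[OF p]

lemma rdev_CF: "c \<in> C.CF n \<Longrightarrow> rdev c h = 0"
  by (simp add: rdev_def fn)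

lemma rdev_mult: "rdev c (a * h) = rdev (ract c a) h + rdev c a * h"
  by (simp add: rdev_def ract_mult algebra_simps)

definition rcorr where
  "rcorr c = sw scaleH (comult c) (\<lambda>x w. sw scaleH (comult w) (\<lambda>y z. rdev (ract x (S (p y))) (p z)))"

lemma lin_rcorr: "lin scale scaleH rcorr"
  unfolding rcorr_def by (intro rrules)

lemma rcorr_CF: "c \<in> C.CF n \<Longrightarrow> rcorr c = 0"
  unfolding rcorr_def
  by (rule C.subcoalgebra_vanish[OF C.subcoalgebra_CF, of c n]) (auto intro!: rrules simp: rdev_CF CF_ract sw_zero[OF H.vs])

lemma rcorr_ract:
  assumes c: "c \<in> C.CF (Suc n)"
  shows "rcorr (ract c h) = rdev c h + rcorr c * h"
proof -
  note v = H.vs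
  have "rcorr (ract c h) = sw scaleH (comult c) (\<lambda>x w. sw scaleH (comultH h) (\<lambda>g k. sw scaleH (comult w) (\<lambda>y z. sw scaleH (comultH k)
      (\<lambda>m n. rdev (ract (ract x g) (S (p (ract y m)))) (p (ract z n))))))"
    unfolding rcorr_def by (subst ract_sw, intro rrules, subst ract_sw) (intro rrules refl)+
  \<comment> \<open>\<open>p\<close> is merely linear, but it commutes with the action on the
    coradical. Replacing \<open>p (ract y m)\<close> by \<open>p y * m\<close> is therefore
    harmless: the difference vanishes for \<open>w\<close> in the coradical, and for
    \<open>x\<close> in \<open>CF n\<close> because \<open>rdev\<close> does.\<close>
  also have "\<dots> = sw scaleH (comult c) (\<lambda>x w. sw scaleH (comultH h) (\<lambda>g k. sw scaleH (comult w) (\<lambda>y z. sw scaleH (comultH k)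
      (\<lambda>m n. rdev (ract (ract x g) (S (p y * m))) (p z * n)))))"
  proof -
    have "sw scaleH (comult c) (\<lambda>x w. sw scaleH (comultH h) (\<lambda>g k. sw scaleH (comult w) (\<lambda>y z. sw scaleH (comultH k)
      (\<lambda>m n. rdev (ract (ract x g) (S (p (ract y m)))) (p (ract z n))))) -
       sw scaleH (comultH h) (\<lambda>g k. sw scaleH (comult w) (\<lambda>y z. sw scaleH (comultH k)
      (\<lambda>m n. rdev (ract (ract x g) (S (p y * m))) (p z * n))))) = 0"
    proof (rule C.filtration_vanish_r[OF c])
      show "bilin scale scale scaleH (\<lambda>x w. sw scaleH (comultH h) (\<lambda>g k. sw scaleH (comult w) (\<lambda>y z. sw scaleH (comultH k)
      (\<lambda>m n. rdev (ract (ract x g) (S (p (ract y m)))) (p (ract z n))))) -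
       sw scaleH (comultH h) (\<lambda>g k. sw scaleH (comult w) (\<lambda>y z. sw scaleH (comultH k)
      (\<lambda>m n. rdev (ract (ract x g) (S (p y * m))) (p z * n)))))"
        by (intro rrules)
      fix x w assume "w \<in> C.C0"
      then obtain a where w: "w = iota a" using C0_iota by blast
      have "sw scaleH (comult w) (\<lambda>y z. sw scaleH (comultH k) (\<lambda>m n. rdev (ract (ract x g) (S (p (ract y m)))) (p (ract z n)))) =
        sw scaleH (comult w) (\<lambda>y z. sw scaleH (comultH k) (\<lambda>m n. rdev (ract (ract x g) (S (p y * m))) (p z * n)))" for g k
        unfolding w by (subst (1 2) iota_sw, (intro rrules)+, simp add: p_iota iota_ract[symmetric])
      then show "sw scaleH (comultH h) (\<lambda>g k. sw scaleH (comult w) (\<lambda>y z. sw scaleH (comultH k)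
      (\<lambda>m n. rdev (ract (ract x g) (S (p (ract y m)))) (p (ract z n))))) -
       sw scaleH (comultH h) (\<lambda>g k. sw scaleH (comult w) (\<lambda>y z. sw scaleH (comultH k)
      (\<lambda>m n. rdev (ract (ract x g) (S (p y * m))) (p z * n)))) = 0" by simp
    next
      fix x w assume "x \<in> C.CF n"
      then show "sw scaleH (comultH h) (\<lambda>g k. sw scaleH (comult w) (\<lambda>y z. sw scaleH (comultH k)
      (\<lambda>m n. rdev (ract (ract x g) (S (p (ract y m)))) (p (ract z n))))) -
       sw scaleH (comultH h) (\<lambda>g k. sw scaleH (comult w) (\<lambda>y z. sw scaleH (comultH k)
      (\<lambda>m n. rdev (ract (ract x g) (S (p y * m))) (p z * n)))) = 0"
        by (simp add: rdev_CF CF_ract sw_zero[OF v])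
    qed
    then show ?thesis by (simp add: sw_diff[OF v])
  qed
  also have "\<dots> = sw scaleH (comult c) (\<lambda>x w. sw scaleH (comult w) (\<lambda>y z. rdev (ract x (S (p y))) (p z * h)))"
  proof -
    have "sw scaleH (comultH h) (\<lambda>g k. sw scaleH (comult w) (\<lambda>y z. sw scaleH (comultH k) (\<lambda>m n. rdev (ract (ract x g) (S (p y * m))) (p z * n))))
      = sw scaleH (comult w) (\<lambda>y z. rdev (ract x (S (p y))) (p z * h))" for x w
    proof -
      have "sw scaleH (comultH h) (\<lambda>g k. sw scaleH (comult w) (\<lambda>y z. sw scaleH (comultH k) (\<lambda>m n. rdev (ract (ract x g) (S (p y * m))) (p z * n))))
       = sw scaleH (comult w) (\<lambda>y z. sw scaleH (comultH h) (\<lambda>g k. sw scaleH (comultH k) (\<lambda>m n. rdev (ract x (g * S m * S (p y))) (p z * n))))"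
        by (subst sw_swap[OF v]) (simp add: H.antipode_mult ract_mult mult.assoc)
      also have "\<dots> = sw scaleH (comult w) (\<lambda>y z. sw scaleH (comultH h) (\<lambda>e n. sw scaleH (comultH e) (\<lambda>g m. rdev (ract x (g * S m * S (p y))) (p z * n))))"
        by (subst H.coassoc_sw[symmetric]) (intro rrules refl)+
      also have "\<dots> = sw scaleH (comult w) (\<lambda>y z. sw scaleH (comultH h) (\<lambda>e n. scaleH (counitH e) (rdev (ract x (1 * S (p y))) (p z * n))))"
        by (subst H.antipode_sw_right[where L = "\<lambda>t. rdev (ract x (t * S (p y))) (p z * n)" for y z n]) (intro rrules refl)+
      also have "\<dots> = sw scaleH (comult w) (\<lambda>y z. rdev (ract x (1 * S (p y))) (p z * h))"
        by (subst H.counit_sw_left) (intro rrules refl)+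
      finally show ?thesis by simp
    qed
    then show ?thesis by simp
  qed
  also have "\<dots> = sw scaleH (comult c) (\<lambda>x w. sw scaleH (comult w) (\<lambda>y z. rdev (ract x (S (p y) * p z)) h)) + rcorr c * h"
  proof -
    have "lin scaleH scaleH (\<lambda>z. z * h)" by (intro rrules)
    from lin_sw[OF this] have "sw scaleH t B * h = sw scaleH t (\<lambda>x y. B x y * h)" for t :: "('c \<times> 'c \<Rightarrow>\<^sub>0 'k)" and B .
    then show ?thesis by (simp add: rcorr_def rdev_mult sw_add[OF v] ract_mult)
  qed
  \<comment> \<open>Likewise \<open>S (p y) * p z\<close> need not collapse to the counit in
    general. It does for \<open>w\<close> in the coradical, where \<open>p\<close> inverts
    \<open>iota\<close>, and the remaining contribution is killed by \<open>rdev\<close> on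
    \<open>CF n\<close>.\<close>
  also have "sw scaleH (comult c) (\<lambda>x w. sw scaleH (comult w) (\<lambda>y z. rdev (ract x (S (p y) * p z)) h)) =
     sw scaleH (comult c) (\<lambda>x w. scaleH (counit w) (rdev x h))"
  proof -
    have "sw scaleH (comult c) (\<lambda>x w. sw scaleH (comult w) (\<lambda>y z. rdev (ract x (S (p y) * p z)) h) - scaleH (counit w) (rdev x h)) = 0"
    proof (rule C.filtration_vanish_r[OF c])
      show "bilin scale scale scaleH (\<lambda>x w. sw scaleH (comult w) (\<lambda>y z. rdev (ract x (S (p y) * p z)) h) - scaleH (counit w) (rdev x h))"
        by (intro rrules)
      fix x w assume "w \<in> C.C0"
      then obtain a where w: "w = iota a" using C0_iota by blast
      have "sw scaleH (comult w) (\<lambda>y z. rdev (ract x (S (p y) * p z)) h) = sw scaleH (comultH a) (\<lambda>y z. rdev (ract x (S (p (iota y)) * p (iota z))) h)"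
        unfolding w by (rule iota_sw) (intro rrules)
      also have "\<dots> = sw scaleH (comultH a) (\<lambda>y z. rdev (ract x (S y * z)) h)" by (simp add: p_iota)
      also have "\<dots> = scaleH (counitH a) (rdev (ract x 1) h)"
        by (rule H.antipode_sw_left) (intro rrules)
      finally show "sw scaleH (comult w) (\<lambda>y z. rdev (ract x (S (p y) * p z)) h) - scaleH (counit w) (rdev x h) = 0"
        by (simp add: w counit_iota ract_one)
    next
      fix x w assume "x \<in> C.CF n"
      then show "sw scaleH (comult w) (\<lambda>y z. rdev (ract x (S (p y) * p z)) h) - scaleH (counit w) (rdev x h) = 0"
        by (simp add: rdev_CF CF_ract sw_zero[OF v] vs_zeror[OF v])
    qed
    then show ?thesis by (simp add: sw_diff[OF v])
  qed
  also have "\<dots> = rdev c h" by (rule C.counit_sw_right) (intro rrules)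
  finally show ?thesis .
qed

lemma ract_extension:
  obtains f' where "lin scale scaleH f'" "\<And>c. c \<in> C.CF n \<Longrightarrow> f' c = f c"
    "\<And>c h. c \<in> C.CF (Suc n) \<Longrightarrow> f' (ract c h) = f' c * h"
proof (rule that)
  show "lin scale scaleH (\<lambda>c. f c - rcorr c)" by (intro rules lin_comp[OF f] lin_comp[OF lin_rcorr])
qed (use rcorr_CF rcorr_ract in \<open>auto simp del: coradical_filtration.simps simp: algebra_simps rdev_def\<close>)

end

text \<open>Each extension step fixes the map on the previous layer but involves a choice beyond it,
  so dependent choice collects the steps into one sequence that stabilises on every layer. The same
  linear \<open>p\<close> serves as substitute for the coaction at all stages.\<close>

lemma right_linear_retraction:
  obtains f where "lin scale scaleH f" "\<And>x. f (iota x) = x" "\<And>c h. f (ract c h) = f c * h"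
proof -
  obtain p where p: "lin scale scaleH p" "\<And>x. p (iota x) = x" by (rule linear_retraction) blast
  let ?P = "\<lambda>n f. lin scale scaleH f \<and> (\<forall>x. f (iota x) = x) \<and> (\<forall>c\<in>C.CF n. \<forall>h. f (ract c h) = f c * h)"
  have "\<exists>F. \<forall>n. ?P n (F n) \<and> (\<forall>c\<in>C.CF n. F (Suc n) c = F n c)"
  proof (rule dependent_nat_choice)
    have "p (ract c h) = p c * h" if "c \<in> C.CF 0" for c h
      using C0_iota[of c] that p(2) by (auto simp: iota_ract[symmetric])
    then show "\<exists>f. ?P 0 f" using p by blast
  next
    fix f n assume f: "?P n f"
    obtain f' where "lin scale scaleH f'" "\<And>c. c \<in> C.CF n \<Longrightarrow> f' c = f c"
       "\<And>c h. c \<in> C.CF (Suc n) \<Longrightarrow> f' (ract c h) = f' c * h"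
      by (rule ract_extension[OF p, of f n]) (use f in auto)
    moreover have "iota x \<in> C.CF n" for x using C.CF_mono[of 0 n] iota_C0[of x] by auto
    ultimately show "\<exists>f'. ?P (Suc n) f' \<and> (\<forall>c\<in>C.CF n. f' c = f c)" using f
      by (intro exI[of _ f']) (auto simp del: coradical_filtration.simps)
  qed
  then obtain F where F: "\<And>n. lin scale scaleH (F n)" "\<And>n x. F n (iota x) = x"
     "\<And>n c h. c \<in> C.CF n \<Longrightarrow> F n (ract c h) = F n c * h" "\<And>n c. c \<in> C.CF n \<Longrightarrow> F (Suc n) c = F n c" by blast
  have L: "C.stable_limit F c = F n c" if "c \<in> C.CF n" for c n by (rule C.stable_limit) (use F that in auto)
  show ?thesis
  proof (rule that[of "C.stable_limit F"])
    show "lin scale scaleH (C.stable_limit F)" by (rule C.lin_stable_limit) (use F in auto)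
    show "C.stable_limit F (iota x) = x" for x using L[of "iota x" 0] iota_C0 F(2) by simp
    show "C.stable_limit F (ract c h) = C.stable_limit F c * h" for c h
    proof -
      obtain n where "c \<in> C.CF n" "ract c h \<in> C.CF n" by (rule C.common_CF[of c "ract c h" c])
      then show ?thesis using L F(3) by simp
    qed
  qed
qed

theorem right_retraction:
  "\<exists>\<pi>. coalgebra_map scale comult counit scaleH comultH counitH \<pi> \<and>
     (\<forall>c h. \<pi> (ract c h) = \<pi> c * h) \<and> (\<forall>x. \<pi> (iota x) = x)"
proof -
  obtain lam where lam: "left_integral scaleH comultH lam" "lam 1 = 1" by (rule exists_integral) blast
  obtain f where f: "lin scale scaleH f" "\<And>x. f (iota x) = x" "\<And>c h. f (ract c h) = f c * h"
    by (rule right_linear_retraction) blast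
  show ?thesis
    using coalgebra_map_newton_limit[OF lam f(1,2)] newton_limit_ract[OF lam f] newton_limit_iota[OF lam f(1,2)] by blast
qed

end

section \<open>Bimodule coalgebras\<close>

locale hopf_coradical_bimodule =
  hopf_coradical scaleH comultH counitH antipode scale comult counit ract iota +
  bimodule_coalgebra scaleH comultH counitH scale comult counit lact ract
  for scaleH :: "'k::field \<Rightarrow> 'h::ring_1 \<Rightarrow> 'h" and comultH counitH antipode
    and scale :: "'k \<Rightarrow> 'c::ab_group_add \<Rightarrow> 'c" and comult counit and ract iota lact +
  assumes iota_lact: "iota (h * x) = lact h (iota x)"
begin

lemma lin_lact_l: assumes "lin s scaleH g" shows "lin s scale (\<lambda>x. lact (g x) a)"
  by (rule linI) (simp_all add: C.vs lin_vs[OF assms] lin_add[OF assms] lin_scale[OF assms] lact_add_left lact_scale_left)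
lemma lin_lact_r: assumes "lin s scale g" shows "lin s scale (\<lambda>x. lact a (g x))"
  by (rule linI) (simp_all add: C.vs lin_vs[OF assms] lin_add[OF assms] lin_scale[OF assms] lact_add_right lact_scale_right)

lemma lact_sw: assumes B: "bilin scale scale s B"
  shows "sw s (comult (lact h c)) B = sw s (comultH h) (\<lambda>g k. sw s (comult c) (\<lambda>x y. B (lact g x) (lact k y)))"
  by (subst sw_eq[OF B comult_lact], rule sw_act[OF bilin_vs[OF B]])

context
  fixes lam f
  assumes lam: "ad_invariant_integral scaleH comultH counitH antipode lam"
    and f: "lin scale scaleH f" and f_iota: "\<And>x. f (iota x) = x"
begin

lemma lin_lam': "lin scaleH (*) lam" using lam by (simp add: ad_invariant_integral_def left_integral_def)

lemmas lrules = rules lin_lact_l lin_lact_r lin_dev[OF f] lin_devB lin_comp[OF lin_lam'] lin_comp[OF f]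

lemma dev_lact:
  assumes fl: "\<And>h c. f (lact h c) = h * f c" and B: "bilin scaleH scaleH s B"
  shows "dev s f B (lact k y) = dev s f (\<lambda>a b. sw s (comultH k) (\<lambda>m n. B (m * a) (n * b))) y"
proof -
  note r = lrules bilin_l[OF B] bilin_r[OF B]
  have "sw s (comult (lact k y)) (\<lambda>x y. B (f x) (f y)) = sw s (comultH k) (\<lambda>m n. sw s (comult y) (\<lambda>u v. B (f (lact m u)) (f (lact n v))))"
    by (rule lact_sw) (intro r)
  then show ?thesis
    by (simp add: dev_def fl H.mult_sw[OF B] sw_swap[OF bilin_vs[OF B], of "comultH k"])
qed

text \<open>As in \<open>newton_ract\<close>, except that the two legs of \<open>h\<close> to be
  absorbed surround the argument of \<open>lam\<close>; absorbing them takes ad-invariance, through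
  \<open>theta_left\<close>.\<close>

lemma newton_lact:
  assumes fl: "\<And>h c. f (lact h c) = h * f c"
  shows "newton lam f (lact h c) = h * newton lam f c"
proof -
  have "correction lam f (lact h c) = sw scaleH (comultH h) (\<lambda>g k. sw scaleH (comult c) (\<lambda>x y.
     dev scaleH f (\<lambda>p q. scaleH (lam (f (lact g x) * S p)) q) (lact k y)))"
    unfolding correction_def by (rule lact_sw) (intro lrules)
  also have "\<dots> = sw scaleH (comultH h) (\<lambda>g k. sw scaleH (comult c) (\<lambda>x y. dev scaleH f (\<lambda>a b. sw scaleH (comultH k) (\<lambda>m n.
     scaleH (lam (g * f x * S (m * a))) (n * b))) y))"
    by (subst dev_lact[OF fl]) (intro lrules, simp add: fl)
  also have "\<dots> = sw scaleH (comult c) (\<lambda>x y. dev scaleH f (\<lambda>a b. sw scaleH (comultH h) (\<lambda>g k. sw scaleH (comultH k) (\<lambda>m n.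
     scaleH (lam (g * f x * S (m * a))) (n * b)))) y)"
    by (subst sw_swap[OF H.vs]) (simp add: sw_dev[OF H.vs])
  also have "\<dots> = sw scaleH (comult c) (\<lambda>x y. dev scaleH f (\<lambda>a b. scaleH (lam (f x * S a)) (h * b)) y)"
  proof -
    have "sw scaleH (comultH h) (\<lambda>g k. sw scaleH (comultH k) (\<lambda>m n. scaleH (lam (g * z * S (m * a))) (n * b)))
      = scaleH (lam (z * S a)) (h * b)" for z a b
    proof -
      have "sw scaleH (comultH h) (\<lambda>g k. sw scaleH (comultH k) (\<lambda>m n. scaleH (lam (g * z * S (m * a))) (n * b))) =
         sw scaleH (comultH h) (\<lambda>w n. sw scaleH (comultH w) (\<lambda>g m. scaleH (lam (g * z * S (m * a))) (n * b)))"
        by (rule H.coassoc_sw[symmetric]) (intro lrules)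
      also have "\<dots> = sw scaleH (comultH h) (\<lambda>w n. scaleH (counitH w) (scaleH (lam (z * S a)) (n * b)))"
      proof (rule sw_cong)
        fix w n
        have "lin (*) scaleH (\<lambda>t. scaleH t (n * b))" by (intro lrules)
        from lin_sw[OF this, of "comultH w" "\<lambda>g m. lam (g * z * S (m * a))"]
        show "sw scaleH (comultH w) (\<lambda>g m. scaleH (lam (g * z * S (m * a))) (n * b)) = scaleH (counitH w) (scaleH (lam (z * S a)) (n * b))"
          unfolding H.theta_left[OF lam] by simp
      qed
      also have "\<dots> = scaleH (lam (z * S a)) (h * b)" by (rule H.counit_sw_left) (intro lrules)
      finally show ?thesis .
    qed
    then show ?thesis by simp
  qed
  also have "\<dots> = h * correction lam f c"
  proof -
    have l: "lin scaleH scaleH (\<lambda>z. h * z)" by (intro lrules)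
    show ?thesis unfolding correction_def lin_sw[OF l] lin_dev_comp[OF l] by (simp add: H.scale_mult_right)
  qed
  finally show ?thesis by (simp add: newton_def fl distrib_left)
qed

end

lemma bimodule_retraction:
  assumes lam: "ad_invariant_integral scaleH comultH counitH antipode lam"
    and f: "lin scale scaleH f" "\<And>x. f (iota x) = x" "\<And>h c. f (lact h c) = h * f c" "\<And>c h. f (ract c h) = f c * h"
  shows "\<exists>\<pi>. coalgebra_map scale comult counit scaleH comultH counitH \<pi> \<and>
     (\<forall>h c. \<pi> (lact h c) = h * \<pi> c) \<and> (\<forall>c h. \<pi> (ract c h) = \<pi> c * h) \<and> (\<forall>x. \<pi> (iota x) = x)"
proof -
  have l: "left_integral scaleH comultH lam" "lam 1 = 1" using lam by (auto simp: ad_invariant_integral_def)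
  note L = newton_limit_CF[OF l f(1,2)]
  have *: "newton_iter lam f n (lact h c) = h * newton_iter lam f n c" for n c h
  proof (induction n arbitrary: c h)
    case (Suc n)
    show ?case using newton_lact[OF lam _ _ Suc] newton_iter[OF l f(1,2), of n] by simp
  qed (use f in simp)
  have "newton_limit lam f (lact h c) = h * newton_limit lam f c" for h c
  proof -
    obtain n where "c \<in> C.CF n" "lact h c \<in> C.CF n" by (rule C.common_CF[of c "lact h c" c])
    then show ?thesis by (simp add: L *)
  qed
  then show ?thesis
    using coalgebra_map_newton_limit[OF l f(1,2)] newton_limit_ract[OF l f(1,2,4)] newton_limit_iota[OF l f(1,2)] by blast
qed

text \<open>\<open>f\<close> is composed with the projection of \<open>CF (Suc n)\<close> to
  \<open>CF n\<close> along the complement \<open>D\<close>. Maps are total, so \<open>q\<close>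
  first carries all of C linearly into \<open>CF (Suc n)\<close>; \<open>q\<close> ignores the
  actions, which is why \<open>r\<close> commutes with them only on that layer. The properties of
  \<open>r\<close> are checked through uniqueness of the decomposition.\<close>

lemma summand_extension:
  assumes f: "lin scale scaleH f" and fn: "\<And>c h. c \<in> C.CF n \<Longrightarrow> f (ract c h) = f c * h" "\<And>c h. c \<in> C.CF n \<Longrightarrow> f (lact h c) = h * f c"
    and sm: "bimodule_direct_summand scale lact ract (C.CF n) (C.CF (Suc n))"
  obtains f' where "lin scale scaleH f'" "\<And>c. c \<in> C.CF n \<Longrightarrow> f' c = f c"
    "\<And>c h. c \<in> C.CF (Suc n) \<Longrightarrow> f' (ract c h) = f' c * h" "\<And>c h. c \<in> C.CF (Suc n) \<Longrightarrow> f' (lact h c) = h * f' c"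
proof -
  obtain D where D: "sub_bimodule scale lact ract D" "C.CF n \<inter> D = {0}" "{x + y |x y. x \<in> C.CF n \<and> y \<in> D} = C.CF (Suc n)"
    and bn: "sub_bimodule scale lact ract (C.CF n)" and bS: "sub_bimodule scale lact ract (C.CF (Suc n))"
    using sm unfolding bimodule_direct_summand_def by blast
  have sD: "C.subspace D" using D(1) by (simp add: sub_bimodule_def)
  obtain q where q: "lin scale scale q" "\<And>x. q x \<in> C.CF (Suc n)" "\<And>x. x \<in> C.CF (Suc n) \<Longrightarrow> q x = x"
    by (rule subspace_projection[OF C.vs C.subspace_CF[of "Suc n"]]) auto
  have "\<exists>u. u \<in> C.CF n \<and> q x - u \<in> D" for x
  proof -
    have "q x \<in> {x + y |x y. x \<in> C.CF n \<and> y \<in> D}" using q(2) D(3) by blast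
    then obtain u w where "q x = u + w" "u \<in> C.CF n" "w \<in> D" by blast
    then show ?thesis by (intro exI[of _ u]) simp
  qed
  then obtain r where r: "\<And>x. r x \<in> C.CF n" "\<And>x. q x - r x \<in> D" by metis
  have uniq: "r x = u" if "u \<in> C.CF n" "q x - u \<in> D" for x u
  proof -
    have "(q x - u) - (q x - r x) \<in> D" by (rule C.subspace_diff[OF sD that(2) r(2)])
    moreover have "r x - u \<in> C.CF n" by (rule C.subspace_diff[OF C.subspace_CF r(1) that(1)])
    ultimately have "r x - u \<in> C.CF n \<inter> D" by simp
    then show ?thesis using D(2) by simp
  qed
  have lr: "lin scale scale r"
  proof (rule linI[OF C.vs C.vs])
    fix x y a
    show "r (x + y) = r x + r y"
      using C.subspace_add[OF sD r(2)[of x] r(2)[of y]]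
      by (intro uniq C.subspace_add[OF C.subspace_CF] r) (simp add: lin_add[OF q(1)] algebra_simps)
    show "r (scale a x) = scale a (r x)"
      using C.subspace_scale[OF sD r(2)[of x], of a]
      by (intro uniq C.subspace_scale[OF C.subspace_CF] r) (simp add: lin_scale[OF q(1)] C.scale_right_diff_distrib)
  qed
  have rr: "r (ract c h) = ract (r c) h" "r (lact h c) = lact h (r c)" if c: "c \<in> C.CF (Suc n)" for c h
  proof -
    have i: "ract c h \<in> C.CF (Suc n)" "lact h c \<in> C.CF (Suc n)" "ract (r c) h \<in> C.CF n" "lact h (r c) \<in> C.CF n"
      "ract (q c - r c) h \<in> D" "lact h (q c - r c) \<in> D"
      using bS bn D(1) c r[of c] unfolding sub_bimodule_def by blast+
    have e: "ract (q c - r c) h = ract c h - ract (r c) h" "lact h (q c - r c) = lact h c - lact h (r c)"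
      using lin_diff[OF lin_ract_l[OF lin_id[OF C.vs]], of "q c" "r c" h] lin_diff[OF lin_lact_r[OF lin_id[OF C.vs]], of h "q c" "r c"] q(3)[OF c]
      by simp_all
    show "r (ract c h) = ract (r c) h" "r (lact h c) = lact h (r c)"
      using i e by (auto intro!: uniq simp del: coradical_filtration.simps simp: q(3))
  qed
  have rn: "r c = c" if "c \<in> C.CF n" for c
  proof (rule uniq[OF that])
    have "c \<in> C.CF (Suc n)" using that C.CF_Suc by blast
    then show "q c - c \<in> D" using q(3) C.subspace_0[OF sD] by simp
  qed
  show ?thesis
  proof (rule that[of "\<lambda>x. f (r x)"])
    show "lin scale scaleH (\<lambda>x. f (r x))" by (rule lin_comp[OF f lr])
  qed (simp_all only: rn rr fn r)
qed

theorem retraction_of_summands: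
  assumes lam: "ad_invariant_integral scaleH comultH counitH antipode lam"
    and sm: "\<And>n. bimodule_direct_summand scale lact ract (C.CF n) (C.CF (Suc n))"
  shows "\<exists>\<pi>. coalgebra_map scale comult counit scaleH comultH counitH \<pi> \<and>
     (\<forall>h c. \<pi> (lact h c) = h * \<pi> c) \<and> (\<forall>c h. \<pi> (ract c h) = \<pi> c * h) \<and> (\<forall>x. \<pi> (iota x) = x)"
proof -
  obtain p where p: "lin scale scaleH p" "\<And>x. p (iota x) = x" by (rule linear_retraction) blast
  let ?P = "\<lambda>n f. lin scale scaleH f \<and> (\<forall>x. f (iota x) = x) \<and> (\<forall>c\<in>C.CF n. \<forall>h. f (ract c h) = f c * h \<and> f (lact h c) = h * f c)"
  have "\<exists>F. \<forall>n. ?P n (F n) \<and> (\<forall>c\<in>C.CF n. F (Suc n) c = F n c)"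
  proof (rule dependent_nat_choice)
    have "p (ract c h) = p c * h \<and> p (lact h c) = h * p c" if "c \<in> C.CF 0" for c h
      using C0_iota[of c] that p(2) by (auto simp: iota_ract[symmetric] iota_lact[symmetric])
    then show "\<exists>f. ?P 0 f" using p by blast
  next
    fix f n assume f: "?P n f"
    obtain f' where "lin scale scaleH f'" "\<And>c. c \<in> C.CF n \<Longrightarrow> f' c = f c"
       "\<And>c h. c \<in> C.CF (Suc n) \<Longrightarrow> f' (ract c h) = f' c * h" "\<And>c h. c \<in> C.CF (Suc n) \<Longrightarrow> f' (lact h c) = h * f' c"
      by (rule summand_extension[of f n, OF _ _ _ sm]) (use f in auto)
    moreover have "iota x \<in> C.CF n" for x using C.CF_mono[of 0 n] iota_C0[of x] by auto
    ultimately show "\<exists>f'. ?P (Suc n) f' \<and> (\<forall>c\<in>C.CF n. f' c = f c)" using f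
      by (intro exI[of _ f']) (auto simp del: coradical_filtration.simps)
  qed
  then obtain F where F: "\<And>n. lin scale scaleH (F n)" "\<And>n x. F n (iota x) = x"
     "\<And>n c h. c \<in> C.CF n \<Longrightarrow> F n (ract c h) = F n c * h" "\<And>n c h. c \<in> C.CF n \<Longrightarrow> F n (lact h c) = h * F n c"
     "\<And>n c. c \<in> C.CF n \<Longrightarrow> F (Suc n) c = F n c" by blast
  have L: "C.stable_limit F c = F n c" if "c \<in> C.CF n" for c n by (rule C.stable_limit) (use F that in auto)
  show ?thesis
  proof (rule bimodule_retraction[OF lam])
    show "lin scale scaleH (C.stable_limit F)" by (rule C.lin_stable_limit) (use F in auto)
    show "C.stable_limit F (iota x) = x" for x using L[of "iota x" 0] iota_C0 F(2) by simp
    show "C.stable_limit F (ract c h) = C.stable_limit F c * h" "C.stable_limit F (lact h c) = h * C.stable_limit F c" for c h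
    proof -
      obtain n where "c \<in> C.CF n" "ract c h \<in> C.CF n" "lact h c \<in> C.CF n" by (rule C.common_CF[of c "ract c h" "lact h c"])
      then show "C.stable_limit F (ract c h) = C.stable_limit F c * h" "C.stable_limit F (lact h c) = h * C.stable_limit F c"
        using L F(3,4) by simp_all
    qed
  qed
qed

theorem retraction_of_semisimple:
  assumes ss: "semisimple_algebra scaleH"
  shows "\<exists>\<pi>. coalgebra_map scale comult counit scaleH comultH counitH \<pi> \<and>
     (\<forall>h c. \<pi> (lact h c) = h * \<pi> c) \<and> (\<forall>c h. \<pi> (ract c h) = \<pi> c * h) \<and> (\<forall>x. \<pi> (iota x) = x)"
proof -
  obtain lam where "left_integral scaleH comultH lam" "right_integral scaleH comultH lam" "lam 1 = 1" by (rule exists_integral)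
  then have lam: "ad_invariant_integral scaleH comultH counitH antipode lam" by (rule H.semisimple_ad_invariant[OF ss])
  obtain \<Lambda> where L: "\<And>h. h * \<Lambda> = scaleH (counitH h) \<Lambda>" "\<And>h. \<Lambda> * h = scaleH (counitH h) \<Lambda>" "counitH \<Lambda> = 1"
    by (rule H.semisimple_integral_element[OF ss]) blast
  obtain p where p: "lin scale scaleH p" "\<And>x. p (iota x) = x" by (rule linear_retraction) blast
  \<comment> \<open>Maschke averaging of \<open>p\<close>: \<open>f(c) = \<Lambda>\<^sub>1 p(S(\<Lambda>\<^sub>2) c S(\<Lambda>'\<^sub>1)) \<Lambda>'\<^sub>2\<close>\<close>
  define f where "f c = sw scaleH (comultH \<Lambda>) (\<lambda>a b. sw scaleH (comultH \<Lambda>) (\<lambda>u v. a * p (ract (lact (S b) c) (S u)) * v))" for c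
  note r = rules lin_comp[OF p(1)] lin_lact_l lin_lact_r
  \<comment> \<open>The two copies of \<open>\<Lambda>\<close> are arranged oppositely:
    \<open>a\<close>, \<open>S b\<close> has the Casimir property that carries a left factor
    \<open>h\<close> across, while \<open>S u\<close>, \<open>v\<close> has the one for right
    factors. On the image of \<open>iota\<close> both pairs cancel to the counit of
    \<open>\<Lambda>\<close>, which is 1.\<close>
  have fl: "f (lact h c) = h * f c" for h c
  proof -
    have "bilin scaleH scaleH scaleH (\<lambda>a b. sw scaleH (comultH \<Lambda>) (\<lambda>u v. a * p (ract (lact b c) (S u)) * v))" by (intro r)
    from H.integral_element_left[OF L(1) this, of h]
    have "f (lact h c) = sw scaleH (comultH \<Lambda>) (\<lambda>a b. sw scaleH (comultH \<Lambda>) (\<lambda>u v. h * a * p (ract (lact (S b) c) (S u)) * v))"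
      by (simp add: f_def lact_mult)
    also have "\<dots> = h * f c"
    proof -
      have l: "lin scaleH scaleH (\<lambda>z. h * z)" by (intro r)
      show ?thesis unfolding f_def lin_sw[OF l] by (simp add: mult.assoc)
    qed
    finally show ?thesis .
  qed
  have fr: "f (ract c h) = f c * h" for h c
  proof -
    have "sw scaleH (comultH \<Lambda>) (\<lambda>u v. a * p (ract (lact b (ract c h)) (S u)) * v) = sw scaleH (comultH \<Lambda>) (\<lambda>u v. a * p (ract (lact b c) (S u)) * (v * h))" for a b
    proof -
      have "bilin scaleH scaleH scaleH (\<lambda>u v. a * p (ract (lact b c) u) * v)" by (intro r)
      from H.integral_element_right[OF L(2) this, of h] show ?thesis
        by (simp add: ract_mult lact_ract)
    qed
    then have "f (ract c h) = sw scaleH (comultH \<Lambda>) (\<lambda>a b. sw scaleH (comultH \<Lambda>) (\<lambda>u v. a * p (ract (lact (S b) c) (S u)) * (v * h)))"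
      by (simp add: f_def)
    also have "\<dots> = f c * h"
    proof -
      have l: "lin scaleH scaleH (\<lambda>z. z * h)" by (intro r)
      show ?thesis unfolding f_def lin_sw[OF l] by (simp add: mult.assoc)
    qed
    finally show ?thesis .
  qed
  have fi: "f (iota x) = x" for x
  proof -
    have "f (iota x) = sw scaleH (comultH \<Lambda>) (\<lambda>a b. sw scaleH (comultH \<Lambda>) (\<lambda>u v. a * S b * x * (S u * v)))"
      by (simp add: f_def iota_lact[symmetric] iota_ract[symmetric] p(2) mult.assoc)
    also have "\<dots> = sw scaleH (comultH \<Lambda>) (\<lambda>a b. scaleH (counitH \<Lambda>) (a * S b * x * 1))"
      by (subst H.antipode_sw_left) (intro r refl)+
    also have "\<dots> = sw scaleH (comultH \<Lambda>) (\<lambda>a b. a * S b * x)" by (simp add: L(3))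
    also have "\<dots> = scaleH (counitH \<Lambda>) (1 * x)" by (rule H.antipode_sw_right) (intro r)
    finally show ?thesis by (simp add: L(3))
  qed
  have "lin scale scaleH f" unfolding f_def by (intro r)
  from bimodule_retraction[OF lam this fi fl fr] show ?thesis .
qed

end

theorem theorem5p9:
  fixes sH :: "'k::field \<Rightarrow> 'h::ring_1 \<Rightarrow> 'h"
    and \<Delta>H :: "'h \<Rightarrow> ('h \<times> 'h \<Rightarrow>\<^sub>0 'k)"
    and \<epsilon>H :: "'h \<Rightarrow> 'k"
    and S :: "'h \<Rightarrow> 'h"
  assumes hopf: "hopf_algebra sH \<Delta>H \<epsilon>H S"
  shows
    "(\<forall>(sC :: 'k \<Rightarrow> 'c::ab_group_add \<Rightarrow> 'c) \<Delta>C \<epsilon>C ract \<iota>.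
        right_module_coalgebra sH \<Delta>H \<epsilon>H sC \<Delta>C \<epsilon>C ract \<and>
        coradical_identification sH \<Delta>H \<epsilon>H sC \<Delta>C \<epsilon>C \<iota> \<and>
        (\<forall>x h. \<iota> (x * h) = ract (\<iota> x) h) \<longrightarrow>
        (\<exists>\<pi>. coalgebra_map sC \<Delta>C \<epsilon>C sH \<Delta>H \<epsilon>H \<pi> \<and>
             (\<forall>c h. \<pi> (ract c h) = \<pi> c * h) \<and>
             (\<forall>x. \<pi> (\<iota> x) = x)))
     \<and>
     (\<forall>(sC :: 'k \<Rightarrow> 'c::ab_group_add \<Rightarrow> 'c) \<Delta>C \<epsilon>C lact ract \<iota>.
        bimodule_coalgebra sH \<Delta>H \<epsilon>H sC \<Delta>C \<epsilon>C lact ract \<and>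
        coradical_identification sH \<Delta>H \<epsilon>H sC \<Delta>C \<epsilon>C \<iota> \<and>
        (\<forall>h x. \<iota> (h * x) = lact h (\<iota> x)) \<and>
        (\<forall>x h. \<iota> (x * h) = ract (\<iota> x) h) \<and>
        (\<exists>lam. ad_invariant_integral sH \<Delta>H \<epsilon>H S lam) \<and>
        (\<forall>n. bimodule_direct_summand sC lact ract
               (coradical_filtration sC \<Delta>C n) (coradical_filtration sC \<Delta>C (Suc n))) \<longrightarrow>
        (\<exists>\<pi>. coalgebra_map sC \<Delta>C \<epsilon>C sH \<Delta>H \<epsilon>H \<pi> \<and>
             (\<forall>h c. \<pi> (lact h c) = h * \<pi> c) \<and>
             (\<forall>c h. \<pi> (ract c h) = \<pi> c * h) \<and>
             (\<forall>x. \<pi> (\<iota> x) = x)))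
     \<and>
     (\<forall>(sC :: 'k \<Rightarrow> 'c::ab_group_add \<Rightarrow> 'c) \<Delta>C \<epsilon>C lact ract \<iota>.
        bimodule_coalgebra sH \<Delta>H \<epsilon>H sC \<Delta>C \<epsilon>C lact ract \<and>
        coradical_identification sH \<Delta>H \<epsilon>H sC \<Delta>C \<epsilon>C \<iota> \<and>
        (\<forall>h x. \<iota> (h * x) = lact h (\<iota> x)) \<and>
        (\<forall>x h. \<iota> (x * h) = ract (\<iota> x) h) \<and>
        semisimple_algebra sH \<longrightarrow>
        (\<exists>\<pi>. coalgebra_map sC \<Delta>C \<epsilon>C sH \<Delta>H \<epsilon>H \<pi> \<and>
             (\<forall>h c. \<pi> (lact h c) = h * \<pi> c) \<and>
             (\<forall>c h. \<pi> (ract c h) = \<pi> c * h) \<and>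
             (\<forall>x. \<pi> (\<iota> x) = x)))"
proof (intro conjI allI impI, goal_cases)
  case (1 sC \<Delta>C \<epsilon>C ract \<iota>)
  then interpret hopf_coradical sH \<Delta>H \<epsilon>H S sC \<Delta>C \<epsilon>C ract \<iota>
    using hopf by (simp add: hopf_coradical_def hopf_coradical_axioms_def)
  show ?case by (rule right_retraction)
next
  case (2 sC \<Delta>C \<epsilon>C lact ract \<iota>)
  then interpret hopf_coradical_bimodule sH \<Delta>H \<epsilon>H S sC \<Delta>C \<epsilon>C ract \<iota> lact
    using hopf unfolding hopf_coradical_bimodule_def hopf_coradical_bimodule_axioms_def
      hopf_coradical_def hopf_coradical_axioms_def bimodule_coalgebra_def by blast
  obtain lam where "ad_invariant_integral sH \<Delta>H \<epsilon>H S lam" using 2 by blast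
  then show ?case using 2 by (intro retraction_of_summands) auto
next
  case (3 sC \<Delta>C \<epsilon>C lact ract \<iota>)
  then interpret hopf_coradical_bimodule sH \<Delta>H \<epsilon>H S sC \<Delta>C \<epsilon>C ract \<iota> lact
    using hopf unfolding hopf_coradical_bimodule_def hopf_coradical_bimodule_axioms_def
      hopf_coradical_def hopf_coradical_axioms_def bimodule_coalgebra_def by blast
  show ?case using 3 by (intro retraction_of_semisimple) blast
qed

end
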